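(* Consider the problem that takes as input an $n$-vertex connected graph $G$ and an integer $k\ge 1$ and decides whether $h(G)\le k$ (respectively, whether $mh(G)\le k$), parameterised by an integer $t$ that is an upper bound on the vertex cover number $vc(G)$. This problem admits a kernel of size at most $4^t(t+1)+2t$. Moreover, it can be solved in time $(4^t(t+1)+2t)^{t+1}\cdot n^{\mathcal{O}(1)}$.
   Context: A kernel of size $f(t)$ for a parameterised problem is an algorithm that, given an instance $(I,t)$, runs in time $(|I|+t)^{\mathcal{O}(1)}$ and outputs an equivalent instance $(I',t')$ (i.e. $(I,t)$ is a yes-instance iff $(I',t')$ is) with $|I'|\le f(t)$ and $t'\le t$. $vc(G)$ is the minimum size of a vertex cover of $G$. Hunters and Rabbit game on a graph $G=(V,E)$. A hunter strategy is a finite sequence $(S_1,\dots,S_\ell)$ of non-empty subsets of $V$, using $\max_i|S_i|$ hunters. A rabbit trajectory is a walk $(r_0,\dots,r_\ell)$ in $G$ ($r_i\in N(r_{i-1})$); the strategy is winning if every rabbit trajectory has some $j<\ell$ with $r_j\in S_{j+1}$. $h(G)$ is the minimum number of hunters of a winning hunter strategy ($0$ for a single vertex). Contaminated sets: $Z_0=V$, $Z_i=\{x : \exists y\in Z_{i-1}\setminus S_i,\ xy\in E\}$. A vertex $v$ is cleared at round $i$ if $v\in S_i$, or $N(v)\cap Z_{i-1}\ne\emptyset$ and $N(v)\cap Z_{i-1}\subseteq S_i$. A strategy is monotone if any vertex $v$ cleared at some round $i$ satisfies $v\in S_{j+1}$ whenever $j>i$ and $v\in Z_j$. $mh(G)$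 is the minimum number of hunters of a monotone winning hunter strategy ($0$ for a single vertex). *)

theory Defs
  imports Main
begin

section \<open>Graphs\<close>

definition simple_graph :: "'a set \<Rightarrow> ('a \<Rightarrow> 'a \<Rightarrow> bool) \<Rightarrow> bool" where
  "simple_graph V E \<longleftrightarrow> finite V \<and> V \<noteq> {} \<and> (\<forall>u v. E u v \<longrightarrow> u \<in> V \<and> v \<in> V) \<and> symp E \<and> irreflp E"

definition connected_graph :: "'a set \<Rightarrow> ('a \<Rightarrow> 'a \<Rightarrow> bool) \<Rightarrow> bool" where
  "connected_graph V E \<longleftrightarrow> (\<forall>u\<in>V. \<forall>v\<in>V. E\<^sup>*\<^sup>* u v)"

definition nbrs :: "('a \<Rightarrow> 'a \<Rightarrow> bool) \<Rightarrow> 'a \<Rightarrow> 'a set" where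
  "nbrs E v = {u. E v u}"

definition vertex_cover :: "'a set \<Rightarrow> ('a \<Rightarrow> 'a \<Rightarrow> bool) \<Rightarrow> 'a set \<Rightarrow> bool" where
  "vertex_cover V E C \<longleftrightarrow> C \<subseteq> V \<and> (\<forall>u v. E u v \<longrightarrow> u \<in> C \<or> v \<in> C)"

definition vc_number :: "'a set \<Rightarrow> ('a \<Rightarrow> 'a \<Rightarrow> bool) \<Rightarrow> nat" where
  "vc_number V E = (LEAST m. \<exists>C. vertex_cover V E C \<and> card C = m)"


section \<open>The Hunters and Rabbit game\<close>

text \<open>A strategy \<open>(S\<^sub>1, \<dots>, S\<^sub>l)\<close> is a list, so \<open>S\<^sub>i\<close> is \<open>S ! (i - 1)\<close>; in particular
  \<open>S\<^sub>j\<^sub>+\<^sub>1\<close> is \<open>S ! j\<close>.\<close>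

definition hunter_strategy :: "'a set \<Rightarrow> 'a set list \<Rightarrow> bool" where
  "hunter_strategy V S \<longleftrightarrow> S \<noteq> [] \<and> (\<forall>X\<in>set S. X \<noteq> {} \<and> X \<subseteq> V)"

definition hunters_used :: "'a set list \<Rightarrow> nat" where
  "hunters_used S = Max (card ` set S)"

text \<open>A trajectory against a strategy of length \<open>l\<close> is a walk \<open>(r\<^sub>0, \<dots>, r\<^sub>l)\<close>. A single-vertex graph
  has none for \<open>l \<ge> 1\<close>.\<close>

definition rabbit_trajectory :: "'a set \<Rightarrow> ('a \<Rightarrow> 'a \<Rightarrow> bool) \<Rightarrow> nat \<Rightarrow> 'a list \<Rightarrow> bool" where
  "rabbit_trajectory V E l r \<longleftrightarrow>
     length r = l + 1 \<and> set r \<subseteq> V \<and> (\<forall>i\<in>{1..l}. r ! i \<in> nbrs E (r ! (i - 1)))"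

definition winning :: "'a set \<Rightarrow> ('a \<Rightarrow> 'a \<Rightarrow> bool) \<Rightarrow> 'a set list \<Rightarrow> bool" where
  "winning V E S \<longleftrightarrow>
     (\<forall>r. rabbit_trajectory V E (length S) r \<longrightarrow> (\<exists>j<length S. r ! j \<in> S ! j))"

definition hunter_number :: "'a set \<Rightarrow> ('a \<Rightarrow> 'a \<Rightarrow> bool) \<Rightarrow> nat" where
  "hunter_number V E =
     (if card V = 1 then 0
      else LEAST m. \<exists>S. hunter_strategy V S \<and> winning V E S \<and> hunters_used S = m)"

fun contaminated :: "'a set \<Rightarrow> ('a \<Rightarrow> 'a \<Rightarrow> bool) \<Rightarrow> 'a set list \<Rightarrow> nat \<Rightarrow> 'a set" where
  "contaminated V E S 0 = V"
| "contaminated V E S (Suc i) = {x. \<exists>y \<in> contaminated V E S i - S ! i. E x y}"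

definition cleared :: "'a set \<Rightarrow> ('a \<Rightarrow> 'a \<Rightarrow> bool) \<Rightarrow> 'a set list \<Rightarrow> nat \<Rightarrow> 'a \<Rightarrow> bool" where
  "cleared V E S i v \<longleftrightarrow>
     v \<in> S ! (i - 1) \<or>
     (nbrs E v \<inter> contaminated V E S (i - 1) \<noteq> {} \<and>
      nbrs E v \<inter> contaminated V E S (i - 1) \<subseteq> S ! (i - 1))"

text \<open>Rounds are \<open>1, \<dots>, l\<close> and \<open>S\<^sub>j\<^sub>+\<^sub>1\<close> exists only for \<open>j < l\<close>. Leaving out \<open>j = l\<close> is immaterial:
  for a winning strategy no vertex is contaminated after round \<open>l\<close>.\<close>

definition monotone_strategy :: "'a set \<Rightarrow> ('a \<Rightarrow> 'a \<Rightarrow> bool) \<Rightarrow> 'a set list \<Rightarrow> bool" where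
  "monotone_strategy V E S \<longleftrightarrow>
     (\<forall>v\<in>V. \<forall>i\<in>{1..length S}. cleared V E S i v \<longrightarrow>
        (\<forall>j. i < j \<and> j < length S \<and> v \<in> contaminated V E S j \<longrightarrow> v \<in> S ! j))"

definition monotone_hunter_number :: "'a set \<Rightarrow> ('a \<Rightarrow> 'a \<Rightarrow> bool) \<Rightarrow> nat" where
  "monotone_hunter_number V E =
     (if card V = 1 then 0
      else LEAST m. \<exists>S. hunter_strategy V S \<and> winning V E S \<and> monotone_strategy V E S \<and>
                        hunters_used S = m)"


section \<open>Algorithms and running time\<close>

text \<open>Algorithms are programs of a random access machine with uniform cost, presented as a while
  language over finitely many unbounded arrays of natural numbers; a scalar is an array used only at
  index \<open>0\<close>. Addition and truncated subtraction are the only arithmetic operations. Without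
  multiplication or shifts the largest number in memory at most doubles (up to the fixed constants
  of the program) at each operation, so polynomial time in this model is ordinary polynomial time.\<close>

datatype exp =
    Const nat
  | Read string exp
  | Plus exp exp
  | Minus exp exp

datatype com =
    Skip
  | Write string exp exp
  | Seq com com
  | Cond exp com com
  | While exp com

type_synonym state = "string \<Rightarrow> nat \<Rightarrow> nat"

fun aval :: "exp \<Rightarrow> state \<Rightarrow> nat" where
  "aval (Const m) s = m"
| "aval (Read a e) s = s a (aval e s)"
| "aval (Plus e1 e2) s = aval e1 s + aval e2 s"
| "aval (Minus e1 e2) s = aval e1 s - aval e2 s"

fun exp_time :: "exp \<Rightarrow> nat" where
  "exp_time (Const m) = 1"
| "exp_time (Read a e) = exp_time e + 1"
| "exp_time (Plus e1 e2) = exp_time e1 + exp_time e2 + 1"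
| "exp_time (Minus e1 e2) = exp_time e1 + exp_time e2 + 1"

text \<open>\<open>exec c s T s'\<close>: started in \<open>s\<close>, the program \<open>c\<close> halts in \<open>s'\<close> after exactly \<open>T\<close> steps.
  A condition holds iff it evaluates to a nonzero number.\<close>

inductive exec :: "com \<Rightarrow> state \<Rightarrow> nat \<Rightarrow> state \<Rightarrow> bool" where
  Skip: "exec Skip s 1 s"
| Write: "exec (Write a i e) s (exp_time i + exp_time e + 1)
            (s(a := (s a)(aval i s := aval e s)))"
| Seq: "exec c1 s1 T1 s2 \<Longrightarrow> exec c2 s2 T2 s3 \<Longrightarrow> exec (Seq c1 c2) s1 (T1 + T2 + 1) s3"
| CondTrue: "aval b s \<noteq> 0 \<Longrightarrow> exec c1 s T s' \<Longrightarrow> exec (Cond b c1 c2) s (exp_time b + T + 1) s'"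
| CondFalse: "aval b s = 0 \<Longrightarrow> exec c2 s T s' \<Longrightarrow> exec (Cond b c1 c2) s (exp_time b + T + 1) s'"
| WhileTrue: "aval b s1 \<noteq> 0 \<Longrightarrow> exec c s1 T1 s2 \<Longrightarrow> exec (While b c) s2 T2 s3 \<Longrightarrow>
                exec (While b c) s1 (exp_time b + T1 + T2 + 1) s3"
| WhileFalse: "aval b s = 0 \<Longrightarrow> exec (While b c) s (exp_time b + 1) s"

lemma exec_deterministic:
  assumes "exec c s T s'" and "exec c s U s''"
  shows "T = U \<and> s' = s''"
  using assms
proof (induction arbitrary: U s'' rule: exec.induct)
  case (Skip s)
  then show ?case by cases simp
next
  case (Write a i e s)
  then show ?case by cases simp
next
  case (Seq c1 s1 T1 s2 c2 T2 s3)
  from Seq.prems show ?case by cases (use Seq.IH in blast)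
next
  case (CondTrue b s c1 T s' c2)
  from CondTrue.prems show ?case by cases (use CondTrue.hyps CondTrue.IH in blast)+
next
  case (CondFalse b s c2 T s' c1)
  from CondFalse.prems show ?case by cases (use CondFalse.hyps CondFalse.IH in blast)+
next
  case (WhileTrue b s1 c T1 s2 T2 s3)
  from WhileTrue.prems show ?case by cases (use WhileTrue.hyps WhileTrue.IH in blast)+
next
  case (WhileFalse b s c)
  from WhileFalse.prems show ?case by cases (use WhileFalse.hyps in simp_all)
qed


section \<open>The parameterised problem\<close>

text \<open>An \<open>n\<close>-vertex input graph has vertex set \<open>{0, \<dots>, n - 1}\<close>. The parameter \<open>t\<close> is part of the input,
  with the promise that it is an upper bound on the vertex cover number.\<close>

definition is_instance :: "nat \<Rightarrow> (nat \<Rightarrow> nat \<Rightarrow> bool) \<Rightarrow> nat \<Rightarrow> nat \<Rightarrow> bool" where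
  "is_instance n E k t \<longleftrightarrow>
     simple_graph {..<n} E \<and> connected_graph {..<n} E \<and> k \<ge> 1 \<and> vc_number {..<n} E \<le> t"

text \<open>The memory holds an instance as the numbers \<open>n\<close>, \<open>k\<close>, \<open>t\<close> and the adjacency matrix in row-major
  order. The initial memory holds the input and is zero elsewhere; the final memory may contain
  leftovers of the computation.\<close>

definition stores_instance ::
    "state \<Rightarrow> nat \<Rightarrow> (nat \<Rightarrow> nat \<Rightarrow> bool) \<Rightarrow> nat \<Rightarrow> nat \<Rightarrow> bool" where
  "stores_instance s n E k t \<longleftrightarrow>
     s ''n'' 0 = n \<and> s ''k'' 0 = k \<and> s ''t'' 0 = t \<and>
     (\<forall>u<n. \<forall>v<n. s ''adj'' (u * n + v) = (if E u v then 1 else 0))"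

definition input_state :: "nat \<Rightarrow> (nat \<Rightarrow> nat \<Rightarrow> bool) \<Rightarrow> nat \<Rightarrow> nat \<Rightarrow> state" where
  "input_state n E k t =
     (\<lambda>_ _. 0)
       (''n'' := (\<lambda>_. 0)(0 := n),
        ''k'' := (\<lambda>_. 0)(0 := k),
        ''t'' := (\<lambda>_. 0)(0 := t),
        ''adj'' := (\<lambda>i. if i < n * n \<and> E (i div n) (i mod n) then 1 else 0))"

lemma stores_input_state: "stores_instance (input_state n E k t) n E k t"
proof -
  have "u * n + v < n * n" if "u < n" "v < n" for u v
  proof -
    have "u * n + v < Suc u * n" using that by simp
    also have "\<dots> \<le> n * n" using that by (intro mult_le_mono1) simp
    finally show ?thesis .
  qed
  then show ?thesis
    by (auto simp: stores_instance_def input_state_def)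
qed

text \<open>\<open>p V E\<close> is the graph number compared with \<open>k\<close>, i.e. \<open>h\<close> or \<open>mh\<close>. The size of an instance is its
  number of vertices, and \<open>x\<^sup>O\<^sup>(\<^sup>1\<^sup>)\<close> is read as \<open>c x\<^sup>c\<close> for some constant \<open>c\<close>. Since the number of vertices
  does not account for \<open>k'\<close>, the size bound is imposed on \<open>k'\<close> as well, so that
  the whole output instance is bounded in terms of \<open>t\<close>.\<close>

definition admits_kernel ::
    "(nat set \<Rightarrow> (nat \<Rightarrow> nat \<Rightarrow> bool) \<Rightarrow> nat) \<Rightarrow> (nat \<Rightarrow> nat) \<Rightarrow> bool" where
  "admits_kernel p f \<longleftrightarrow>
     (\<exists>prog c. \<forall>n E k t. is_instance n E k t \<longrightarrow>
        (\<exists>T s' n' E' k' t'.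
           exec prog (input_state n E k t) T s' \<and> T \<le> c * (n + t) ^ c \<and>
           stores_instance s' n' E' k' t' \<and> is_instance n' E' k' t' \<and>
           (p {..<n'} E' \<le> k' \<longleftrightarrow> p {..<n} E \<le> k) \<and>
           n' \<le> f t \<and> k' \<le> f t \<and> t' \<le> t))"

text \<open>Solvable in time \<open>g(t) n\<^sup>O\<^sup>(\<^sup>1\<^sup>)\<close>; the answer is yes iff the final content of \<open>out\<close> is nonzero.\<close>

definition solvable_in_fpt_time ::
    "(nat set \<Rightarrow> (nat \<Rightarrow> nat \<Rightarrow> bool) \<Rightarrow> nat) \<Rightarrow> (nat \<Rightarrow> nat) \<Rightarrow> bool" where
  "solvable_in_fpt_time p g \<longleftrightarrow>
     (\<exists>prog c. \<forall>n E k t. is_instance n E k t \<longrightarrow>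
        (\<exists>T s'. exec prog (input_state n E k t) T s' \<and> T \<le> g t * (c * n ^ c) \<and>
           (s' ''out'' 0 \<noteq> 0 \<longleftrightarrow> p {..<n} E \<le> k)))"

end

theory Submission
  imports Defs "HOL-Library.Nat_Bijection"
begin

text \<open>
  Against a fixed sequence of contaminated sets \<open>Z\<^sub>0 = V, Z\<^sub>1, \<dots>\<close> the hunters may be lazy: a vertex of \<open>Z\<^sub>j\<close>
  must be shot only if some neighbour lies outside \<open>Z\<^sub>j\<^sub>+\<^sub>1\<close> or, in the monotone game, if it or a neighbour
  has been clean before. The latter turns out to depend on \<open>Z\<^sub>j\<^sub>-\<^sub>1\<close> and \<open>Z\<^sub>j\<^sub>-\<^sub>2\<close> only. So \<open>h(G) \<le> k\<close> and
  \<open>mh(G) \<le> k\<close> both ask for a path in a graph on triples of consecutive sets \<open>Z\<^sub>j\<close>. Every \<open>Z\<^sub>j\<close> is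
  determined by two subsets of a vertex cover, and a maximal matching gives a vertex cover of size at most \<open>2t\<close>;
  hence there are at most \<open>16^t\<close> sets, and both numbers are decided in time \<open>2^O(t) n^O(1)\<close> without
  enumerating the shots. This is below \<open>(4^t (t + 1) + 2t)^(t + 1) n^O(1)\<close>.

  No twin reduction is needed for the kernel either: if \<open>n \<le> 4^t\<close>, the instance itself (with \<open>k\<close> replaced by
  \<open>min k (t + 1)\<close>, as \<open>h\<close> and \<open>mh\<close> are at most \<open>vc\<close>) is a kernel, and otherwise \<open>2^O(t)\<close> is polynomial in
  \<open>n\<close>, so the instance can be solved and replaced by a single vertex or by a triangle with \<open>k = 1\<close>.
\<close>

section \<open>A term language with bounded sums\<close>

text \<open>Both claims ask for concrete programs of the while language, so the algorithm must be
  executable there and its cost provable without counting steps. It is therefore a short sequence of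
  tables whose entries are arithmetic terms with bounded sums. One generic argument shows that such
  a program takes at most M^e steps, where M bounds the table entries and e depends on the program
  alone. Running times reduce to the choice of M: n + 2 + 16^t for deciding, and (n + t + 2)^2 for
  the kernel, where the exponential tables are built only if 4^t \<le> n. That e is unknown does no
  harm: 2te \<le> t^2 + e^2 puts 16^(te) below (4^t)^t times a constant. Two preceding sets suffice
  in the monotone game because a vertex contaminated one round before the current one has a
  neighbour that was spared two rounds before the current one. By induction the closed neighbourhood
  of that neighbour, which contains the vertex, had been contaminated at all earlier times; the two
  sets cover the times in between.\<close>

datatype tm =
    TVar nat
  | TConst nat
  | TRead string tm
  | TAdd tm tm
  | TSub tm tm
  | TSum nat tm tm

primrec tval :: "state \<Rightarrow> tm \<Rightarrow> (nat \<Rightarrow> nat) \<Rightarrow> nat" where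
  "tval s (TVar i) \<rho> = \<rho> i"
| "tval s (TConst m) \<rho> = m"
| "tval s (TRead a t) \<rho> = s a (tval s t \<rho>)"
| "tval s (TAdd t u) \<rho> = tval s t \<rho> + tval s u \<rho>"
| "tval s (TSub t u) \<rho> = tval s t \<rho> - tval s u \<rho>"
| "tval s (TSum i t u) \<rho> = (\<Sum>j<tval s t \<rho>. tval s u (\<rho>(i := j)))"

text \<open>The compiler owns the arrays \<open>reg\<close> and \<open>var\<close>. The input \<open>k\<close> is excluded from terms because it
  is not bounded in terms of \<open>n\<close> and \<open>t\<close>.\<close>

primrec admissible :: "tm \<Rightarrow> bool" where
  "admissible (TVar i) = True"
| "admissible (TConst m) = True"
| "admissible (TRead a t) = (a \<noteq> ''reg'' \<and> a \<noteq> ''var'' \<and> a \<noteq> ''k'' \<and> admissible t)"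
| "admissible (TAdd t u) = (admissible t \<and> admissible u)"
| "admissible (TSub t u) = (admissible t \<and> admissible u)"
| "admissible (TSum i t u) = (admissible t \<and> admissible u)"

primrec fresh :: "tm \<Rightarrow> nat" where
  "fresh (TVar i) = Suc i"
| "fresh (TConst m) = 0"
| "fresh (TRead a t) = fresh t"
| "fresh (TAdd t u) = max (fresh t) (fresh u)"
| "fresh (TSub t u) = max (fresh t) (fresh u)"
| "fresh (TSum i t u) = max (fresh t) (fresh u)"

text \<open>\<open>fresh\<close> ignores the variable bound by a sum, so this variable may coincide
  with \<open>i\<close>. Then the inner assignment overwrites the outer one and nothing changes;
  otherwise the two assignments commute.\<close>

lemma tval_fresh: "fresh t \<le> i \<Longrightarrow> tval s t (\<rho>(i := j)) = tval s t \<rho>"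
proof (induction t arbitrary: \<rho>)
  case (TSum x t u)
  have "tval s u (\<rho>(i := j, x := l)) = tval s u (\<rho>(x := l))" for l
  proof (cases "x = i")
    case False
    then have "\<rho>(i := j, x := l) = \<rho>(x := l, i := j)" by (rule fun_upd_twist[OF not_sym])
    then show ?thesis using TSum.IH(2)[of "\<rho>(x := l)"] TSum.prems by (simp only: fresh.simps max.bounded_iff)
  qed simp
  then show ?case using TSum.IH(1)[of \<rho>] TSum.prems by (simp only: tval.simps fresh.simps max.bounded_iff)
qed auto

lemma tval_cong:
  "admissible t \<Longrightarrow> (\<And>a. a \<noteq> ''reg'' \<Longrightarrow> a \<noteq> ''var'' \<Longrightarrow> s a = s' a) \<Longrightarrow> tval s t \<rho> = tval s' t \<rho>"
  by (induction t arbitrary: \<rho>) simp_all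

text \<open>The product is a sum of \<open>t\<close> copies of \<open>u\<close>. The summation
  variable has to be fresh for \<open>u\<close> only, as the bound \<open>t\<close> is evaluated
  outside the sum.\<close>

definition TMul :: "tm \<Rightarrow> tm \<Rightarrow> tm" where
  "TMul t u = TSum (fresh u) t u"

definition TNot :: "tm \<Rightarrow> tm" where
  "TNot t = TSub (TConst 1) t"

definition TLe :: "tm \<Rightarrow> tm \<Rightarrow> tm" where
  "TLe t u = TNot (TSub t u)"

definition TAnd :: "tm \<Rightarrow> tm \<Rightarrow> tm" where
  "TAnd t u = TNot (TAdd (TNot t) (TNot u))"

definition TOr :: "tm \<Rightarrow> tm \<Rightarrow> tm" where
  "TOr t u = TNot (TNot (TAdd t u))"

definition TEq :: "tm \<Rightarrow> tm \<Rightarrow> tm" where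
  "TEq t u = TAnd (TLe t u) (TLe u t)"

definition TEx :: "nat \<Rightarrow> tm \<Rightarrow> tm \<Rightarrow> tm" where
  "TEx i t u = TNot (TNot (TSum i t u))"

definition TAll :: "nat \<Rightarrow> tm \<Rightarrow> tm \<Rightarrow> tm" where
  "TAll i t u = TNot (TSum i t (TNot u))"

text \<open>For b > 0 the quotient of a by b is the number of j < a with (j + 1) b \<le> a. Both
  arguments stand inside the sum, so its variable must be fresh for both.\<close>

definition TDiv :: "tm \<Rightarrow> tm \<Rightarrow> tm" where
  "TDiv t u = (let i = max (fresh t) (fresh u) in
     TSum i t (TLe (TMul (TAdd (TVar i) (TConst 1)) u) t))"

definition TMod :: "tm \<Rightarrow> tm \<Rightarrow> tm" where
  "TMod t u = TSub t (TMul (TDiv t u) u)"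

lemma tval_TMul [simp]: "tval s (TMul t u) \<rho> = tval s t \<rho> * tval s u \<rho>"
  by (simp add: TMul_def tval_fresh)

lemma tval_TNot [simp]: "tval s (TNot t) \<rho> = of_bool (tval s t \<rho> = 0)"
  by (simp add: TNot_def)

lemma tval_TLe [simp]: "tval s (TLe t u) \<rho> = of_bool (tval s t \<rho> \<le> tval s u \<rho>)"
  by (simp add: TLe_def)

lemma tval_TAnd [simp]: "tval s (TAnd t u) \<rho> = of_bool (tval s t \<rho> \<noteq> 0 \<and> tval s u \<rho> \<noteq> 0)"
  by (simp add: TAnd_def)

lemma tval_TOr [simp]: "tval s (TOr t u) \<rho> = of_bool (tval s t \<rho> \<noteq> 0 \<or> tval s u \<rho> \<noteq> 0)"
  by (simp add: TOr_def)

lemma tval_TEq [simp]: "tval s (TEq t u) \<rho> = of_bool (tval s t \<rho> = tval s u \<rho>)"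
  by (auto simp: TEq_def)

lemma tval_TEx [simp]:
  "tval s (TEx i t u) \<rho> = of_bool (\<exists>j<tval s t \<rho>. tval s u (\<rho>(i := j)) \<noteq> 0)"
  by (auto simp: TEx_def)

lemma tval_TAll [simp]:
  "tval s (TAll i t u) \<rho> = of_bool (\<forall>j<tval s t \<rho>. tval s u (\<rho>(i := j)) \<noteq> 0)"
  by (auto simp: TAll_def)

lemma sum_of_bool_div:
  fixes a b :: nat
  assumes "b > 0"
  shows "(\<Sum>j<a. of_bool (Suc j * b \<le> a)) = a div b"
proof -
  have iff: "Suc j * b \<le> a \<longleftrightarrow> j < a div b" for j
    using less_eq_div_iff_mult_less_eq[OF assms, of "Suc j" a] by (simp only: Suc_le_eq)
  have "{..<a} \<inter> {j. Suc j * b \<le> a} = {..<a div b}"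
    unfolding iff using less_le_trans[OF _ div_le_dividend] by blast
  then show ?thesis by (simp only: sum_of_bool_eq finite_lessThan card_lessThan of_nat_id)
qed

lemma tval_TDiv [simp]:
  assumes "tval s u \<rho> > 0"
  shows "tval s (TDiv t u) \<rho> = tval s t \<rho> div tval s u \<rho>"
  using sum_of_bool_div[OF assms] by (simp add: TDiv_def Let_def tval_fresh)

lemma tval_TMod [simp]:
  "tval s u \<rho> > 0 \<Longrightarrow> tval s (TMod t u) \<rho> = tval s t \<rho> mod tval s u \<rho>"
  by (simp add: TMod_def minus_div_mult_eq_mod)

lemma admissible_macros [simp]:
  "admissible (TMul t u) \<longleftrightarrow> admissible t \<and> admissible u"
  "admissible (TNot t) \<longleftrightarrow> admissible t"
  "admissible (TLe t u) \<longleftrightarrow> admissible t \<and> admissible u"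
  "admissible (TAnd t u) \<longleftrightarrow> admissible t \<and> admissible u"
  "admissible (TOr t u) \<longleftrightarrow> admissible t \<and> admissible u"
  "admissible (TEq t u) \<longleftrightarrow> admissible t \<and> admissible u"
  "admissible (TEx i t u) \<longleftrightarrow> admissible t \<and> admissible u"
  "admissible (TAll i t u) \<longleftrightarrow> admissible t \<and> admissible u"
  "admissible (TDiv t u) \<longleftrightarrow> admissible t \<and> admissible u"
  "admissible (TMod t u) \<longleftrightarrow> admissible t \<and> admissible u"
  by (auto simp: TMul_def TNot_def TLe_def TAnd_def TOr_def TEq_def TEx_def TAll_def TDiv_def
      TMod_def Let_def)

section \<open>Polynomial bounds on the values of terms\<close>

definition tables_le :: "nat \<Rightarrow> state \<Rightarrow> bool" where
  "tables_le M s \<longleftrightarrow> (\<forall>a j. a \<noteq> ''reg'' \<longrightarrow> a \<noteq> ''var'' \<longrightarrow> a \<noteq> ''k'' \<longrightarrow> s a j \<le> M)"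

text \<open>Additions, also of constants below a fixed power of 2, are absorbed by the exponent. All
  costs are collapsed to a single power of M in this way, so that only the existence of an exponent
  has to be carried along.\<close>

lemma power_add_le:
  fixes M :: nat
  assumes "M \<ge> 2"
  shows "M ^ a + M ^ b \<le> M ^ (a + b + 1)"
proof -
  have "M ^ a \<le> M ^ (a + b)" "M ^ b \<le> M ^ (a + b)"
    using assms by (auto intro: power_increasing)
  then have "M ^ a + M ^ b \<le> 2 * M ^ (a + b)" by linarith
  also have "\<dots> \<le> M * M ^ (a + b)" using assms by (rule mult_le_mono1)
  finally show ?thesis by simp
qed

lemma tables_le_mono: "tables_le M s \<Longrightarrow> M \<le> M' \<Longrightarrow> tables_le M' s"
  unfolding tables_le_def by (meson le_trans)

lemma const_le_power: "2 \<le> M \<Longrightarrow> m \<le> M ^ m" for m M :: nat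
  by (meson le_trans less_exp less_imp_le power_mono zero_le)

definition val_exponent :: "tm \<Rightarrow> nat \<Rightarrow> bool" where
  "val_exponent t e \<longleftrightarrow>
     (\<forall>s \<rho> M. 2 \<le> M \<longrightarrow> tables_le M s \<longrightarrow> (\<forall>i. \<rho> i \<le> M) \<longrightarrow> tval s t \<rho> \<le> M ^ e)"

lemma val_exponentI:
  "(\<And>s \<rho> M. 2 \<le> M \<Longrightarrow> tables_le M s \<Longrightarrow> \<forall>i. \<rho> i \<le> M \<Longrightarrow> tval s t \<rho> \<le> M ^ e) \<Longrightarrow> val_exponent t e"
  by (simp add: val_exponent_def)

lemma val_exponentD:
  "val_exponent t e \<Longrightarrow> 2 \<le> M \<Longrightarrow> tables_le M s \<Longrightarrow> \<forall>i. \<rho> i \<le> M \<Longrightarrow> tval s t \<rho> \<le> M ^ e"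
  by (simp add: val_exponent_def)

text \<open>Positivity of \<open>e\<close> gives M \<le> M^e, so the bound on a value can replace M
  as the bound on tables and variables. This is what the case of a sum needs.\<close>

lemma val_exponent_exists:
  assumes "admissible t"
  shows "\<exists>e>0. val_exponent t e"
  using assms
proof (induction t)
  case (TVar i)
  have "val_exponent (TVar i) 1" by (rule val_exponentI) simp
  then show ?case by blast
next
  case (TConst m)
  have "val_exponent (TConst m) (Suc m)"
  proof (rule val_exponentI)
    show "tval s (TConst m) \<rho> \<le> M ^ Suc m" if "2 \<le> M" for s \<rho> and M :: nat
      using const_le_power[OF that, of m] power_increasing[of m "Suc m" M] that
      unfolding tval.simps by linarith
  qed
  then show ?case by blast
next
  case (TRead a t)
  then have "val_exponent (TRead a t) 1" by (intro val_exponentI) (simp add: tables_le_def)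
  then show ?case by blast
next
  case (TAdd t u)
  then obtain e1 e2 where e: "val_exponent t e1" "val_exponent u e2" by auto
  have "val_exponent (TAdd t u) (e1 + e2 + 1)"
  proof (rule val_exponentI)
    fix s and \<rho> :: "nat \<Rightarrow> nat" and M :: nat
    assume M: "2 \<le> M" "tables_le M s" "\<forall>i. \<rho> i \<le> M"
    show "tval s (TAdd t u) \<rho> \<le> M ^ (e1 + e2 + 1)"
      using val_exponentD[OF e(1) M] val_exponentD[OF e(2) M] power_add_le[OF M(1), of e1 e2]
      unfolding tval.simps by linarith
  qed
  then show ?case using zero_less_Suc[of "e1 + e2"] by (metis Suc_eq_plus1)
next
  case (TSub t u)
  then obtain e where e: "e > 0" "val_exponent t e" by auto
  have "val_exponent (TSub t u) e"
  proof (rule val_exponentI)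
    fix s and \<rho> :: "nat \<Rightarrow> nat" and M :: nat
    assume M: "2 \<le> M" "tables_le M s" "\<forall>i. \<rho> i \<le> M"
    show "tval s (TSub t u) \<rho> \<le> M ^ e"
      using val_exponentD[OF e(2) M] unfolding tval.simps by linarith
  qed
  with e show ?case by blast
next
  case (TSum x t u)
  then obtain e1 e2 where e1: "e1 > 0" "val_exponent t e1" and e2: "val_exponent u e2" by auto
  \<comment> \<open>There are at most M^e1 summands, and each is evaluated with variables bounded by
    M^e1 instead of M, hence is at most (M^e1)^e2.\<close>
  have "val_exponent (TSum x t u) (e1 + e1 * e2)"
  proof (rule val_exponentI)
    fix s and \<rho> :: "nat \<Rightarrow> nat" and M :: nat
    assume M: "2 \<le> M" "tables_le M s" "\<forall>i. \<rho> i \<le> M"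
    have le: "M \<le> M ^ e1" using M e1(1) by (simp add: self_le_power)
    have t: "tval s t \<rho> \<le> M ^ e1" using val_exponentD[OF e1(2) M] .
    have "tval s u (\<rho>(x := j)) \<le> (M ^ e1) ^ e2" if j: "j < tval s t \<rho>" for j
    proof (rule val_exponentD[OF e2])
      show "\<forall>i. (\<rho>(x := j)) i \<le> M ^ e1"
        using j t M(3) le by (simp add: le_trans[OF _ le])
    qed (use le M tables_le_mono in auto)
    then have "(\<Sum>j<tval s t \<rho>. tval s u (\<rho>(x := j))) \<le> tval s t \<rho> * (M ^ e1) ^ e2"
      using sum_bounded_above[of "{..<tval s t \<rho>}" "\<lambda>j. tval s u (\<rho>(x := j))" "(M ^ e1) ^ e2"] by simp
    also have "\<dots> \<le> M ^ e1 * (M ^ e1) ^ e2" using t by (rule mult_le_mono1)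
    finally show "tval s (TSum x t u) \<rho> \<le> M ^ (e1 + e1 * e2)" by (simp add: power_add power_mult)
  qed
  then show ?case using e1(1) by (metis add_gr_0)
qed

section \<open>Compilation\<close>

definition reg :: "nat \<Rightarrow> exp" where
  "reg r = Read ''reg'' (Const r)"

abbreviation set_reg :: "nat \<Rightarrow> exp \<Rightarrow> com" where
  "set_reg r e \<equiv> Write ''reg'' (Const r) e"

text \<open>The value ends up in register \<open>r\<close>, and the registers below \<open>r\<close>
  stay intact. For a sum, \<open>r\<close> accumulates, \<open>r + 1\<close> holds the bound,
  \<open>r + 2\<close> counts, and \<open>r + 3\<close> saves the old value of the bound variable,
  which may be in use outside. Truncated subtraction serves as the test that the counter is below
  the bound.\<close>

primrec compile :: "nat \<Rightarrow> tm \<Rightarrow> com" where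
  "compile r (TVar i) = set_reg r (Read ''var'' (Const i))"
| "compile r (TConst m) = set_reg r (Const m)"
| "compile r (TRead a t) = Seq (compile r t) (set_reg r (Read a (reg r)))"
| "compile r (TAdd t u) = Seq (compile r t) (Seq (compile (r + 1) u)
     (set_reg r (Plus (reg r) (reg (r + 1)))))"
| "compile r (TSub t u) = Seq (compile r t) (Seq (compile (r + 1) u)
     (set_reg r (Minus (reg r) (reg (r + 1)))))"
| "compile r (TSum i t u) = Seq (compile (r + 1) t)
     (Seq (set_reg r (Const 0))
     (Seq (set_reg (r + 2) (Const 0))
     (Seq (set_reg (r + 3) (Read ''var'' (Const i)))
     (Seq (While (Minus (reg (r + 1)) (reg (r + 2)))
        (Seq (Write ''var'' (Const i) (reg (r + 2)))
        (Seq (compile (r + 4) u)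
        (Seq (set_reg r (Plus (reg r) (reg (r + 4))))
             (set_reg (r + 2) (Plus (reg (r + 2)) (Const 1)))))))
     (Write ''var'' (Const i) (reg (r + 3)))))))"

section \<open>Total correctness with time bounds\<close>

definition runs :: "com \<Rightarrow> nat \<Rightarrow> state \<Rightarrow> (state \<Rightarrow> bool) \<Rightarrow> bool" where
  "runs c \<tau> s Q \<longleftrightarrow> (\<exists>T s'. exec c s T s' \<and> T \<le> \<tau> \<and> Q s')"

lemma runs_Skip: "Q s \<Longrightarrow> runs Skip 1 s Q"
  unfolding runs_def using exec.Skip by blast

lemma runs_Write:
  "Q (s(a := (s a)(aval i s := aval e s))) \<Longrightarrow> exp_time i + exp_time e + 1 \<le> \<tau> \<Longrightarrow>
     runs (Write a i e) \<tau> s Q"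
  unfolding runs_def using exec.Write by blast

lemma runsI: "exec c s T s' \<Longrightarrow> T \<le> \<tau> \<Longrightarrow> Q s' \<Longrightarrow> runs c \<tau> s Q"
  unfolding runs_def by blast

lemma runsE:
  assumes "runs c \<tau> s Q"
  obtains T s' where "exec c s T s'" "T \<le> \<tau>" "Q s'"
  using assms unfolding runs_def by blast

lemma runs_Seq:
  assumes "runs c \<tau> s P" and "\<And>s'. P s' \<Longrightarrow> runs d \<upsilon> s' Q"
  shows "runs (Seq c d) (\<tau> + \<upsilon> + 1) s Q"
proof -
  from assms(1) obtain T s1 where T: "exec c s T s1" "T \<le> \<tau>" "P s1" by (rule runsE)
  from assms(2)[OF T(3)] obtain U s2 where U: "exec d s1 U s2" "U \<le> \<upsilon>" "Q s2" by (rule runsE)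
  show ?thesis using exec.Seq[OF T(1) U(1)] T(2) U(2,3) by (intro runsI) auto
qed

lemma runs_Cond:
  assumes "aval b s \<noteq> 0 \<Longrightarrow> runs c \<tau> s Q" and "aval b s = 0 \<Longrightarrow> runs d \<tau> s Q"
  shows "runs (Cond b c d) (exp_time b + \<tau> + 1) s Q"
proof (cases "aval b s = 0")
  case True
  from assms(2)[OF this] obtain T s' where T: "exec d s T s'" "T \<le> \<tau>" "Q s'" by (rule runsE)
  show ?thesis using exec.CondFalse[OF True T(1)] T(2,3) by (intro runsI) auto
next
  case False
  from assms(1)[OF this] obtain T s' where T: "exec c s T s'" "T \<le> \<tau>" "Q s'" by (rule runsE)
  show ?thesis using exec.CondTrue[OF False T(1)] T(2,3) by (intro runsI) auto
qed

lemma runs_mono: "runs c \<tau> s P \<Longrightarrow> \<tau> \<le> \<upsilon> \<Longrightarrow> (\<And>s'. P s' \<Longrightarrow> Q s') \<Longrightarrow> runs c \<upsilon> s Q"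
  unfolding runs_def using le_trans by blast

lemma runs_le: "runs c \<tau> s Q \<Longrightarrow> \<tau> \<le> \<upsilon> \<Longrightarrow> runs c \<upsilon> s Q"
  by (rule runs_mono)

text \<open>The invariant is indexed by the number of completed iterations, which is known to be
  exactly \<open>m\<close>. The extra factor 1 pays for the final, failing test.\<close>

lemma runs_While:
  assumes step: "\<And>j s. j < m \<Longrightarrow> I j s \<Longrightarrow> aval b s \<noteq> 0 \<and> runs c \<tau> s (I (Suc j))"
    and stop: "\<And>s. I m s \<Longrightarrow> aval b s = 0"
    and init: "I 0 s"
  shows "runs (While b c) ((m + 1) * (\<tau> + exp_time b + 1)) s (I m)"
proof -
  have "runs (While b c) ((m - j + 1) * (\<tau> + exp_time b + 1)) s (I m)" if "j \<le> m" "I j s" for j s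
    using that
  proof (induction "m - j" arbitrary: j s)
    case 0
    then have "j = m" by simp
    then show ?case using exec.WhileFalse[OF stop] 0 unfolding runs_def by fastforce
  next
    case (Suc d)
    then have j: "j < m" by simp
    obtain T s' where s': "aval b s \<noteq> 0" "exec c s T s'" "T \<le> \<tau>" "I (Suc j) s'"
      using step[OF j Suc.prems(2)] unfolding runs_def by blast
    have "d = m - Suc j" using Suc.hyps(2) by simp
    from Suc.hyps(1)[OF this _ s'(4)] j obtain U s'' where
      "exec (While b c) s' U s''" "U \<le> (m - Suc j + 1) * (\<tau> + exp_time b + 1)" "I m s''"
      unfolding runs_def by auto
    moreover have "m - j = Suc (m - Suc j)" using j by simp
    ultimately show ?case unfolding runs_def
      using exec.WhileTrue[OF s'(1,2)] s'(3) by (fastforce simp: algebra_simps)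
  qed
  from this[OF _ init] show ?thesis by simp
qed

text \<open>Registers above \<open>r\<close> are scratch space and remain unspecified. The array
  \<open>var\<close> must come back unchanged, although sums overwrite it temporarily.\<close>

definition evaluated :: "nat \<Rightarrow> nat \<Rightarrow> state \<Rightarrow> state \<Rightarrow> bool" where
  "evaluated r x s s' \<longleftrightarrow> (\<forall>a. a \<noteq> ''reg'' \<longrightarrow> s' a = s a) \<and> (\<forall>j<r. s' ''reg'' j = s ''reg'' j) \<and>
     s' ''reg'' r = x"

lemma evaluated_other: "evaluated r x s s' \<Longrightarrow> a \<noteq> ''reg'' \<Longrightarrow> s' a = s a"
  by (simp add: evaluated_def)

lemma evaluated_tables_le: "evaluated r x s s' \<Longrightarrow> tables_le M s' \<longleftrightarrow> tables_le M s"
  by (simp add: tables_le_def evaluated_def)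

lemma evaluated_tval: "evaluated r x s s' \<Longrightarrow> admissible t \<Longrightarrow> tval s' t \<rho> = tval s t \<rho>"
  by (rule tval_cong) (auto simp: evaluated_other)

definition time_exponent :: "tm \<Rightarrow> nat \<Rightarrow> bool" where
  "time_exponent t e \<longleftrightarrow>
     (\<forall>r s M. 2 \<le> M \<longrightarrow> tables_le M s \<longrightarrow> (\<forall>i. s ''var'' i \<le> M) \<longrightarrow>
        runs (compile r t) (M ^ e) s (evaluated r (tval s t (s ''var'')) s))"

lemma time_exponentI:
  "(\<And>r s M. 2 \<le> M \<Longrightarrow> tables_le M s \<Longrightarrow> \<forall>i. s ''var'' i \<le> M \<Longrightarrow>
      runs (compile r t) (M ^ e) s (evaluated r (tval s t (s ''var'')) s)) \<Longrightarrow> time_exponent t e"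
  by (simp add: time_exponent_def)

lemma time_exponentD:
  "time_exponent t e \<Longrightarrow> 2 \<le> M \<Longrightarrow> tables_le M s \<Longrightarrow> \<forall>i. s ''var'' i \<le> M \<Longrightarrow>
     runs (compile r t) (M ^ e) s (evaluated r (tval s t (s ''var'')) s)"
  by (simp add: time_exponent_def)

lemma time_exponent_exists:
  assumes "admissible t"
  shows "\<exists>e. time_exponent t e"
  using assms
proof (induction t)
  case (TVar i)
  have "time_exponent (TVar i) 2"
  proof (rule time_exponentI)
    show "runs (compile r (TVar i)) (M ^ 2) s (evaluated r (tval s (TVar i) (s ''var'')) s)" if "2 \<le> M" for r s M
      using power_mono[OF that, of 2]
      by (auto intro!: runs_Write simp: evaluated_def)
  qed
  then show ?case by blast
next
  case (TConst m)
  have "time_exponent (TConst m) 2"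
  proof (rule time_exponentI)
    show "runs (compile r (TConst m)) (M ^ 2) s (evaluated r (tval s (TConst m) (s ''var'')) s)" if "2 \<le> M" for r s M
      using power_mono[OF that, of 2]
      by (auto intro!: runs_Write simp: evaluated_def)
  qed
  then show ?case by blast
next
  case (TRead a t)
  then obtain e where e: "time_exponent t e" by auto
  have "time_exponent (TRead a t) (e + 3 + 1)"
  proof (rule time_exponentI)
    fix r s and M :: nat
    assume M: "2 \<le> M" "tables_le M s" "\<forall>i. s ''var'' i \<le> M"
    have "runs (compile r (TRead a t)) (M ^ e + 5 + 1) s (evaluated r (tval s (TRead a t) (s ''var'')) s)"
      unfolding compile.simps
      apply (rule runs_Seq[OF time_exponentD[OF e M]])
      apply (rule runs_Write)
      using TRead.prems by (auto simp: evaluated_def reg_def)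
    moreover have "M ^ e + 5 + 1 \<le> M ^ (e + 3 + 1)"
      using power_mono[OF M(1), of 3] power_add_le[OF M(1), of e 3] by simp
    ultimately show "runs (compile r (TRead a t)) (M ^ (e + 3 + 1)) s (evaluated r (tval s (TRead a t) (s ''var'')) s)"
      by (rule runs_le)
  qed
  then show ?case by blast
next
  case (TAdd t u)
  then have "\<exists>e. time_exponent t e" and "\<exists>e. time_exponent u e" by simp_all
  then obtain e1 e2 where e1: "time_exponent t e1" and e2: "time_exponent u e2" by blast
  have "time_exponent (TAdd t u) (e1 + (e2 + 4 + 1) + 1)"
  proof (rule time_exponentI)
    fix r s and M :: nat
    assume M: "2 \<le> M" "tables_le M s" "\<forall>i. s ''var'' i \<le> M"
    have "runs (compile r (TAdd t u)) (M ^ e1 + (M ^ e2 + 7 + 1) + 1) s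
      (evaluated r (tval s (TAdd t u) (s ''var'')) s)"
      unfolding compile.simps
    proof (rule runs_Seq[OF time_exponentD[OF e1 M]])
      fix s1 assume s1: "evaluated r (tval s t (s ''var'')) s s1"
      show "runs (Seq (compile (r + 1) u) (set_reg r (Plus (reg r) (reg (r + 1))))) (M ^ e2 + 7 + 1) s1
          (evaluated r (tval s (TAdd t u) (s ''var'')) s)"
      proof (rule runs_Seq[OF time_exponentD[OF e2 M(1)]])
        show "tables_le M s1" using M(2) evaluated_tables_le[OF s1] by simp
        show "\<forall>i. s1 ''var'' i \<le> M" using M(3) evaluated_other[OF s1] by simp
      next
        fix s2 assume s2: "evaluated (r + 1) (tval s1 u (s1 ''var'')) s1 s2"
        have "s1 ''var'' = s ''var''" using evaluated_other[OF s1] by simp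
        with TAdd.prems have "tval s1 u (s1 ''var'') = tval s u (s ''var'')"
          using evaluated_tval[OF s1] by simp
        with s1 s2 show "runs (set_reg r (Plus (reg r) (reg (r + 1)))) 7 s2
            (evaluated r (tval s (TAdd t u) (s ''var'')) s)"
          by (intro runs_Write) (simp_all add: evaluated_def reg_def)
      qed
    qed
    moreover have "16 \<le> M ^ 4" using power_mono[OF M(1), of 4] by simp
    then have "M ^ e1 + (M ^ e2 + 7 + 1) + 1 \<le> M ^ (e1 + (e2 + 4 + 1) + 1)"
      using power_add_le[OF M(1), of e2 4]
        power_add_le[OF M(1), of e1 "e2 + 4 + 1"] by linarith
    ultimately show "runs (compile r (TAdd t u)) (M ^ (e1 + (e2 + 4 + 1) + 1)) s (evaluated r (tval s (TAdd t u) (s ''var'')) s)"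
      by (rule runs_le)
  qed
  then show ?case by blast
next
  case (TSub t u)
  then have "\<exists>e. time_exponent t e" and "\<exists>e. time_exponent u e" by simp_all
  then obtain e1 e2 where e1: "time_exponent t e1" and e2: "time_exponent u e2" by blast
  have "time_exponent (TSub t u) (e1 + (e2 + 4 + 1) + 1)"
  proof (rule time_exponentI)
    fix r s and M :: nat
    assume M: "2 \<le> M" "tables_le M s" "\<forall>i. s ''var'' i \<le> M"
    have "runs (compile r (TSub t u)) (M ^ e1 + (M ^ e2 + 7 + 1) + 1) s
      (evaluated r (tval s (TSub t u) (s ''var'')) s)"
      unfolding compile.simps
    proof (rule runs_Seq[OF time_exponentD[OF e1 M]])
      fix s1 assume s1: "evaluated r (tval s t (s ''var'')) s s1"
      show "runs (Seq (compile (r + 1) u) (set_reg r (Minus (reg r) (reg (r + 1))))) (M ^ e2 + 7 + 1) s1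
          (evaluated r (tval s (TSub t u) (s ''var'')) s)"
      proof (rule runs_Seq[OF time_exponentD[OF e2 M(1)]])
        show "tables_le M s1" using M(2) evaluated_tables_le[OF s1] by simp
        show "\<forall>i. s1 ''var'' i \<le> M" using M(3) evaluated_other[OF s1] by simp
      next
        fix s2 assume s2: "evaluated (r + 1) (tval s1 u (s1 ''var'')) s1 s2"
        have "s1 ''var'' = s ''var''" using evaluated_other[OF s1] by simp
        with TSub.prems have "tval s1 u (s1 ''var'') = tval s u (s ''var'')"
          using evaluated_tval[OF s1] by simp
        with s1 s2 show "runs (set_reg r (Minus (reg r) (reg (r + 1)))) 7 s2
            (evaluated r (tval s (TSub t u) (s ''var'')) s)"
          by (intro runs_Write) (simp_all add: evaluated_def reg_def)
      qed
    qed
    moreover have "16 \<le> M ^ 4" using power_mono[OF M(1), of 4] by simp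
    then have "M ^ e1 + (M ^ e2 + 7 + 1) + 1 \<le> M ^ (e1 + (e2 + 4 + 1) + 1)"
      using power_add_le[OF M(1), of e2 4]
        power_add_le[OF M(1), of e1 "e2 + 4 + 1"] by linarith
    ultimately show "runs (compile r (TSub t u)) (M ^ (e1 + (e2 + 4 + 1) + 1)) s (evaluated r (tval s (TSub t u) (s ''var'')) s)"
      by (rule runs_le)
  qed
  then show ?case by blast
next
  case (TSum i t u)
  then have "\<exists>e. time_exponent t e" and "\<exists>e. time_exponent u e" by simp_all
  then obtain e1 e2 where e1: "time_exponent t e1" and e2: "time_exponent u e2" by blast
  obtain v where v: "v > 0" "val_exponent t v" using val_exponent_exists[of t] TSum.prems by auto
  define e where "e = e1 + (v + 1 + (v * e2 + 5 + 1) + 5 + 1) + 1"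
  have "time_exponent (TSum i t u) e"
  proof (rule time_exponentI)
    fix r s and M :: nat
    assume M: "2 \<le> M" "tables_le M s" "\<forall>i. s ''var'' i \<le> M"
    define m where "m = tval s t (s ''var'')"
    \<comment> \<open>Inside the loop the bound variable runs up to the value of \<open>t\<close>,
      so the time bound of \<open>u\<close> is used with M^v in place of M.\<close>
    define \<tau> where "\<tau> = (M ^ v) ^ e2"
    \<comment> \<open>Nothing is claimed about \<open>var\<close> at \<open>i\<close>, which the
      loop overwrites; its old value waits in register \<open>r + 3\<close>.\<close>
    define I where "I = (\<lambda>j s'. (\<forall>a. a \<noteq> ''reg'' \<longrightarrow> a \<noteq> ''var'' \<longrightarrow> s' a = s a) \<and>
        (\<forall>l. l \<noteq> i \<longrightarrow> s' ''var'' l = s ''var'' l) \<and> (\<forall>l<r. s' ''reg'' l = s ''reg'' l) \<and>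
        s' ''reg'' r = (\<Sum>l<j. tval s u ((s ''var'')(i := l))) \<and>
        s' ''reg'' (r + 1) = m \<and> s' ''reg'' (r + 2) = j \<and> s' ''reg'' (r + 3) = s ''var'' i)"
    have m: "m \<le> M ^ v" using val_exponentD[OF v(2) M] by (simp add: m_def)
    have MM: "M \<le> M ^ v" using M v(1) by (simp add: self_le_power)
    have body: "runs (Seq (Write ''var'' (Const i) (reg (r + 2)))
        (Seq (compile (r + 4) u)
        (Seq (set_reg r (Plus (reg r) (reg (r + 4))))
             (set_reg (r + 2) (Plus (reg (r + 2)) (Const 1)))))) (4 + (\<tau> + (7 + 6 + 1) + 1) + 1) s1 (I (Suc j))"
      if j: "j < m" and Ij: "I j s1" for j s1
    proof (rule runs_Seq)
      have other: "\<And>a. a \<noteq> ''reg'' \<Longrightarrow> a \<noteq> ''var'' \<Longrightarrow> s1 a = s a"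
        and vars: "\<And>l. l \<noteq> i \<Longrightarrow> s1 ''var'' l = s ''var'' l"
        and low: "\<And>l. l < r \<Longrightarrow> s1 ''reg'' l = s ''reg'' l"
        and regs: "s1 ''reg'' r = (\<Sum>l<j. tval s u ((s ''var'')(i := l)))"
          "s1 ''reg'' (r + 1) = m" "s1 ''reg'' (r + 2) = j" "s1 ''reg'' (r + 3) = s ''var'' i"
        using Ij unfolding I_def by blast+
      define s2 where "s2 = s1(''var'' := (s ''var'')(i := j))"
      have upd: "(s1 ''var'')(i := j) = (s ''var'')(i := j)" using vars by (simp add: fun_eq_iff)
      show "runs (Write ''var'' (Const i) (reg (r + 2))) 4 s1 (\<lambda>x. x = s2)"
        using regs(3) upd by (intro runs_Write) (simp_all add: reg_def s2_def)
      fix s2' assume "s2' = s2"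
      moreover have "runs (Seq (compile (r + 4) u) (Seq (set_reg r (Plus (reg r) (reg (r + 4))))
             (set_reg (r + 2) (Plus (reg (r + 2)) (Const 1))))) (\<tau> + (7 + 6 + 1) + 1) s2 (I (Suc j))"
      proof (rule runs_Seq)
        have "tval s2 u \<rho> = tval s u \<rho>" for \<rho>
          using TSum.prems other by (intro tval_cong) (simp_all add: s2_def)
        then have ev: "tval s2 u (s2 ''var'') = tval s u ((s ''var'')(i := j))" by (simp add: s2_def)
        show "runs (compile (r + 4) u) \<tau> s2 (evaluated (r + 4) (tval s u ((s ''var'')(i := j))) s2)"
          unfolding \<tau>_def ev[symmetric]
        proof (rule time_exponentD[OF e2])
          show "tables_le (M ^ v) s2"
            using tables_le_mono[OF M(2) MM] other by (simp add: tables_le_def s2_def)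
          show "\<forall>l. s2 ''var'' l \<le> M ^ v"
            using M(3) MM m j by (simp add: s2_def le_trans[OF _ MM])
        qed (use M MM in simp)
        fix s3 assume s3: "evaluated (r + 4) (tval s u ((s ''var'')(i := j))) s2 s3"
        define s4 where "s4 = s3(''reg'' := (s3 ''reg'')(r := (\<Sum>l<Suc j. tval s u ((s ''var'')(i := l)))))"
        have s3': "\<And>a. a \<noteq> ''reg'' \<Longrightarrow> s3 a = s2 a" "\<And>l. l < r + 4 \<Longrightarrow> s3 ''reg'' l = s1 ''reg'' l"
          "s3 ''reg'' (r + 4) = tval s u ((s ''var'')(i := j))"
          using s3 unfolding evaluated_def s2_def by simp_all
        show "runs (Seq (set_reg r (Plus (reg r) (reg (r + 4))))
             (set_reg (r + 2) (Plus (reg (r + 2)) (Const 1)))) (7 + 6 + 1) s3 (I (Suc j))"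
        proof (rule runs_Seq)
          show "runs (set_reg r (Plus (reg r) (reg (r + 4)))) 7 s3 (\<lambda>x. x = s4)"
            using s3'(2)[of r] s3'(3) regs(1) by (intro runs_Write) (simp_all add: reg_def s4_def)
          fix s4' assume "s4' = s4"
          moreover have "I (Suc j) (s4(''reg'' := (s4 ''reg'')(r + 2 := Suc j)))"
            using s3' other vars low regs unfolding I_def s4_def by (simp add: s2_def)
          moreover have "s4 ''reg'' (r + 2) = j" using s3'(2)[of "r + 2"] regs(3) by (simp add: s4_def)
          ultimately show "runs (set_reg (r + 2) (Plus (reg (r + 2)) (Const 1))) 6 s4' (I (Suc j))"
            by (intro runs_Write) (simp_all add: reg_def)
        qed
      qed
      ultimately show "runs (Seq (compile (r + 4) u) (Seq (set_reg r (Plus (reg r) (reg (r + 4))))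
             (set_reg (r + 2) (Plus (reg (r + 2)) (Const 1))))) (\<tau> + (7 + 6 + 1) + 1) s2' (I (Suc j))"
        by simp
    qed
    have loop: "runs (While (Minus (reg (r + 1)) (reg (r + 2))) (Seq (Write ''var'' (Const i) (reg (r + 2)))
        (Seq (compile (r + 4) u)
        (Seq (set_reg r (Plus (reg r) (reg (r + 4))))
             (set_reg (r + 2) (Plus (reg (r + 2)) (Const 1)))))))
       ((m + 1) * (4 + (\<tau> + (7 + 6 + 1) + 1) + 1 + 5 + 1)) s1 (I m)" if "I 0 s1" for s1
    proof (rule runs_mono[OF runs_While[where I = I]])
      show "aval (Minus (reg (r + 1)) (reg (r + 2))) s' \<noteq> 0 \<and> runs (Seq (Write ''var'' (Const i) (reg (r + 2)))
        (Seq (compile (r + 4) u)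
        (Seq (set_reg r (Plus (reg r) (reg (r + 4))))
             (set_reg (r + 2) (Plus (reg (r + 2)) (Const 1)))))) (4 + (\<tau> + (7 + 6 + 1) + 1) + 1) s' (I (Suc j))"
        if "j < m" "I j s'" for j s'
        using body[OF that] that by (simp add: I_def reg_def)
    qed (use that in \<open>auto simp: I_def reg_def\<close>)
    have "runs (compile r (TSum i t u))
        (M ^ e1 + (3 + (3 + (4 + ((m + 1) * (4 + (\<tau> + (7 + 6 + 1) + 1) + 1 + 5 + 1) + 4 + 1) + 1) + 1) + 1) + 1)
        s (evaluated r (tval s (TSum i t u) (s ''var'')) s)"
      unfolding compile.simps
    proof (rule runs_Seq[OF time_exponentD[OF e1 M]])
      fix s1 assume s1: "evaluated (r + 1) (tval s t (s ''var'')) s s1"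
      define s2 where "s2 = s1(''reg'' := (s1 ''reg'')(r := 0))"
      define s3 where "s3 = s2(''reg'' := (s2 ''reg'')(r + 2 := 0))"
      define s4 where "s4 = s3(''reg'' := (s3 ''reg'')(r + 3 := s ''var'' i))"
      have I0: "I 0 s4" using s1 by (auto simp: I_def evaluated_def s2_def s3_def s4_def m_def)
      show "runs (Seq (set_reg r (Const 0)) (Seq (set_reg (r + 2) (Const 0))
         (Seq (set_reg (r + 3) (Read ''var'' (Const i)))
         (Seq (While (Minus (reg (r + 1)) (reg (r + 2))) (Seq (Write ''var'' (Const i) (reg (r + 2)))
        (Seq (compile (r + 4) u) (Seq (set_reg r (Plus (reg r) (reg (r + 4))))
             (set_reg (r + 2) (Plus (reg (r + 2)) (Const 1)))))))
         (Write ''var'' (Const i) (reg (r + 3)))))))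
        (3 + (3 + (4 + ((m + 1) * (4 + (\<tau> + (7 + 6 + 1) + 1) + 1 + 5 + 1) + 4 + 1) + 1) + 1) + 1) s1
        (evaluated r (tval s (TSum i t u) (s ''var'')) s)"
        apply (rule runs_Seq[where P = "\<lambda>x. x = s2"])
        subgoal by (intro runs_Write) (auto simp: s2_def)
        apply (rule runs_Seq[where P = "\<lambda>x. x = s3"])
        subgoal by (intro runs_Write) (auto simp: s3_def)
        apply (rule runs_Seq[where P = "\<lambda>x. x = s4"])
        subgoal using s1 by (intro runs_Write)
          (auto simp: s4_def s3_def s2_def evaluated_def)
        apply (rule runs_Seq[where P = "I m"])
        subgoal using loop[OF I0] by (simp only:)
        apply (rule runs_Write)
        by (auto simp: I_def evaluated_def reg_def m_def fun_eq_iff)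
    qed
    moreover have "M ^ e1 + (3 + (3 + (4 + ((m + 1) * (4 + (\<tau> + (7 + 6 + 1) + 1) + 1 + 5 + 1) + 4 + 1) + 1) + 1) + 1) + 1 \<le> M ^ e"
    proof -
      have m1: "m + 1 \<le> M ^ (v + 1)"
        using m power_add_le[OF M(1), of v 0] by simp
      have c: "26 \<le> M ^ 5" using power_mono[OF M(1), of 5] by simp
      have "4 + (\<tau> + (7 + 6 + 1) + 1) + 1 + 5 + 1 \<le> M ^ (v * e2 + 5 + 1)"
        using power_add_le[OF M(1), of "v * e2" 5] c by (simp add: \<tau>_def power_mult)
      with m1 have "(m + 1) * (4 + (\<tau> + (7 + 6 + 1) + 1) + 1 + 5 + 1) \<le> M ^ (v + 1) * M ^ (v * e2 + 5 + 1)"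
        by (rule mult_le_mono)
      then have "(m + 1) * (4 + (\<tau> + (7 + 6 + 1) + 1) + 1 + 5 + 1) \<le> M ^ (v + 1 + (v * e2 + 5 + 1))"
        by (simp only: power_add)
      then show ?thesis
        using power_add_le[OF M(1), of "v + 1 + (v * e2 + 5 + 1)" 5] c
          power_add_le[OF M(1), of e1 "v + 1 + (v * e2 + 5 + 1) + 5 + 1"]
        unfolding e_def by linarith
    qed
    ultimately show "runs (compile r (TSum i t u)) (M ^ e) s (evaluated r (tval s (TSum i t u) (s ''var'')) s)"
      by (rule runs_le)
  qed
  then show ?case by blast
qed

section \<open>Table programs\<close>

definition agree :: "state \<Rightarrow> state \<Rightarrow> bool" where
  "agree f s \<longleftrightarrow> (\<forall>a. a \<noteq> ''reg'' \<longrightarrow> s a = f a)"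

text \<open>The relation \<open>R M f f'\<close> also carries the preconditions, such as the bound M
  on the entries of \<open>f\<close>. The exponent is chosen before M and the states, so it depends
  on the program only.\<close>

definition implements :: "com \<Rightarrow> (nat \<Rightarrow> state \<Rightarrow> state \<Rightarrow> bool) \<Rightarrow> bool" where
  "implements c R \<longleftrightarrow> (\<exists>e. \<forall>M f f' s. 2 \<le> M \<longrightarrow> R M f f' \<longrightarrow> agree f s \<longrightarrow> runs c (M ^ e) s (agree f'))"

lemma implementsI:
  "(\<And>M f f' s. 2 \<le> M \<Longrightarrow> R M f f' \<Longrightarrow> agree f s \<Longrightarrow> runs c (M ^ e) s (agree f')) \<Longrightarrow> implements c R"
  unfolding implements_def by blast

lemma implementsE:
  assumes "implements c R"
  obtains e where "\<And>M f f' s. 2 \<le> M \<Longrightarrow> R M f f' \<Longrightarrow> agree f s \<Longrightarrow> runs c (M ^ e) s (agree f')"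
  using assms unfolding implements_def by blast

lemma implements_Seq:
  assumes "implements c R" and "implements d S"
  shows "implements (Seq c d) (\<lambda>M f f''. \<exists>f'. R M f f' \<and> S M f' f'')"
proof -
  obtain e1 where e1: "\<And>M f f' s. 2 \<le> M \<Longrightarrow> R M f f' \<Longrightarrow> agree f s \<Longrightarrow> runs c (M ^ e1) s (agree f')"
    using assms(1) by (rule implementsE) blast
  obtain e2 where e2: "\<And>M f f' s. 2 \<le> M \<Longrightarrow> S M f f' \<Longrightarrow> agree f s \<Longrightarrow> runs d (M ^ e2) s (agree f')"
    using assms(2) by (rule implementsE) blast
  show ?thesis
  proof (rule implementsI)
    fix M f f'' s
    assume M: "2 \<le> M" and R: "\<exists>f'. R M f f' \<and> S M f' f''" and s: "agree f s"
    then obtain f' where f': "R M f f'" "S M f' f''" by blast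
    have le: "M ^ e1 + M ^ e2 + 1 \<le> M ^ (e1 + e2 + 1 + 0 + 1)"
      using power_add_le[OF M, of e1 e2] power_add_le[OF M, of "e1 + e2 + 1" 0] by simp
    have "runs (Seq c d) (M ^ e1 + M ^ e2 + 1) s (agree f'')"
      using e1[OF M f'(1) s] e2[OF M f'(2)] by (rule runs_Seq)
    from this le show "runs (Seq c d) (M ^ (e1 + e2 + 1 + 0 + 1)) s (agree f'')"
      by (rule runs_le)
  qed
qed

text \<open>Variable 0 is the index of the entry being computed. Registers 0 and 1 hold the counter
  and the table size; the entry is compiled from register 2 upwards and leaves them alone. The last
  write restores the convention that all variables are 0 between tables.\<close>

definition fill :: "string \<Rightarrow> tm \<Rightarrow> tm \<Rightarrow> com" where
  "fill a t u = Seq (compile 1 t)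
     (Seq (set_reg 0 (Const 0))
     (Seq (While (Minus (reg 1) (reg 0))
        (Seq (Write ''var'' (Const 0) (reg 0))
        (Seq (compile 2 u)
        (Seq (Write a (reg 0) (reg 2))
             (set_reg 0 (Plus (reg 0) (Const 1)))))))
     (Write ''var'' (Const 0) (Const 0))))"

definition zeros :: "nat \<Rightarrow> nat" where
  "zeros = (\<lambda>_. 0)"

definition prefix :: "(nat \<Rightarrow> nat) \<Rightarrow> nat \<Rightarrow> (nat \<Rightarrow> nat) \<Rightarrow> nat \<Rightarrow> nat" where
  "prefix h m g = (\<lambda>j. if j < m then h j else g j)"

lemma prefix_0: "prefix h 0 g = g"
  by (simp add: prefix_def)

lemma prefix_Suc: "(prefix h m g)(m := h m) = prefix h (Suc m) g"
  by (auto simp: prefix_def fun_eq_iff less_Suc_eq)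

text \<open>The entry \<open>h i\<close> is computed while only the entries below \<open>i\<close> have been filled in, so a table may
  be defined by recursion on its own earlier entries.\<close>

definition fills :: "string \<Rightarrow> tm \<Rightarrow> tm \<Rightarrow> (nat \<Rightarrow> nat) \<Rightarrow> nat \<Rightarrow> state \<Rightarrow> state \<Rightarrow> bool" where
  "fills a t u h M f f' \<longleftrightarrow> f ''var'' = zeros \<and> tables_le M f \<and>
     (\<forall>i<tval f t zeros. h i \<le> M \<and> tval (f(a := prefix h i (f a))) u (zeros(0 := i)) = h i) \<and>
     f' = f(a := prefix h (tval f t zeros) (f a))"

text \<open>The loop invariant says that the table is \<open>prefix h j\<close>. As all entries
  \<open>h i\<close> are at most M, the bound on tables survives the filling; the number of entries
  may be larger, up to M^v.\<close>

lemma implements_fill: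
  assumes t: "admissible t" and u: "admissible u" and a: "a \<noteq> ''reg''" "a \<noteq> ''var''" "a \<noteq> ''k''"
  shows "implements (fill a t u) (\<lambda>M f f'. \<exists>h. fills a t u h M f f')"
proof -
  obtain v where v: "v > 0" "val_exponent t v" using val_exponent_exists[OF t] by blast
  obtain e1 where e1: "time_exponent t e1" using time_exponent_exists[OF t] by blast
  obtain e2 where e2: "time_exponent u e2" using time_exponent_exists[OF u] by blast
  define e where "e = e1 + (v + 1 + (v * e2 + 5 + 1) + 4 + 1) + 1"
  show ?thesis
  proof (rule implementsI)
    fix M :: nat and f f' s
    assume M: "2 \<le> M" and "\<exists>h. fills a t u h M f f'" and s: "agree f s"
    then obtain h where h: "fills a t u h M f f'" by blast
    define m where "m = tval f t zeros"
    define \<tau> where "\<tau> = (M ^ v) ^ e2"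
    have var: "f ''var'' = zeros" and tab: "tables_le M f"
      and f': "f' = f(a := prefix h m (f a))"
      and hM: "\<And>i. i < m \<Longrightarrow> h i \<le> M"
      and hi: "\<And>i. i < m \<Longrightarrow> tval (f(a := prefix h i (f a))) u (zeros(0 := i)) = h i"
      using h unfolding fills_def m_def by blast+
    have s_other: "\<And>b. b \<noteq> ''reg'' \<Longrightarrow> s b = f b" using s by (simp add: agree_def)
    have tab_s: "tables_le M s" using tab s_other by (simp add: tables_le_def)
    have var_s: "s ''var'' = zeros" using s_other var by simp
    have m_s: "tval s t (s ''var'') = m"
      unfolding var_s m_def using t s_other by (intro tval_cong) auto
    have MM: "M \<le> M ^ v" using M v(1) by (simp add: self_le_power)
    have "m \<le> M ^ v"
      unfolding m_def by (rule val_exponentD[OF v(2) M tab]) (simp add: zeros_def)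
    have m1: "m + 1 \<le> M ^ (v + 1)"
      using \<open>m \<le> M ^ v\<close> power_add_le[OF M, of v 0] by simp
    define I where "I = (\<lambda>j s'. (\<forall>b. b \<noteq> ''reg'' \<longrightarrow> b \<noteq> ''var'' \<longrightarrow> s' b = (f(a := prefix h j (f a))) b) \<and>
        (\<forall>l. l \<noteq> 0 \<longrightarrow> s' ''var'' l = 0) \<and> s' ''reg'' 0 = j \<and> s' ''reg'' 1 = m)"
    let ?write = "Seq (Write a (reg 0) (reg 2)) (set_reg 0 (Plus (reg 0) (Const 1)))"
    let ?body = "Seq (Write ''var'' (Const 0) (reg 0)) (Seq (compile 2 u) ?write)"
    have body: "runs ?body (4 + (\<tau> + (5 + 6 + 1) + 1) + 1) s1 (I (Suc j))"
      if j: "j < m" and Ij: "I j s1" for j s1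
    proof (rule runs_Seq)
      have other: "\<And>b. b \<noteq> ''reg'' \<Longrightarrow> b \<noteq> ''var'' \<Longrightarrow> s1 b = (f(a := prefix h j (f a))) b"
        and vars: "\<And>l. l \<noteq> 0 \<Longrightarrow> s1 ''var'' l = 0"
        and regs: "s1 ''reg'' 0 = j" "s1 ''reg'' 1 = m"
        using Ij unfolding I_def by blast+
      define s2 where "s2 = s1(''var'' := zeros(0 := j))"
      have upd: "(s1 ''var'')(0 := j) = zeros(0 := j)" using vars by (simp add: fun_eq_iff zeros_def)
      show "runs (Write ''var'' (Const 0) (reg 0)) 4 s1 (\<lambda>x. x = s2)"
        using regs(1) upd by (intro runs_Write) (simp_all add: reg_def s2_def)
      fix s2' assume "s2' = s2"
      moreover have "runs (Seq (compile 2 u) ?write) (\<tau> + (5 + 6 + 1) + 1) s2 (I (Suc j))"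
      proof (rule runs_Seq)
        have "tval s2 u \<rho> = tval (f(a := prefix h j (f a))) u \<rho>" for \<rho>
          using u other by (intro tval_cong) (simp_all add: s2_def)
        then have ev: "tval s2 u (s2 ''var'') = h j" using hi[OF j] by (simp add: s2_def)
        show "runs (compile 2 u) \<tau> s2 (evaluated 2 (h j) s2)"
          unfolding \<tau>_def ev[symmetric]
        proof (rule time_exponentD[OF e2])
          have "prefix h j (f a) l \<le> M" for l
            using tab a hM[of l] j by (simp add: prefix_def tables_le_def)
          then have "tables_le M s2"
            using tab other by (simp add: tables_le_def s2_def)
          then show "tables_le (M ^ v) s2" using MM by (rule tables_le_mono)
          show "\<forall>l. s2 ''var'' l \<le> M ^ v"
            using j \<open>m \<le> M ^ v\<close> by (simp add: s2_def zeros_def)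
        qed (use M MM in simp)
        fix s3 assume s3: "evaluated 2 (h j) s2 s3"
        define s4 where "s4 = s3(a := (s3 a)(j := h j))"
        have s3': "\<And>b. b \<noteq> ''reg'' \<Longrightarrow> s3 b = s2 b" "s3 ''reg'' 0 = j" "s3 ''reg'' 1 = m"
          "s3 ''reg'' 2 = h j"
          using s3 regs unfolding evaluated_def s2_def by simp_all
        show "runs ?write (5 + 6 + 1) s3 (I (Suc j))"
        proof (rule runs_Seq)
          show "runs (Write a (reg 0) (reg 2)) 5 s3 (\<lambda>x. x = s4)"
            using s3' by (intro runs_Write) (simp_all add: reg_def s4_def)
          fix s4' assume "s4' = s4"
          moreover have "I (Suc j) (s4(''reg'' := (s4 ''reg'')(0 := Suc j)))"
            using s3' other a vars unfolding I_def s4_def by (simp add: s2_def prefix_Suc zeros_def)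
          moreover have "s4 ''reg'' 0 = j" using s3'(2) a by (simp add: s4_def)
          ultimately show "runs (set_reg 0 (Plus (reg 0) (Const 1))) 6 s4' (I (Suc j))"
            by (intro runs_Write) (simp_all add: reg_def)
        qed
      qed
      ultimately show "runs (Seq (compile 2 u) ?write) (\<tau> + (5 + 6 + 1) + 1) s2' (I (Suc j))"
        by simp
    qed
    have loop: "runs (While (Minus (reg 1) (reg 0)) ?body)
        ((m + 1) * (4 + (\<tau> + (5 + 6 + 1) + 1) + 1 + 5 + 1)) s1 (I m)" if "I 0 s1" for s1
    proof (rule runs_mono[OF runs_While[where I = I]])
      show "aval (Minus (reg 1) (reg 0)) s' \<noteq> 0 \<and>
          runs ?body (4 + (\<tau> + (5 + 6 + 1) + 1) + 1) s' (I (Suc j))"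
        if "j < m" "I j s'" for j s'
        using body[OF that] that by (simp add: I_def reg_def)
    qed (use that in \<open>auto simp: I_def reg_def\<close>)
    have "runs (fill a t u)
        (M ^ e1 + (3 + ((m + 1) * (4 + (\<tau> + (5 + 6 + 1) + 1) + 1 + 5 + 1) + 3 + 1) + 1) + 1) s (agree f')"
      unfolding fill_def
    proof (rule runs_Seq)
      show "runs (compile 1 t) (M ^ e1) s (evaluated 1 m s)"
        unfolding m_s[symmetric] using time_exponentD[OF e1 M tab_s] var_s by (simp add: zeros_def)
      fix s1 assume s1: "evaluated 1 m s s1"
      define s2 where "s2 = s1(''reg'' := (s1 ''reg'')(0 := 0))"
      have I0: "I 0 s2" using s1 s_other a var_s unfolding I_def evaluated_def
        by (simp add: s2_def prefix_0 zeros_def)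
      show "runs (Seq (set_reg 0 (Const 0)) (Seq (While (Minus (reg 1) (reg 0)) ?body)
          (Write ''var'' (Const 0) (Const 0))))
          (3 + ((m + 1) * (4 + (\<tau> + (5 + 6 + 1) + 1) + 1 + 5 + 1) + 3 + 1) + 1) s1 (agree f')"
      proof (rule runs_Seq)
        show "runs (set_reg 0 (Const 0)) 3 s1 (\<lambda>x. x = s2)"
          by (intro runs_Write) (simp_all add: s2_def)
        fix s2' assume "s2' = s2"
        then show "runs (Seq (While (Minus (reg 1) (reg 0)) ?body) (Write ''var'' (Const 0) (Const 0)))
            ((m + 1) * (4 + (\<tau> + (5 + 6 + 1) + 1) + 1 + 5 + 1) + 3 + 1) s2' (agree f')"
        proof (intro runs_Seq)
          show "runs (While (Minus (reg 1) (reg 0)) ?body)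
            ((m + 1) * (4 + (\<tau> + (5 + 6 + 1) + 1) + 1 + 5 + 1)) s2' (I m)"
            using loop[OF I0] \<open>s2' = s2\<close> by (simp only:)
          fix s3 assume "I m s3"
          then have "s3 b = f' b" if "b \<noteq> ''reg''" "b \<noteq> ''var''" for b
            using that unfolding I_def f' by simp
          moreover have "(s3 ''var'')(0 := 0) = f' ''var''"
            using \<open>I m s3\<close> a var unfolding I_def f' by (simp add: fun_eq_iff zeros_def)
          ultimately show "runs (Write ''var'' (Const 0) (Const 0)) 3 s3 (agree f')"
            by (intro runs_Write) (simp_all add: agree_def)
        qed
      qed
    qed
    moreover have "M ^ e1 + (3 + ((m + 1) * (4 + (\<tau> + (5 + 6 + 1) + 1) + 1 + 5 + 1) + 3 + 1) + 1) + 1 \<le> M ^ e"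
    proof -
      have c: "32 \<le> M ^ 5" "16 \<le> M ^ 4" using power_mono[OF M, of 5] power_mono[OF M, of 4] by simp_all
      have "4 + (\<tau> + (5 + 6 + 1) + 1) + 1 + 5 + 1 \<le> M ^ (v * e2 + 5 + 1)"
        using power_add_le[OF M, of "v * e2" 5] c by (simp add: \<tau>_def power_mult)
      with m1 have "(m + 1) * (4 + (\<tau> + (5 + 6 + 1) + 1) + 1 + 5 + 1) \<le> M ^ (v + 1) * M ^ (v * e2 + 5 + 1)"
        by (rule mult_le_mono)
      then have "(m + 1) * (4 + (\<tau> + (5 + 6 + 1) + 1) + 1 + 5 + 1) \<le> M ^ (v + 1 + (v * e2 + 5 + 1))"
        by (simp only: power_add)
      then show ?thesis
        using power_add_le[OF M, of "v + 1 + (v * e2 + 5 + 1)" 4] c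
          power_add_le[OF M, of e1 "v + 1 + (v * e2 + 5 + 1) + 4 + 1"]
        unfolding e_def by linarith
    qed
    ultimately show "runs (fill a t u) (M ^ e) s (agree f')" by (rule runs_le)
  qed
qed

section \<open>Sweeps\<close>

definition nb :: "('a \<Rightarrow> 'a \<Rightarrow> bool) \<Rightarrow> 'a set \<Rightarrow> 'a set" where
  "nb E X = {x. \<exists>y\<in>X. E x y}"

text \<open>Once \<open>Z\<close> and the next contaminated set \<open>Z'\<close> are fixed, a vertex of \<open>Z\<close> may be spared iff all its
  neighbours lie in \<open>Z'\<close>; in the monotone game (\<open>b\<close>) its closed neighbourhood must moreover never have
  been clean before, and for this the two preceding sets \<open>Y\<close> and \<open>X\<close> suffice.\<close>

definition spared :: "('a \<Rightarrow> 'a \<Rightarrow> bool) \<Rightarrow> bool \<Rightarrow> 'a set \<Rightarrow> 'a set \<Rightarrow> 'a set \<Rightarrow> 'a set \<Rightarrow> 'a set" where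
  "spared E b X Y Z Z' = {v\<in>Z. nbrs E v \<subseteq> Z' \<and> (b \<longrightarrow> insert v (nbrs E v) \<subseteq> X \<inter> Y)}"

definition sweep_step :: "('a \<Rightarrow> 'a \<Rightarrow> bool) \<Rightarrow> bool \<Rightarrow> nat \<Rightarrow> 'a set \<Rightarrow> 'a set \<Rightarrow> 'a set \<Rightarrow> 'a set \<Rightarrow> bool" where
  "sweep_step E b k X Y Z Z' \<longleftrightarrow> Z' = nb E (spared E b X Y Z Z') \<and> card (Z - spared E b X Y Z Z') \<le> k"

definition game_number :: "bool \<Rightarrow> 'a set \<Rightarrow> ('a \<Rightarrow> 'a \<Rightarrow> bool) \<Rightarrow> nat" where
  "game_number b V E = (if b then monotone_hunter_number V E else hunter_number V E)"

section \<open>The game in terms of sequences of contaminated sets\<close>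

locale hunted_graph =
  fixes V :: "'a set" and E :: "'a \<Rightarrow> 'a \<Rightarrow> bool"
  assumes graph: "simple_graph V E" and connected: "connected_graph V E" and card_V: "card V \<noteq> 1"
begin

lemma finite_V: "finite V" and V_nonempty: "V \<noteq> {}"
  using graph by (simp_all add: simple_graph_def)

lemma E_V: "E u v \<Longrightarrow> u \<in> V \<and> v \<in> V"
  using graph unfolding simple_graph_def by metis

lemma E_sym: "E u v \<Longrightarrow> E v u"
  using graph unfolding simple_graph_def by (metis sympD)

text \<open>A path to a second vertex starts with an edge. Without isolated vertices a round that
  spares all of V reproduces V, which gives \<open>nb_V\<close>.\<close>

lemma has_nbr:
  assumes "v \<in> V"
  shows "\<exists>u. E v u"
proof -
  have "V \<noteq> {v}" using card_V by auto
  then obtain w where "w \<in> V" "w \<noteq> v" using assms by blast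
  then have "E\<^sup>*\<^sup>* v w" using connected assms unfolding connected_graph_def by blast
  then show ?thesis using \<open>w \<noteq> v\<close> by (cases rule: converse_rtranclpE) blast+
qed

lemma nb_mono: "X \<subseteq> Y \<Longrightarrow> nb E X \<subseteq> nb E Y"
  unfolding nb_def by blast

lemma nb_subset_V: "nb E X \<subseteq> V"
  unfolding nb_def using E_V by blast

lemma nb_V: "nb E V = V"
  using nb_subset_V has_nbr E_V unfolding nb_def by blast

lemma contaminated_Suc: "contaminated V E S (Suc i) = nb E (contaminated V E S i - S ! i)"
  by (simp add: nb_def)

lemma contaminated_subset_V: "contaminated V E S i \<subseteq> V"
proof (cases i)
  case (Suc j)
  then show ?thesis using nb_subset_V by (simp only: contaminated_Suc)
qed simp

text \<open>A surviving walk can be extended by an edge after its last unshot vertex, and cutting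
  off its last vertex leaves a surviving walk. This links the definition of winning by trajectories
  to the recursion for contaminated sets.\<close>

lemma contaminated_iff_trajectory:
  "x \<in> contaminated V E S i \<longleftrightarrow>
     (\<exists>r. rabbit_trajectory V E i r \<and> (\<forall>j<i. r ! j \<notin> S ! j) \<and> r ! i = x)"
proof (induction i arbitrary: x)
  case 0
  have "rabbit_trajectory V E 0 [x]" if "x \<in> V" using that by (simp add: rabbit_trajectory_def)
  moreover have "r ! 0 \<in> V" if "rabbit_trajectory V E 0 r" for r
    using that nth_mem[of 0 r] unfolding rabbit_trajectory_def by auto
  ultimately show ?case by (auto intro!: exI[of _ "[x]"])
next
  case (Suc i)
  show ?case
  proof
    assume "x \<in> contaminated V E S (Suc i)"
    then obtain y where y: "y \<in> contaminated V E S i" "y \<notin> S ! i" "E x y" by auto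
    then obtain r where r: "rabbit_trajectory V E i r" "\<forall>j<i. r ! j \<notin> S ! j" "r ! i = y"
      using Suc.IH by blast
    have "rabbit_trajectory V E (Suc i) (r @ [x])"
      using r E_V[OF y(3)] E_sym[OF y(3)] unfolding rabbit_trajectory_def nbrs_def
      by (auto simp: nth_append le_Suc_eq)
    moreover have "\<forall>j<Suc i. (r @ [x]) ! j \<notin> S ! j" "(r @ [x]) ! Suc i = x"
      using r y(2) unfolding rabbit_trajectory_def by (auto simp: nth_append less_Suc_eq)
    ultimately show "\<exists>r. rabbit_trajectory V E (Suc i) r \<and> (\<forall>j<Suc i. r ! j \<notin> S ! j) \<and> r ! Suc i = x"
      by blast
  next
    assume "\<exists>r. rabbit_trajectory V E (Suc i) r \<and> (\<forall>j<Suc i. r ! j \<notin> S ! j) \<and> r ! Suc i = x"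
    then obtain r where r: "rabbit_trajectory V E (Suc i) r" "\<forall>j<Suc i. r ! j \<notin> S ! j" "r ! Suc i = x"
      by blast
    have "rabbit_trajectory V E i (take (Suc i) r)"
      using r(1) unfolding rabbit_trajectory_def by (auto dest: in_set_takeD)
    then have "r ! i \<in> contaminated V E S i"
      using Suc.IH[of "r ! i"] r(2) by (auto intro!: exI[of _ "take (Suc i) r"])
    moreover have "r ! Suc i \<in> nbrs E (r ! (Suc i - 1))"
      using r(1) unfolding rabbit_trajectory_def
      by (elim conjE, drule_tac bspec[where x = "Suc i"]) auto
    then have "E (r ! i) x" using r(3) by (simp add: nbrs_def)
    ultimately show "x \<in> contaminated V E S (Suc i)" using r(2) E_sym[of "r ! i" x] by auto
  qed
qed

lemma winning_iff: "winning V E S \<longleftrightarrow> contaminated V E S (length S) = {}"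
  unfolding winning_def using contaminated_iff_trajectory[of _ S "length S"] by blast

text \<open>The index is shifted by two: \<open>Z (j + 2)\<close> plays the role of the contaminated
  set after j rounds, and \<open>Z 0\<close>, \<open>Z 1\<close> are an artificial past, so that the
  first rounds also have two preceding sets.\<close>

definition sweep :: "bool \<Rightarrow> nat \<Rightarrow> nat \<Rightarrow> (nat \<Rightarrow> 'a set) \<Rightarrow> bool" where
  "sweep b k l Z \<longleftrightarrow> Z 0 = V \<and> Z 1 = V \<and> Z 2 = V \<and>
     (\<forall>j<l. sweep_step E b k (Z j) (Z (j + 1)) (Z (j + 2)) (Z (j + 3))) \<and> Z (l + 2) = {}"

definition good_strategy :: "bool \<Rightarrow> nat \<Rightarrow> 'a set list \<Rightarrow> bool" where
  "good_strategy b k S \<longleftrightarrow> hunter_strategy V S \<and> winning V E S \<and> (b \<longrightarrow> monotone_strategy V E S) \<and>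
     (\<forall>X\<in>set S. card X \<le> k)"

lemma good_strategy_V: "good_strategy b (card V) [V]"
  using V_nonempty
  by (auto simp: good_strategy_def hunter_strategy_def winning_iff monotone_strategy_def)

lemma Least_le_iff: "\<exists>m. P m \<Longrightarrow> (LEAST m. P m) \<le> k \<longleftrightarrow> (\<exists>m\<le>k. P m)" for k :: nat
  by (meson LeastI_ex Least_le le_trans)

lemma hunters_used_le: "S \<noteq> [] \<Longrightarrow> hunters_used S \<le> k \<longleftrightarrow> (\<forall>X\<in>set S. card X \<le> k)"
  unfolding hunters_used_def by simp

lemma game_number_le_iff: "game_number b V E \<le> k \<longleftrightarrow> (\<exists>S. good_strategy b k S)"
proof -
  let ?P = "\<lambda>S. hunter_strategy V S \<and> winning V E S \<and> (b \<longrightarrow> monotone_strategy V E S)"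
  have "game_number b V E = (LEAST m. \<exists>S. ?P S \<and> hunters_used S = m)"
    using card_V by (simp add: game_number_def hunter_number_def monotone_hunter_number_def conj_assoc)
  moreover have "?P [V]" using good_strategy_V[of b] unfolding good_strategy_def by blast
  then have "\<exists>m S. ?P S \<and> hunters_used S = m" by blast
  ultimately have "game_number b V E \<le> k \<longleftrightarrow> (\<exists>m\<le>k. \<exists>S. ?P S \<and> hunters_used S = m)"
    by (simp only: Least_le_iff)
  also have "\<dots> \<longleftrightarrow> (\<exists>S. ?P S \<and> hunters_used S \<le> k)" by blast
  also have "\<dots> \<longleftrightarrow> (\<exists>S. good_strategy b k S)"
  proof (rule ex_cong1)
    fix S
    show "?P S \<and> hunters_used S \<le> k \<longleftrightarrow> good_strategy b k S"
      using hunters_used_le[of S k] unfolding good_strategy_def hunter_strategy_def by blast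
  qed
  finally show ?thesis .
qed

text \<open>The contaminated sets of the strategy form the sweep: every contaminated vertex that is
  not shot is spared, hence the unspared ones are among the shots and number at most k.\<close>

lemma strategy_imp_sweep:
  assumes "good_strategy b k S"
  shows "\<exists>l Z. sweep b k l Z"
proof -
  define C where "C = contaminated V E S"
  define W where "W = (\<lambda>j. C j - S ! j)"
  \<comment> \<open>Truncated subtraction makes the first three sets equal to V.\<close>
  define Z where "Z = (\<lambda>j. C (j - 2))"
  have C_Suc: "C (Suc j) = nb E (W j)" for j unfolding C_def W_def by (rule contaminated_Suc)
  have C_V: "C j \<subseteq> V" for j unfolding C_def by (rule contaminated_subset_V)
  have nbrs_W: "nbrs E v \<subseteq> C (Suc j)" if "v \<in> W j" for v j
    using that E_sym unfolding C_Suc nb_def nbrs_def by blast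
  \<comment> \<open>A vertex left alone in round j + 1 was not cleared before, by monotonicity. So
    at each earlier time it was not shot, which contaminates its neighbours next, and some
    contaminated neighbour was not shot, which contaminates the vertex itself next.\<close>
  have old: "insert v (nbrs E v) \<subseteq> C a" if b: b and j: "j < length S" and v: "v \<in> W j" and "a \<le> j - 1" for v j a
    using \<open>a \<le> j - 1\<close>
  proof (induction a)
    case 0
    show ?case using v C_V[of j] E_V[of v] unfolding W_def nbrs_def by (auto simp: C_def)
  next
    case (Suc a)
    then have IH: "insert v (nbrs E v) \<subseteq> C a" by simp
    have not_cleared: "\<not> cleared V E S (Suc a) v"
    proof
      assume "cleared V E S (Suc a) v"
      moreover have "monotone_strategy V E S" using assms b by (simp add: good_strategy_def)
      moreover have "v \<in> V" "Suc a \<in> {1..length S}" "Suc a < j" "v \<in> C j"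
        using v C_V Suc.prems j unfolding W_def by auto
      ultimately have "v \<in> S ! j" using j unfolding monotone_strategy_def C_def by blast
      then show False using v by (simp add: W_def)
    qed
    then have "v \<in> W a" using IH by (simp add: cleared_def W_def)
    moreover obtain u where "u \<in> nbrs E v" using has_nbr v C_V unfolding W_def nbrs_def by blast
    then obtain u where "u \<in> nbrs E v" "u \<notin> S ! a" using not_cleared IH unfolding cleared_def C_def by auto
    then have "v \<in> C (Suc a)" using IH unfolding C_Suc nb_def W_def nbrs_def by blast
    ultimately show ?case using nbrs_W by simp
  qed
  have "sweep_step E b k (Z j) (Z (j + 1)) (Z (j + 2)) (Z (j + 3))" if j: "j < length S" for j
  proof -
    let ?W = "spared E b (Z j) (Z (j + 1)) (Z (j + 2)) (Z (j + 3))"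
    have Z3: "Z (j + 3) = nb E (W j)" by (simp add: Z_def C_Suc numeral_3_eq_3)
    have W: "W j \<subseteq> ?W"
    proof
      fix v assume v: "v \<in> W j"
      then have "v \<in> Z (j + 2)" by (simp add: W_def Z_def)
      moreover have "nbrs E v \<subseteq> Z (j + 3)" using nbrs_W[OF v] unfolding Z3 C_Suc .
      moreover have "insert v (nbrs E v) \<subseteq> Z j \<inter> Z (j + 1)" if b
        using old[OF that j v, of "j - 2"] old[OF that j v, of "j - 1"] unfolding Z_def by auto
      ultimately show "v \<in> ?W" unfolding spared_def by blast
    qed
    \<comment> \<open>Sparing more than the strategy does costs nothing: spared vertices have all
      their neighbours in the next set, so the next set does not grow.\<close>
    have "nb E ?W \<subseteq> Z (j + 3)"
      unfolding nb_def spared_def nbrs_def using E_sym by blast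
    then have "Z (j + 3) = nb E ?W" using nb_mono[OF W] unfolding Z3 by blast
    moreover have "card (Z (j + 2) - ?W) \<le> k"
    proof -
      have "S ! j \<in> set S" using j by simp
      then have Sj: "S ! j \<subseteq> V" "card (S ! j) \<le> k"
        using assms unfolding good_strategy_def hunter_strategy_def by auto
      have "Z (j + 2) - ?W \<subseteq> S ! j" using W unfolding W_def Z_def by auto
      then have "card (Z (j + 2) - ?W) \<le> card (S ! j)"
        using Sj finite_V by (meson card_mono finite_subset)
      with Sj show ?thesis by simp
    qed
    ultimately show ?thesis unfolding sweep_step_def by blast
  qed
  moreover have "Z (length S + 2) = {}"
    using assms by (simp add: Z_def C_def good_strategy_def winning_iff)
  ultimately have "sweep b k (length S) Z" by (simp add: sweep_def Z_def C_def)
  then show ?thesis by blast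
qed

text \<open>The shots are the unspared vertices. The obstacle is that shots must be non-empty: an
  idle round shoots a filler vertex \<open>w\<close>, paid for by k \<ge> 1. In the monotone game
  this shot counts as clearing \<open>w\<close>, so it must not change the course of the
  game.\<close>

lemma sweep_imp_strategy:
  assumes k: "k \<ge> 1" and "sweep b k l Z"
  shows "\<exists>S. good_strategy b k S"
proof -
  \<comment> \<open>The initial rounds that leave all of V contaminated are cut off, so that already
    the first remaining round makes some vertex clean.\<close>
  define a where "a = (LEAST i. Z (i + 2) \<noteq> V)"
  have "Z (l + 2) \<noteq> V" using assms V_nonempty by (simp add: sweep_def)
  then have a_neq: "Z (a + 2) \<noteq> V" and "a \<le> l" unfolding a_def by (rule LeastI, rule Least_le)
  have eq_V: "Z i = V" if "i < a + 2" for i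
  proof (cases "i < 2")
    case True
    then show ?thesis using assms by (auto simp: sweep_def less_2_cases_iff)
  next
    case False
    then have "i - 2 < a" using that by simp
    from not_less_Least[OF this[unfolded a_def]] have "Z (i - 2 + 2) = V" by blast
    then show ?thesis using False by (simp only: le_add_diff_inverse2 not_less)
  qed
  have Z012: "Z 0 = V" "Z 1 = V" "Z 2 = V" and Z_end: "Z (l + 2) = {}"
    using assms by (simp_all add: sweep_def)
  have "a \<noteq> 0" using a_neq Z012 by (metis add_0)
  define a0 where "a0 = a - 1"
  define X where "X = (\<lambda>j. Z (a0 + j))"
  define m where "m = l - a0"
  define W where "W = (\<lambda>j. spared E b (X j) (X (j + 1)) (X (j + 2)) (X (j + 3)))"
  have "m > 0" using \<open>a \<le> l\<close> \<open>a \<noteq> 0\<close> by (simp add: m_def a0_def)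
  have a: "a = a0 + 1" using \<open>a \<noteq> 0\<close> by (simp add: a0_def)
  have X0: "X 0 = V" "X 1 = V" "X 2 = V"
    using eq_V[of a0] eq_V[of "a0 + 1"] eq_V[of "a0 + 2"] by (simp_all add: X_def a)
  have X3: "X 3 \<noteq> V" using a_neq by (simp add: X_def a eval_nat_numeral)
  have X_end: "X (m + 2) = {}" using Z_end \<open>a \<le> l\<close> by (simp add: X_def m_def a add.commute)
  have step: "X (j + 3) = nb E (W j)" "card (X (j + 2) - W j) \<le> k" if "j < m" for j
  proof -
    have "a0 + j < l" using that by (simp add: m_def)
    then have "sweep_step E b k (Z (a0 + j)) (Z (a0 + j + 1)) (Z (a0 + j + 2)) (Z (a0 + j + 3))"
      using assms by (simp add: sweep_def)
    then show "X (j + 3) = nb E (W j)" "card (X (j + 2) - W j) \<le> k"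
      unfolding sweep_step_def W_def X_def by (simp_all add: add.assoc)
  qed
  have X_V: "X (j + 2) \<subseteq> V" if "j \<le> m" for j
  proof (cases j)
    case (Suc i)
    then show ?thesis using step(1)[of i] nb_subset_V that by (simp add: eval_nat_numeral)
  qed (use X0 in \<open>simp add: numeral_2_eq_2\<close>)
  have W_sub: "W j \<subseteq> X (j + 2)" for j unfolding W_def spared_def by blast
  \<comment> \<open>The filler is clean after the first round. In the monotone game it is therefore
    never spared later on, and an idle round, which spares everything contaminated, finds it
    clean.\<close>
  obtain w where w: "w \<in> V" "w \<notin> X 3" using X3 X_V[of 1] \<open>m > 0\<close> by (auto simp: eval_nat_numeral)
  \<comment> \<open>This recovers the full history from the two sets tested by
    \<open>spared\<close>.\<close>
  have old: "insert v (nbrs E v) \<subseteq> X i" if b: b and "v \<in> W j" "j < m" "i \<le> j + 1" for v i j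
    using \<open>v \<in> W j\<close> \<open>j < m\<close> \<open>i \<le> j + 1\<close>
  proof (induction j arbitrary: v i rule: less_induct)
    case (less j)
    have base: "insert v (nbrs E v) \<subseteq> X j \<inter> X (j + 1)"
      using less.prems(1) b unfolding W_def spared_def by blast
    show ?case
    proof (cases "i \<ge> j")
      case True
      then have "i = j \<or> i = j + 1" using less.prems(3) by auto
      then show ?thesis using base by blast
    next
      case False
      show ?thesis
      proof
        fix x assume x: "x \<in> insert v (nbrs E v)"
        show "x \<in> X i"
        proof (cases "i < 3")
          case True
          then have "i = 0 \<or> i = 1 \<or> i = 2" by auto
          moreover have "x \<in> V" using x less.prems X_V[of j] W_sub[of j] E_V unfolding nbrs_def by auto
          ultimately show ?thesis using X0 by auto
        next
          case i3: False
          \<comment> \<open>\<open>X (j + 1)\<close> is the result of step j - 2, so the induction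
            hypothesis reaches up to index j - 1, which is all that is left since i < j.\<close>
          define j' where "j' = j - 2"
          have j': "j + 1 = j' + 3" "j' < j" "i \<le> j' + 1" using False i3 by (auto simp: j'_def)
          have "x \<in> X (j' + 3)" using x base unfolding j'(1) by blast
          then have "x \<in> nb E (W j')" using step(1)[of j'] less.prems(2) j'(2) by simp
          then obtain y where "y \<in> W j'" "E x y" unfolding nb_def by blast
          then show ?thesis
            using less.IH[OF j'(2), of y i] j' less.prems(2) E_sym unfolding nbrs_def by auto
        qed
      qed
    qed
  qed
  have w_notin: "w \<notin> W j" if b "1 < j" "j < m" for j
    using old[OF that(1) _ that(3), of w 3] w that by auto
  define T where "T = (\<lambda>j. if X (j + 2) - W j = {} then {w} else X (j + 2) - W j)"
  define S where "S = map T [0..<m]"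
  have S_nth: "S ! j = T j" if "j < m" for j using that by (simp add: S_def)
  have len: "length S = m" by (simp add: S_def)
  have T: "T j \<noteq> {}" "T j \<subseteq> V" "card (T j) \<le> k" if "j < m" for j
    using X_V[of j] step(2)[OF that] that w(1) k unfolding T_def by auto
  have "hunter_strategy V S"
    unfolding hunter_strategy_def S_def using \<open>m > 0\<close> T(1,2) by auto
  moreover have "\<forall>Y\<in>set S. card Y \<le> k"
    unfolding S_def using T(3) by auto
  \<comment> \<open>Filler shots can only remove contamination, so an inclusion is enough for
    winning.\<close>
  moreover have sub: "contaminated V E S j \<subseteq> X (j + 2)" if "j \<le> m" for j
    using that
  proof (induction j)
    case 0
    then show ?case using X0 by (simp add: numeral_2_eq_2)
  next
    case (Suc j)
    then have "contaminated V E S j - S ! j \<subseteq> W j" by (auto simp: S_nth T_def split: if_splits)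
    then show ?case using nb_mono step(1)[of j] Suc.prems
      by (simp add: contaminated_Suc eval_nat_numeral del: contaminated.simps)
  qed
  then have "winning V E S" using X_end unfolding winning_iff len by blast
  moreover have "monotone_strategy V E S" if b
  proof -
    have w_out: "w \<notin> X (j + 2)" if "j < m" "X (j + 2) - W j = {}" for j
    proof
      assume wX: "w \<in> X (j + 2)"
      then have "w \<in> W j" using that by blast
      moreover have "j \<noteq> 0"
      \<comment> \<open>An idle first round would spare all of V and reproduce it, against the
        choice of the cut.\<close>
      proof
        assume "j = 0"
        then have "W 0 = V" using that(2) W_sub[of 0] X0 by (auto simp: numeral_2_eq_2)
        then have "X 3 = V" using step(1)[of 0] \<open>m > 0\<close> nb_V by simp
        then show False using X3 by simp
      qed
      moreover have "j \<noteq> 1" using wX w by (auto simp: eval_nat_numeral)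
      ultimately show False using w_notin[OF \<open>b\<close> _ that(1)] by simp
    qed
    \<comment> \<open>Monotonicity speaks about the actual contaminated sets, so here equality is
      required; it holds because a filler shot hits a clean vertex.\<close>
    have eq: "contaminated V E S j = X (j + 2)" if "j \<le> m" for j
      using that
    proof (induction j)
      case 0
      then show ?case using X0 by (simp add: numeral_2_eq_2)
    next
      case (Suc j)
      then have "X (j + 2) - T j = W j" using W_sub[of j] w_out[of j] by (auto simp: T_def)
      then show ?case using step(1)[of j] Suc
        by (simp add: contaminated_Suc S_nth eval_nat_numeral del: contaminated.simps)
    qed
    \<comment> \<open>If \<open>v\<close> is spared at j, its closed neighbourhood was contaminated
      all along. Hence \<open>v\<close> was spared in the earlier round as well, and so was some
      neighbour \<open>u\<close>; neither was shot, which excludes both ways of being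
      cleared.\<close>
    have key: "v \<notin> W j" if v: "cleared V E S (Suc i) v" and ij: "Suc i < j" "j < m" for v i j
    proof
      assume vW: "v \<in> W j"
      have closed: "insert v (nbrs E v) \<subseteq> X q" if "q \<le> j + 1" for q
        using old[OF \<open>b\<close> vW ij(2) that] .
      have spare: "v \<in> W i"
        unfolding W_def spared_def
        using closed[of i] closed[of "i + 1"] closed[of "i + 2"] closed[of "i + 3"] ij by auto
      have i: "i < m" using ij by simp
      have no_w: "u \<noteq> w" if "u \<in> W i" "X (i + 2) - W i = {}" for u
        using w_out[OF i that(2)] W_sub[of i] that by auto
      have disj: "u \<notin> S ! i" if "u \<in> W i" for u
        using that no_w[OF that] i by (auto simp: S_nth T_def)
      have "v \<in> X (i + 3)" using closed[of "i + 3"] ij by auto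
      then obtain u where u: "u \<in> W i" "E v u" using step(1)[OF i] unfolding nb_def by blast
      then have "u \<in> nbrs E v \<inter> contaminated V E S i"
        using W_sub[of i] eq[of i] i unfolding nbrs_def by auto
      moreover have "u \<notin> S ! i" "v \<notin> S ! i" using disj u(1) spare by blast+
      ultimately show False using v unfolding cleared_def by auto
    qed
    show ?thesis
      unfolding monotone_strategy_def len
    proof (intro ballI impI allI)
      fix v i j
      assume i: "i \<in> {1..m}" and c: "cleared V E S i v"
        and j: "i < j \<and> j < m \<and> v \<in> contaminated V E S j"
      have "v \<notin> W j" using key[of "i - 1" v j] i c j by simp
      then show "v \<in> S ! j" using j eq[of j] by (auto simp: S_nth T_def)
    qed
  qed
  ultimately show ?thesis unfolding good_strategy_def by blast
qed

lemma game_number_le_iff_sweep: "k \<ge> 1 \<Longrightarrow> game_number b V E \<le> k \<longleftrightarrow> (\<exists>l Z. sweep b k l Z)"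
  using game_number_le_iff strategy_imp_sweep sweep_imp_strategy by blast

text \<open>A rabbit that escapes the first shot is off the cover and must step onto it. With two
  rounds there is no pair 1 \<le> i < j < 2, so monotonicity holds.\<close>

lemma good_strategy_cover:
  assumes "vertex_cover V E C" "C \<noteq> {}"
  shows "good_strategy b (card C) [C, C]"
proof -
  have "contaminated V E [C, C] 2 = {}"
    using assms(1) unfolding vertex_cover_def by (auto simp: numeral_2_eq_2)
  moreover have "length [C, C] = 2" by simp
  ultimately have "winning V E [C, C]" by (simp only: winning_iff)
  moreover have "hunter_strategy V [C, C]"
    using assms unfolding hunter_strategy_def vertex_cover_def by simp
  moreover have "monotone_strategy V E [C, C]" unfolding monotone_strategy_def by auto
  ultimately show ?thesis by (simp add: good_strategy_def)
qed

lemma cover_nonempty: "vertex_cover V E C \<Longrightarrow> C \<noteq> {}"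
  using V_nonempty has_nbr unfolding vertex_cover_def by blast

lemma game_number_le_vc: "game_number b V E \<le> vc_number V E"
proof -
  have "vertex_cover V E V" using E_V unfolding vertex_cover_def by blast
  then have "\<exists>m C. vertex_cover V E C \<and> card C = m" by blast
  from LeastI_ex[OF this] obtain C where C: "vertex_cover V E C" "card C = vc_number V E"
    unfolding vc_number_def by blast
  then show ?thesis
    using good_strategy_cover[OF C(1) cover_nonempty[OF C(1)], of b] game_number_le_iff by metis
qed

end

section \<open>A vertex cover and codes for contaminated sets\<close>

text \<open>Greedy matching: the pairs \<open>z = u n + v\<close> are scanned in order, and the ends of an edge are added
  when neither end has been added before.\<close>

primrec scanned :: "nat \<Rightarrow> (nat \<Rightarrow> nat \<Rightarrow> bool) \<Rightarrow> nat \<Rightarrow> nat set" where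
  "scanned n E 0 = {}"
| "scanned n E (Suc z) = scanned n E z \<union>
     (if E (z div n) (z mod n) \<and> z div n \<notin> scanned n E z \<and> z mod n \<notin> scanned n E z
      then {z div n, z mod n} else {})"

definition greedy_cover :: "nat \<Rightarrow> (nat \<Rightarrow> nat \<Rightarrow> bool) \<Rightarrow> nat set" where
  "greedy_cover n E = scanned n E (n * n)"

lemma scanned_mono: "y \<le> z \<Longrightarrow> scanned n E y \<subseteq> scanned n E z"
  by (induction rule: dec_induct) auto

lemma scanned_subset: "(\<And>u v. E u v \<Longrightarrow> u < n \<and> v < n) \<Longrightarrow> scanned n E z \<subseteq> {..<n}"
proof (induction z)
  case (Suc z)
  then show ?case by (simp only: scanned.simps split: if_splits) blast
qed simp

lemma greedy_cover_subset: "(\<And>u v. E u v \<Longrightarrow> u < n \<and> v < n) \<Longrightarrow> greedy_cover n E \<subseteq> {..<n}"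
  unfolding greedy_cover_def by (rule scanned_subset)

lemma index_less: "u < a \<Longrightarrow> v < n \<Longrightarrow> u * n + v < a * n" for u v a n :: nat
proof -
  assume "u < a" "v < n"
  then have "u * n + v < Suc u * n" by simp
  also have "\<dots> \<le> a * n" using \<open>u < a\<close> by (intro mult_le_mono1) simp
  finally show ?thesis .
qed

text \<open>When the scan has passed the pair (u, v), one end of the edge was present before or has
  just been added, and vertices are never removed.\<close>

lemma greedy_cover_covers:
  assumes "E u v" and "u < n" and "v < n"
  shows "u \<in> greedy_cover n E \<or> v \<in> greedy_cover n E"
proof -
  let ?z = "u * n + v"
  have "Suc ?z \<le> n * n" using index_less[OF assms(2,3)] by simp
  then have "scanned n E (Suc ?z) \<subseteq> greedy_cover n E"
    unfolding greedy_cover_def by (rule scanned_mono)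
  moreover have "?z div n = u" "?z mod n = v" using assms by simp_all
  ultimately show ?thesis using assms(1) by (auto split: if_splits)
qed

text \<open>Every added pair is an edge with two new ends, one of which lies in X. So the scanned
  set grows by at most two whenever its intersection with X grows.\<close>

lemma card_scanned:
  assumes "finite X" and "\<And>u v. E u v \<Longrightarrow> u \<in> X \<or> v \<in> X"
  shows "card (scanned n E z) \<le> 2 * card (X \<inter> scanned n E z)"
proof (induction z)
  case (Suc z)
  let ?u = "z div n" and ?v = "z mod n" and ?A = "scanned n E z"
  show ?case
  proof (cases "E ?u ?v \<and> ?u \<notin> ?A \<and> ?v \<notin> ?A")
    case True
    then obtain w where w: "w \<in> X" "w \<notin> ?A" "w \<in> {?u, ?v}" using assms(2) by blast
    have fin: "finite (X \<inter> scanned n E (Suc z))" using assms(1) by simp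
    have "card (scanned n E (Suc z)) \<le> card ?A + card {?u, ?v}"
      using True by (simp only: scanned.simps if_True simp_thms card_Un_le)
    also have "card {?u, ?v} \<le> 2" by (simp add: card_insert_if)
    finally have "card (scanned n E (Suc z)) \<le> card ?A + 2" by simp
    moreover have "insert w (X \<inter> ?A) \<subseteq> X \<inter> scanned n E (Suc z)" using True w by auto
    then have "card (insert w (X \<inter> ?A)) \<le> card (X \<inter> scanned n E (Suc z))"
      using fin by (rule card_mono[rotated])
    moreover have "card (insert w (X \<inter> ?A)) = Suc (card (X \<inter> ?A))"
      using w assms(1) by simp
    ultimately show ?thesis using Suc by linarith
  next
    case False
    then have "scanned n E (Suc z) = ?A" by auto
    then show ?thesis using Suc by (simp only:)
  qed
qed simp

lemma card_greedy_cover: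
  assumes "vertex_cover {..<n} E X"
  shows "card (greedy_cover n E) \<le> 2 * card X"
proof -
  have X: "finite X" "\<And>u v. E u v \<Longrightarrow> u \<in> X \<or> v \<in> X"
    using assms finite_subset unfolding vertex_cover_def by blast+
  have "card (greedy_cover n E) \<le> 2 * card (X \<inter> scanned n E (n * n))"
    unfolding greedy_cover_def using card_scanned[OF X] .
  also have "\<dots> \<le> 2 * card X" using X(1) by (simp add: card_mono)
  finally show ?thesis .
qed

text \<open>The rank numbers the elements of C consecutively from 0. Addressing bits by rank instead
  of by vertex keeps the number of codes exponential in |C| and not in n.\<close>

definition rank :: "nat set \<Rightarrow> nat \<Rightarrow> nat" where
  "rank C v = card {u. u < v \<and> u \<in> C}"

lemma rank_Suc: "rank C (Suc v) = rank C v + of_bool (v \<in> C)"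
proof -
  have "{u. u < Suc v \<and> u \<in> C} = (if v \<in> C then insert v {u. u < v \<and> u \<in> C} else {u. u < v \<and> u \<in> C})"
    by (auto simp: less_Suc_eq)
  then show ?thesis by (simp add: rank_def)
qed

lemma rank_mono: "u \<le> v \<Longrightarrow> rank C u \<le> rank C v"
  by (induction rule: dec_induct) (simp_all add: rank_Suc)

lemma rank_less: "u \<in> C \<Longrightarrow> u < v \<Longrightarrow> rank C u < rank C v"
  using rank_mono[of "Suc u" v C] by (simp add: rank_Suc)

lemma rank_inj: "inj_on (rank C) C"
  by (rule linorder_inj_onI') (use rank_less in fastforce)

lemma rank_full: "C \<subseteq> {..<n} \<Longrightarrow> rank C n = card C"
  unfolding rank_def by (rule arg_cong[where f = card]) auto

text \<open>A set that can be contaminated is \<open>Q \<union> (N(P) - C)\<close> with \<open>P, Q \<subseteq> C\<close>, since every neighbour of a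
  vertex outside the cover \<open>C\<close> lies in \<open>C\<close>. The binary digits of a code below \<open>4^|C|\<close> are the
  characteristic functions of \<open>Q\<close> (low half) and \<open>P\<close> (high half).\<close>

definition decode :: "nat \<Rightarrow> (nat \<Rightarrow> nat \<Rightarrow> bool) \<Rightarrow> nat set \<Rightarrow> nat \<Rightarrow> nat set" where
  "decode n E C x = {v. v < n \<and> (if v \<in> C then odd (x div 2 ^ rank C v)
      else \<exists>u<n. u \<in> C \<and> E u v \<and> odd (x div 2 ^ (card C + rank C u)))}"

lemma set_encode_less: "A \<subseteq> {..<m} \<Longrightarrow> set_encode A < 2 ^ m"
proof -
  assume "A \<subseteq> {..<m}"
  then have "set_encode A \<le> set_encode {..<m}"
    unfolding set_encode_def by (intro sum_mono2) auto
  also have "\<dots> = (\<Sum>i<m. 2 ^ i)" by (simp add: set_encode_def)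
  also have "\<dots> < 2 ^ m" by (induction m) auto
  finally show ?thesis .
qed

lemma decode_surj:
  assumes C: "C \<subseteq> {..<n}" and P: "P \<subseteq> C" and Q: "Q \<subseteq> C"
    and E: "\<And>u v. E u v \<Longrightarrow> u < n \<and> v < n" "\<And>u v. E u v \<Longrightarrow> E v u"
  shows "\<exists>x<2 ^ (2 * card C). decode n E C x = Q \<union> (nb E P - C)"
proof -
  \<comment> \<open>The set of one-bits of the code. Ranks of elements of C are below |C|, so the
    part for P, shifted by |C|, cannot collide with the part for Q.\<close>
  let ?A = "rank C ` Q \<union> (\<lambda>u. card C + rank C u) ` P"
  let ?x = "set_encode ?A"
  have less: "rank C u < card C" if "u \<in> C" for u
    using rank_less[OF that, of n] rank_full[OF C] that C by auto
  have fin: "finite ?A" using C P Q by (meson finite_UnI finite_imageI finite_lessThan finite_subset)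
  have "?A \<subseteq> {..<2 * card C}" using less P Q by fastforce
  then have "?x < 2 ^ (2 * card C)" by (rule set_encode_less)
  have bit: "odd (?x div 2 ^ i) \<longleftrightarrow> i \<in> ?A" for i
    using set_encode_inverse[OF fin] unfolding set_decode_def by blast
  have low: "rank C v \<in> ?A \<longleftrightarrow> v \<in> Q" if "v \<in> C" for v
    using inj_onD[OF rank_inj _ that] less[OF that] Q by auto
  have high: "card C + rank C v \<in> ?A \<longleftrightarrow> v \<in> P" if "v \<in> C" for v
  proof -
    have "card C + rank C v \<noteq> rank C q" if "q \<in> Q" for q using less[of q] that Q by auto
    then show ?thesis using inj_onD[OF rank_inj _ that] P by auto
  qed
  have "decode n E C ?x = Q \<union> (nb E P - C)"
  proof (rule set_eqI)
    fix v
    show "v \<in> decode n E C ?x \<longleftrightarrow> v \<in> Q \<union> (nb E P - C)"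
    proof (cases "v \<in> C")
      case True
      then have "v < n" using C by auto
      then show ?thesis using True low[OF True] by (simp add: decode_def bit)
    next
      case False
      then have "v \<in> decode n E C ?x \<longleftrightarrow> v < n \<and> (\<exists>u<n. u \<in> C \<and> E u v \<and> card C + rank C u \<in> ?A)"
        by (simp add: decode_def bit)
      also have "\<dots> \<longleftrightarrow> v < n \<and> (\<exists>u<n. u \<in> C \<and> E u v \<and> u \<in> P)" using high by blast
      also have "\<dots> \<longleftrightarrow> v \<in> nb E P" using P E unfolding nb_def by blast
      finally show ?thesis using False Q by blast
    qed
  qed
  then show ?thesis using \<open>?x < 2 ^ (2 * card C)\<close> by blast
qed

section \<open>Sweeps as paths between triples of codes\<close>

text \<open>The triple \<open>(x\<^sub>1, x\<^sub>2, x\<^sub>3)\<close> of codes below \<open>N\<close> is the number \<open>(x\<^sub>1 N + x\<^sub>2) N + x\<^sub>3\<close>.\<close>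

definition triple_step ::
    "('a \<Rightarrow> 'a \<Rightarrow> bool) \<Rightarrow> bool \<Rightarrow> nat \<Rightarrow> nat \<Rightarrow> (nat \<Rightarrow> 'a set) \<Rightarrow> nat \<Rightarrow> nat \<Rightarrow> bool" where
  "triple_step E b k N D x y \<longleftrightarrow> y div N = x mod (N * N) \<and>
     sweep_step E b k (D (x div (N * N))) (D (x div N mod N)) (D (x mod N)) (D (y mod N))"

definition triple_start :: "'a set \<Rightarrow> nat \<Rightarrow> (nat \<Rightarrow> 'a set) \<Rightarrow> nat \<Rightarrow> bool" where
  "triple_start V N D x \<longleftrightarrow> D (x div (N * N)) = V \<and> D (x div N mod N) = V \<and> D (x mod N) = V"

definition triple_rel ::
    "('a \<Rightarrow> 'a \<Rightarrow> bool) \<Rightarrow> bool \<Rightarrow> nat \<Rightarrow> nat \<Rightarrow> (nat \<Rightarrow> 'a set) \<Rightarrow> (nat \<times> nat) set" where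
  "triple_rel E b k N D = {(x, y). x < N * N * N \<and> y < N * N * N \<and> triple_step E b k N D x y}"

definition triple_reach ::
    "'a set \<Rightarrow> ('a \<Rightarrow> 'a \<Rightarrow> bool) \<Rightarrow> bool \<Rightarrow> nat \<Rightarrow> nat \<Rightarrow> (nat \<Rightarrow> 'a set) \<Rightarrow> nat \<Rightarrow> nat \<Rightarrow> bool" where
  "triple_reach V E b k N D i y \<longleftrightarrow>
     (\<exists>x<N * N * N. triple_start V N D x \<and> (x, y) \<in> triple_rel E b k N D ^^ i)"

lemma triple_reach_0: "y < N * N * N \<Longrightarrow> triple_reach V E b k N D 0 y \<longleftrightarrow> triple_start V N D y"
  by (auto simp: triple_reach_def)

lemma triple_reach_Suc:
  assumes "y < N * N * N"
  shows "triple_reach V E b k N D (Suc i) y \<longleftrightarrow>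
     (\<exists>x<N * N * N. triple_reach V E b k N D i x \<and> triple_step E b k N D x y)"
  using assms unfolding triple_reach_def by (auto simp: triple_rel_def relcomp_unfold)

text \<open>A shortest path uses at most as many steps as the relation has pairs, hence at most B^2
  for B = N^3. This gives the table of reachable triples a finite number of rows.\<close>

lemma triple_reach_bounded:
  assumes "triple_reach V E b k N D i y"
  shows "\<exists>j\<le>(N * N * N) * (N * N * N). triple_reach V E b k N D j y"
proof -
  let ?B = "N * N * N" and ?r = "triple_rel E b k N D"
  have sub: "?r \<subseteq> {..<?B} \<times> {..<?B}" unfolding triple_rel_def by auto
  then have fin: "finite ?r" by (rule finite_subset) simp
  have "card ?r \<le> ?B * ?B" using card_mono[OF _ sub] by (simp add: card_cartesian_product)
  obtain x where x: "x < ?B" "triple_start V N D x" "(x, y) \<in> ?r ^^ i"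
    using assms unfolding triple_reach_def by blast
  then have "(x, y) \<in> ?r\<^sup>*" by (meson relpow_imp_rtrancl)
  then obtain j where "j \<le> card ?r" "(x, y) \<in> ?r ^^ j"
    using rtrancl_finite_eq_relpow[OF fin] by auto
  then show ?thesis using x \<open>card ?r \<le> ?B * ?B\<close> unfolding triple_reach_def by (meson le_trans)
qed

text \<open>A set may have several codes, while consecutive triples have to overlap as numbers. So
  one code \<open>c j\<close> is fixed for each \<open>Z j\<close>, and the triples are cut out of
  this sequence.\<close>

lemma (in hunted_graph) sweep_imp_triple_reach:
  assumes sw: "sweep b k l Z" and D: "\<And>j. j \<le> l + 2 \<Longrightarrow> \<exists>x<N. D x = Z j"
  shows "\<exists>i y. y < N * N * N \<and> triple_reach V E b k N D i y \<and> D (y mod N) = {}"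
proof -
  obtain c where c: "\<And>j. j \<le> l + 2 \<Longrightarrow> c j < N \<and> D (c j) = Z j" using D by metis
  define f where "f = (\<lambda>j. (c j * N + c (j + 1)) * N + c (j + 2))"
  have N: "N > 0" using c[of 0] by simp
  have f: "f j < N * N * N" "f j div (N * N) = c j" "f j div N mod N = c (j + 1)"
    "f j mod N = c (j + 2)" "f j div N = c j * N + c (j + 1)"
    "f j mod (N * N) = c (j + 1) * N + c (j + 2)" if "j \<le> l" for j
  proof -
    have cN: "c j < N" "c (j + 1) < N" "c (j + 2) < N"
      using c[of j] c[of "j + 1"] c[of "j + 2"] that by auto
    show "f j < N * N * N" unfolding f_def using cN by (intro index_less)
    show 1: "f j div N = c j * N + c (j + 1)" and 2: "f j mod N = c (j + 2)"
      unfolding f_def using cN by simp_all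
    show "f j div N mod N = c (j + 1)" unfolding 1 using cN by simp
    have less: "c (j + 1) * N + c (j + 2) < N * N" using cN by (intro index_less)
    have eq: "f j = c (j + 1) * N + c (j + 2) + c j * (N * N)"
      by (simp add: f_def algebra_simps)
    show "f j div (N * N) = c j"
      unfolding eq using div_mult_self1[of "N * N"] div_less[OF less] N by simp
    show "f j mod (N * N) = c (j + 1) * N + c (j + 2)"
      unfolding eq using less by (simp only: mod_mult_self1 mod_less)
  qed
  have "(f 0, f j) \<in> triple_rel E b k N D ^^ j" if "j \<le> l" for j
    using that
  proof (induction j)
    case (Suc j)
    have "sweep_step E b k (Z j) (Z (j + 1)) (Z (j + 2)) (Z (j + 3))"
      using sw Suc.prems by (simp add: sweep_def)
    then have "triple_step E b k N D (f j) (f (Suc j))"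
      unfolding triple_step_def using Suc.prems f[of j] f[of "Suc j"] c[of j] c[of "j + 1"]
        c[of "j + 2"] c[of "j + 3"] by (simp add: eval_nat_numeral)
    then have "(f j, f (Suc j)) \<in> triple_rel E b k N D"
      using f(1)[of j] f(1)[of "Suc j"] Suc.prems by (simp add: triple_rel_def)
    then show ?case using Suc by auto
  qed simp
  moreover have "triple_start V N D (f 0)"
    unfolding triple_start_def using f[of 0] c[of 0] c[of 1] c[of 2] sw
    by (simp add: sweep_def numeral_2_eq_2)
  moreover have "D (f l mod N) = {}" using f[of l] c[of "l + 2"] sw by (simp add: sweep_def)
  ultimately show ?thesis using f(1) unfolding triple_reach_def by blast
qed

text \<open>The sweep consists of the third components, shifted by two. The overlap condition makes
  the other two components of a triple the third components of its predecessors, and the start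
  condition handles the beginning.\<close>

lemma (in hunted_graph) triple_reach_imp_sweep:
  assumes reach: "triple_reach V E b k N D i y" and y: "D (y mod N) = {}"
  shows "\<exists>Z. sweep b k i Z"
proof -
  obtain x where x: "triple_start V N D x" "(x, y) \<in> triple_rel E b k N D ^^ i"
    using reach unfolding triple_reach_def by blast
  then obtain f where f: "f 0 = x" "f i = y"
    and rel: "\<And>j. j < i \<Longrightarrow> (f j, f (Suc j)) \<in> triple_rel E b k N D"
    unfolding relpow_fun_conv by blast
  define Z where "Z = (\<lambda>j. if j < 2 then V else D (f (j - 2) mod N))"
  have c2: "Z (j + 1) = D (f j div N mod N)" if "j \<le> i" for j
  proof (cases j)
    case 0
    then show ?thesis using x f by (simp add: Z_def triple_start_def)
  next
    case (Suc l)
    then have "f j div N = f l mod (N * N)"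
      using rel[of l] that unfolding triple_rel_def triple_step_def by auto
    then have "f j div N mod N = f l mod N" by (simp add: mod_mult2_eq)
    then show ?thesis using Suc by (simp add: Z_def)
  qed
  have c1: "Z j = D (f j div (N * N))" if "j \<le> i" for j
  proof (cases j)
    case 0
    then show ?thesis using x f by (simp add: Z_def triple_start_def)
  next
    case (Suc l)
    then have "f j div N = f l mod (N * N)"
      using rel[of l] that unfolding triple_rel_def triple_step_def by auto
    then have "f j div N div N = f l mod (N * N) div N" by simp
    then have "f j div (N * N) = f l div N mod N"
      by (cases "N = 0") (simp_all add: div_mult2_eq mod_mult2_eq)
    then show ?thesis using c2[of l] that Suc by simp
  qed
  have "sweep_step E b k (Z j) (Z (j + 1)) (Z (j + 2)) (Z (j + 3))" if "j < i" for j
    using rel[OF that] c1[of j] c2[of j] that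
    unfolding triple_rel_def triple_step_def by (simp add: Z_def eval_nat_numeral)
  moreover have "Z 0 = V" "Z 1 = V" "Z (i + 2) = {}" using y f by (simp_all add: Z_def)
  moreover have "Z 2 = V" using x f by (simp add: Z_def triple_start_def)
  ultimately show ?thesis unfolding sweep_def by blast
qed

lemma (in hunted_graph) sweep_form:
  assumes C: "vertex_cover V E C" and sw: "sweep b k l Z" and j: "j \<le> l + 2"
  shows "\<exists>P\<subseteq>C. \<exists>Q\<subseteq>C. Z j = Q \<union> (nb E P - C)"
proof -
  have form: "\<exists>P\<subseteq>C. \<exists>Q\<subseteq>C. nb E W = Q \<union> (nb E P - C)" for W
  proof (intro exI conjI)
    \<comment> \<open>The witnesses are P = W \<inter> C and Q = nb E W \<inter> C: a vertex outside
      the cover has its neighbours in C, so outside C only W \<inter> C is visible.\<close>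
    show "nb E W = (nb E W \<inter> C) \<union> (nb E (W \<inter> C) - C)"
      using C unfolding nb_def vertex_cover_def by blast
  qed blast+
  show ?thesis
  proof (cases "j < 3")
    case True
    then have "j = 0 \<or> j = 1 \<or> j = 2" by auto
    then have "Z j = nb E V" using sw nb_V unfolding sweep_def by metis
    then show ?thesis using form by simp
  next
    case False
    define i where "i = j - 3"
    have "j = i + 3" "i < l" using False j by (auto simp: i_def)
    then show ?thesis using sw form unfolding sweep_def sweep_step_def by metis
  qed
qed

lemma decode_triple_reach_iff:
  assumes G: "hunted_graph {..<n} E" and C: "vertex_cover {..<n} E C" and k: "k \<ge> 1"
    and N: "N = 2 ^ (2 * card C)"
  shows "game_number b {..<n} E \<le> k \<longleftrightarrow>
     (\<exists>i y. i \<le> (N * N * N) * (N * N * N) \<and> y < N * N * N \<and>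
        triple_reach {..<n} E b k N (decode n E C) i y \<and> decode n E C (y mod N) = {})"
    (is "_ \<longleftrightarrow> ?R")
proof -
  interpret hunted_graph "{..<n}" E by (rule G)
  have Cn: "C \<subseteq> {..<n}" using C by (simp add: vertex_cover_def)
  have surj: "\<exists>x<N. decode n E C x = Q \<union> (nb E P - C)" if "P \<subseteq> C" "Q \<subseteq> C" for P Q
    unfolding N using Cn that E_V E_sym by (intro decode_surj) auto
  have "(\<exists>l Z. sweep b k l Z) \<longleftrightarrow> ?R"
  proof
    assume "\<exists>l Z. sweep b k l Z"
    then obtain l Z where sw: "sweep b k l Z" by blast
    have "\<exists>x<N. decode n E C x = Z j" if "j \<le> l + 2" for j
      using sweep_form[OF C sw that] surj by metis
    then obtain i y where y: "y < N * N * N" "triple_reach {..<n} E b k N (decode n E C) i y"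
        "decode n E C (y mod N) = {}"
      using sweep_imp_triple_reach[OF sw] by blast
    from triple_reach_bounded[OF y(2)] y(1,3) show ?R by blast
  next
    assume ?R
    then show "\<exists>l Z. sweep b k l Z" using triple_reach_imp_sweep by blast
  qed
  then show ?thesis using game_number_le_iff_sweep[OF k] by blast
qed

section \<open>The solver\<close>

definition n_tm :: tm where "n_tm = TRead ''n'' (TConst 0)"
definition N_tm :: tm where "N_tm = TRead ''N'' (TConst 0)"
definition B_tm :: tm where "B_tm = TMul (TMul N_tm N_tm) N_tm"
definition R_size_tm :: tm where "R_size_tm = TMul (TAdd (TMul B_tm B_tm) (TConst 1)) B_tm"

definition at_tm :: "string \<Rightarrow> tm \<Rightarrow> tm \<Rightarrow> tm \<Rightarrow> tm" where
  "at_tm a u w v = TRead a (TAdd (TMul u w) v)"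

abbreviation y_tm :: tm where "y_tm \<equiv> TVar 0"

text \<open>Rows have length n; row z + 1 is the characteristic function of the set scanned after
  the pair z and is computed from row z. Row 0 is empty by the test n \<le> y. In row-major order
  \<open>adj\<close> has the pair number z itself as index.\<close>

definition scan_tm :: tm where
  "scan_tm = (let z = TSub (TDiv y_tm n_tm) (TConst 1); u = TDiv z n_tm; v = TMod z n_tm;
       w = TMod y_tm n_tm
     in TAnd (TLe n_tm y_tm) (TOr (at_tm ''c'' z n_tm w)
          (TAnd (TAnd (TRead ''adj'' z) (TNot (TOr (at_tm ''c'' z n_tm u) (at_tm ''c'' z n_tm v))))
                (TOr (TEq w u) (TEq w v)))))"

definition cover_tm :: "tm \<Rightarrow> tm" where
  "cover_tm v = at_tm ''c'' (TMul n_tm n_tm) n_tm v"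

definition rank_tm :: tm where
  "rank_tm = TSum 1 y_tm (cover_tm (TVar 1))"

definition cover_size_tm :: tm where
  "cover_size_tm = TRead ''r'' n_tm"

text \<open>For y = 0 the truncated index makes the entry read itself, still 0 at that time, and 1 -
  y supplies the value 1. For y > 0 that summand vanishes and the previous entry is doubled.\<close>

definition power_tm :: tm where
  "power_tm = (let p = TRead ''p'' (TSub y_tm (TConst 1)) in TAdd (TSub (TConst 1) y_tm) (TAdd p p))"

definition g_tm :: tm where "g_tm = TRead ''g'' (TConst 0)"

definition double_tm :: "tm \<Rightarrow> tm" where
  "double_tm t = TAdd t t"

definition bit_tm :: "tm \<Rightarrow> tm \<Rightarrow> tm" where
  "bit_tm x i = TMod (TDiv x (TRead ''p'' i)) (TConst 2)"

definition decode_tm :: tm where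
  "decode_tm = (let x = TDiv y_tm n_tm; v = TMod y_tm n_tm in
     TOr (TAnd (cover_tm v) (bit_tm x (TRead ''r'' v)))
         (TAnd (TNot (cover_tm v))
            (TEx 1 n_tm (TAnd (TAnd (cover_tm (TVar 1)) (at_tm ''adj'' (TVar 1) n_tm v))
               (bit_tm x (TAdd cover_size_tm (TRead ''r'' (TVar 1))))))))"

definition in_tm :: "tm \<Rightarrow> tm \<Rightarrow> tm" where
  "in_tm x v = at_tm ''z'' x n_tm v"

definition first_tm :: "tm \<Rightarrow> tm" where "first_tm x = TDiv x (TMul N_tm N_tm)"
definition second_tm :: "tm \<Rightarrow> tm" where "second_tm x = TMod (TDiv x N_tm) N_tm"
definition third_tm :: "tm \<Rightarrow> tm" where "third_tm x = TMod x N_tm"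

definition all_tm :: "nat \<Rightarrow> tm \<Rightarrow> tm" where
  "all_tm i x = TAll i n_tm (in_tm x (TVar i))"

definition start_tm :: "tm \<Rightarrow> tm" where
  "start_tm x = TAnd (all_tm 10 (first_tm x)) (TAnd (all_tm 10 (second_tm x)) (all_tm 10 (third_tm x)))"

definition spared_tm :: "bool \<Rightarrow> tm \<Rightarrow> tm \<Rightarrow> nat \<Rightarrow> tm" where
  "spared_tm b x y i = TAnd (in_tm (third_tm x) (TVar i)) (TAnd
     (TAll 12 n_tm (TOr (TNot (at_tm ''adj'' (TVar i) n_tm (TVar 12)))
        (TAnd (in_tm (third_tm y) (TVar 12)) (if b then
           TAnd (in_tm (first_tm x) (TVar 12)) (in_tm (second_tm x) (TVar 12)) else TConst 1))))
     (if b then TAnd (in_tm (first_tm x) (TVar i)) (in_tm (second_tm x) (TVar i)) else TConst 1))"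

definition sweep_step_tm :: "bool \<Rightarrow> tm \<Rightarrow> tm \<Rightarrow> tm" where
  "sweep_step_tm b x y = TAnd
     (TAll 10 n_tm (TEq (in_tm (third_tm y) (TVar 10))
        (TEx 11 n_tm (TAnd (spared_tm b x y 11) (at_tm ''adj'' (TVar 10) n_tm (TVar 11))))))
     (TLe (TSum 10 n_tm (TAnd (in_tm (third_tm x) (TVar 10)) (TNot (spared_tm b x y 10))))
        (TRead ''kk'' (TConst 0)))"

text \<open>Dynamic programming by length: row i marks the triples reachable in exactly i steps,
  computed from row i - 1 of the same table.\<close>

definition reach_tm :: "bool \<Rightarrow> tm" where
  "reach_tm b = (let i = TDiv y_tm B_tm; y = TMod y_tm B_tm; x = TVar 2 in
     TOr (TAnd (TNot i) (start_tm y))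
         (TAnd i (TEx 2 B_tm (TAnd (at_tm ''R'' (TSub i (TConst 1)) B_tm x)
            (TAnd (TEq (TDiv y N_tm) (TMod x (TMul N_tm N_tm))) (sweep_step_tm b x y))))))"

text \<open>A single vertex is accepted at once, as its game numbers are 0 by convention and the
  theory of sweeps excludes it.\<close>

definition answer_tm :: tm where
  "answer_tm = TOr (TLe n_tm (TConst 1)) (TEx 1 R_size_tm (TAnd (TRead ''R'' (TVar 1))
     (TAll 10 n_tm (TNot (in_tm (third_tm (TMod (TVar 1) B_tm)) (TVar 10))))))"

lemmas tm_defs = n_tm_def N_tm_def B_tm_def R_size_tm_def at_tm_def scan_tm_def cover_tm_def
  rank_tm_def cover_size_tm_def power_tm_def g_tm_def double_tm_def bit_tm_def decode_tm_def
  in_tm_def first_tm_def second_tm_def third_tm_def all_tm_def start_tm_def spared_tm_def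
  sweep_step_tm_def reach_tm_def answer_tm_def

definition scan_size_tm :: tm where
  "scan_size_tm = TMul (TAdd (TMul n_tm n_tm) (TConst 1)) n_tm"
definition rank_size_tm :: tm where
  "rank_size_tm = TAdd n_tm (TConst 1)"
definition power_size_tm :: tm where
  "power_size_tm = TMul g_tm (TAdd (double_tm cover_size_tm) (TConst 1))"
definition codes_tm :: tm where
  "codes_tm = TMul g_tm (TRead ''p'' (double_tm cover_size_tm))"
definition decode_size_tm :: tm where
  "decode_size_tm = TMul N_tm n_tm"

lemmas size_tm_defs = scan_size_tm_def rank_size_tm_def power_size_tm_def codes_tm_def decode_size_tm_def

text \<open>The flag \<open>g\<close> is the guard of the exponential part: for \<open>g = 0\<close> the number \<open>N\<close> of codes is taken to be
  \<open>0\<close>, all later tables are empty, and \<open>out\<close> is meaningless.\<close>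

definition solver :: "bool \<Rightarrow> com" where
  "solver b =
     Seq (fill ''c'' scan_size_tm scan_tm)
    (Seq (fill ''r'' rank_size_tm rank_tm)
    (Seq (fill ''p'' power_size_tm power_tm)
    (Seq (fill ''N'' (TConst 1) codes_tm)
    (Seq (fill ''z'' decode_size_tm decode_tm)
    (Seq (fill ''R'' R_size_tm (reach_tm b))
         (fill ''out'' (TConst 1) answer_tm))))))"

section \<open>Correctness of the individual tables\<close>

definition filled :: "string \<Rightarrow> tm \<Rightarrow> tm \<Rightarrow> nat \<Rightarrow> state \<Rightarrow> state \<Rightarrow> bool" where
  "filled a t u M f f' \<longleftrightarrow> (\<exists>h. fills a t u h M f f')"

lemma admissible_solver_tms:
  "admissible scan_size_tm" "admissible scan_tm" "admissible rank_size_tm" "admissible rank_tm"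
  "admissible power_size_tm" "admissible power_tm" "admissible codes_tm" "admissible decode_size_tm"
  "admissible decode_tm" "admissible R_size_tm" "admissible (reach_tm b)" "admissible answer_tm"
  by (simp_all add: tm_defs size_tm_defs Let_def)

lemma implements_filled:
  assumes "admissible t" and "admissible u" and "a \<noteq> ''reg''" "a \<noteq> ''var''" "a \<noteq> ''k''"
  shows "implements (fill a t u) (filled a t u)"
  using implements_fill[OF assms] unfolding filled_def .

lemma implements_solver:
  "implements (solver b) (\<lambda>M f f'. \<exists>f1 f2 f3 f4 f5 f6.
     filled ''c'' scan_size_tm scan_tm M f f1 \<and> filled ''r'' rank_size_tm rank_tm M f1 f2 \<and>
     filled ''p'' power_size_tm power_tm M f2 f3 \<and> filled ''N'' (TConst 1) codes_tm M f3 f4 \<and>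
     filled ''z'' decode_size_tm decode_tm M f4 f5 \<and> filled ''R'' R_size_tm (reach_tm b) M f5 f6 \<and>
     filled ''out'' (TConst 1) answer_tm M f6 f')" (is "implements _ ?R")
proof -
  have "implements (solver b) (\<lambda>M f f'. \<exists>f1. filled ''c'' scan_size_tm scan_tm M f f1 \<and>
     (\<exists>f2. filled ''r'' rank_size_tm rank_tm M f1 f2 \<and>
     (\<exists>f3. filled ''p'' power_size_tm power_tm M f2 f3 \<and>
     (\<exists>f4. filled ''N'' (TConst 1) codes_tm M f3 f4 \<and>
     (\<exists>f5. filled ''z'' decode_size_tm decode_tm M f4 f5 \<and>
     (\<exists>f6. filled ''R'' R_size_tm (reach_tm b) M f5 f6 \<and>
     filled ''out'' (TConst 1) answer_tm M f6 f'))))))"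
    unfolding solver_def
    by (intro implements_Seq implements_filled admissible_solver_tms) simp_all
  moreover have "(\<lambda>M f f'. \<exists>f1. filled ''c'' scan_size_tm scan_tm M f f1 \<and>
     (\<exists>f2. filled ''r'' rank_size_tm rank_tm M f1 f2 \<and>
     (\<exists>f3. filled ''p'' power_size_tm power_tm M f2 f3 \<and>
     (\<exists>f4. filled ''N'' (TConst 1) codes_tm M f3 f4 \<and>
     (\<exists>f5. filled ''z'' decode_size_tm decode_tm M f4 f5 \<and>
     (\<exists>f6. filled ''R'' R_size_tm (reach_tm b) M f5 f6 \<and>
     filled ''out'' (TConst 1) answer_tm M f6 f')))))) = ?R"
    by (simp only: ex_simps)
  ultimately show ?thesis by (simp only:)
qed

text \<open>The computation of entry i may rely on the finished entries below i and on the old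
  content from i upwards. The latter matters where a recursion starts by reading its own
  entry.\<close>

definition computes :: "string \<Rightarrow> tm \<Rightarrow> (nat \<Rightarrow> nat) \<Rightarrow> nat \<Rightarrow> state \<Rightarrow> bool" where
  "computes a u h l f \<longleftrightarrow> a \<noteq> ''var'' \<and> (\<forall>i<l. \<forall>s. (\<forall>a'. a' \<noteq> a \<longrightarrow> s a' = f a') \<longrightarrow>
     (\<forall>j<i. s a j = h j) \<longrightarrow> (\<forall>j\<ge>i. s a j = f a j) \<longrightarrow> tval s u (zeros(0 := i)) = h i)"

lemma computesI:
  assumes "a \<noteq> ''var''"
    and "\<And>i s. i < l \<Longrightarrow> (\<And>a'. a' \<noteq> a \<Longrightarrow> s a' = f a') \<Longrightarrow> (\<And>j. j < i \<Longrightarrow> s a j = h j) \<Longrightarrow>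
      (\<And>j. i \<le> j \<Longrightarrow> s a j = f a j) \<Longrightarrow> tval s u (zeros(0 := i)) = h i"
  shows "computes a u h l f"
  unfolding computes_def using assms by simp

lemma filledI:
  assumes f: "f ''var'' = zeros" "tables_le M f" and l: "tval f t zeros = l"
    and h: "computes a u h l f" "\<forall>i<l. h i \<le> M"
  obtains f' where "filled a t u M f f'" "\<And>i. i < l \<Longrightarrow> f' a i = h i" "\<And>a'. a' \<noteq> a \<Longrightarrow> f' a' = f a'"
    "tables_le M f'" "f' ''var'' = zeros"
proof -
  let ?f' = "f(a := prefix h l (f a))"
  have "fills a t u h M f ?f'"
    unfolding fills_def l
  proof (intro conjI allI impI)
    fix i assume "i < l"
    then show "tval (f(a := prefix h i (f a))) u (zeros(0 := i)) = h i"
      using h(1) unfolding computes_def by (simp add: prefix_def)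
  qed (use f h in simp_all)
  moreover have "tables_le M ?f'"
    using f(2) h(2) by (simp add: tables_le_def prefix_def)
  moreover have "a \<noteq> ''var''" using h(1) unfolding computes_def by blast
  then have "?f' ''var'' = zeros" using f(1) by (metis fun_upd_other)
  ultimately show ?thesis
    using that[of ?f'] by (auto simp: filled_def prefix_def)
qed

text \<open>The number of codes is bounded by M only under the guard \<gamma>. One correctness proof
  thus serves the decision procedure and both outcomes of the guard in the kernel.\<close>

locale solver_input =
  fixes n :: nat and E :: "nat \<Rightarrow> nat \<Rightarrow> bool" and b :: bool and \<gamma> :: bool and kk M :: nat
  assumes n_pos: "n > 0" and E_less: "E u v \<Longrightarrow> u < n \<and> v < n"
    and M_n: "n + 2 \<le> M" and M_codes: "\<gamma> \<Longrightarrow> 2 ^ (2 * card (greedy_cover n E)) \<le> M"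
begin

definition C :: "nat set" where "C = greedy_cover n E"
definition N :: nat where "N = of_bool \<gamma> * 2 ^ (2 * card C)"
definition B :: nat where "B = N * N * N"
definition D :: "nat \<Rightarrow> nat set" where "D = decode n E C"

text \<open>This and the following predicates are the interfaces between tables. Each mentions only
  a few arrays, so it persists while other arrays are being filled.\<close>

definition reads_input :: "state \<Rightarrow> bool" where
  "reads_input s \<longleftrightarrow> s ''n'' 0 = n \<and> (\<forall>z<n * n. s ''adj'' z = of_bool (E (z div n) (z mod n))) \<and>
     s ''kk'' 0 = kk \<and> s ''g'' 0 = of_bool \<gamma>"

definition reads_cover :: "state \<Rightarrow> bool" where
  "reads_cover s \<longleftrightarrow> (\<forall>v<n. s ''c'' (n * n * n + v) = of_bool (v \<in> C))"

definition reads_rank :: "state \<Rightarrow> bool" where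
  "reads_rank s \<longleftrightarrow> (\<forall>v\<le>n. s ''r'' v = rank C v)"

definition reads_power :: "state \<Rightarrow> bool" where
  "reads_power s \<longleftrightarrow> (\<gamma> \<longrightarrow> (\<forall>i\<le>2 * card C. s ''p'' i = 2 ^ i))"

definition reads_codes :: "state \<Rightarrow> bool" where
  "reads_codes s \<longleftrightarrow> s ''N'' 0 = N"

definition reads_decode :: "state \<Rightarrow> bool" where
  "reads_decode s \<longleftrightarrow> (\<forall>x<N. \<forall>v<n. s ''z'' (x * n + v) = of_bool (v \<in> D x))"

lemma C_subset: "C \<subseteq> {..<n}"
  unfolding C_def using E_less by (rule greedy_cover_subset)

lemma card_C: "card C \<le> n"
  using card_mono[OF _ C_subset] by simp

lemma M_ge: "1 \<le> M" "n \<le> M" "2 \<le> M"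
  using M_n by simp_all

lemma tval_n: "reads_input s \<Longrightarrow> tval s n_tm \<rho> = n"
  by (simp add: reads_input_def n_tm_def)

lemma tval_N: "reads_codes s \<Longrightarrow> tval s N_tm \<rho> = N"
  by (simp add: reads_codes_def N_tm_def)

lemma tval_B: "reads_codes s \<Longrightarrow> tval s B_tm \<rho> = B"
  by (simp add: tval_N B_tm_def B_def)

lemma tval_at: "tval s (at_tm a u w v) \<rho> = s a (tval s u \<rho> * tval s w \<rho> + tval s v \<rho>)"
  by (simp add: at_tm_def)

lemma tval_adj:
  assumes "reads_input s" "tval s u \<rho> < n" "tval s v \<rho> < n"
  shows "tval s (at_tm ''adj'' u n_tm v) \<rho> = of_bool (E (tval s u \<rho>) (tval s v \<rho>))"
  using assms index_less[OF assms(2,3)] by (simp add: tval_at tval_n reads_input_def)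

lemma scan_table:
  assumes f: "reads_input f" "f ''var'' = zeros" "tables_le M f"
  obtains f' where "filled ''c'' scan_size_tm scan_tm M f f'" "reads_cover f'"
    "\<And>a. a \<noteq> ''c'' \<Longrightarrow> f' a = f a" "tables_le M f'" "f' ''var'' = zeros"
proof -
  define h where "h = (\<lambda>y. of_bool (y mod n \<in> scanned n E (y div n)) :: nat)"
  have entry: "tval s scan_tm (zeros(0 := y)) = h y"
    if y: "y < (n * n + 1) * n" and s: "\<And>a. a \<noteq> ''c'' \<Longrightarrow> s a = f a" "\<And>j. j < y \<Longrightarrow> s ''c'' j = h j" for y s
  proof (cases "y < n")
    case True
    have "reads_input s" using f(1) s(1) by (simp add: reads_input_def)
    from tval_n[OF this] True show ?thesis by (simp add: scan_tm_def Let_def h_def)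
  next
    case False
    have in_s: "reads_input s" using f(1) s(1) by (simp add: reads_input_def)
    define z where "z = y div n - 1"
    have "1 \<le> y div n" using False n_pos by (simp add: div_greater_zero_iff Suc_leI)
    then have yz: "y div n = Suc z" by (simp add: z_def)
    have "y div n < n * n + 1" using y n_pos by (simp add: less_mult_imp_div_less)
    then have z: "z < n * n" using yz by simp
    have prev: "s ''c'' (z * n + q) = of_bool (q \<in> scanned n E z)" if "q < n" for q
    proof -
      have "z * n + q < Suc z * n" using index_less[of z "Suc z" q n] that by simp
      also have "\<dots> \<le> y" unfolding yz[symmetric] by simp
      finally show ?thesis using s(2) that by (simp add: h_def)
    qed
    have adj: "s ''adj'' z = of_bool (E (z div n) (z mod n))"
      using in_s z unfolding reads_input_def by blast
    have "z div n < n" "z mod n < n" "y mod n < n"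
      using z n_pos by (simp_all add: less_mult_imp_div_less)
    then show ?thesis
      using False n_pos prev[of "z div n"] prev[of "z mod n"] prev[of "y mod n"]
      by (simp add: scan_tm_def Let_def tval_n[OF in_s] tval_at yz adj h_def) blast
  qed
  have size: "tval f scan_size_tm zeros = (n * n + 1) * n"
    by (simp add: scan_size_tm_def tval_n[OF f(1)])
  have le: "h i \<le> M" for i using M_ge by (simp add: h_def)
  obtain f' where f': "filled ''c'' scan_size_tm scan_tm M f f'"
    "\<And>i. i < (n * n + 1) * n \<Longrightarrow> f' ''c'' i = h i" "\<And>a. a \<noteq> ''c'' \<Longrightarrow> f' a = f a"
    "tables_le M f'" "f' ''var'' = zeros"
  proof (rule filledI[OF f(2,3) size])
    show "computes ''c'' scan_tm h ((n * n + 1) * n) f" by (rule computesI) (simp, blast intro: entry)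
    show "\<forall>i<(n * n + 1) * n. h i \<le> M" using le by blast
  qed blast
  have "reads_cover f'"
    unfolding reads_cover_def C_def greedy_cover_def
  proof (intro allI impI)
    fix v assume v: "v < n"
    have "n * n * n + v < (n * n + 1) * n" using index_less[of "n * n" "n * n + 1" v n] v by simp
    then have "f' ''c'' (n * n * n + v) = h (n * n * n + v)" by (rule f'(2))
    also have "(n * n * n + v) div n = n * n" "(n * n * n + v) mod n = v" using v by simp_all
    then have "h (n * n * n + v) = of_bool (v \<in> scanned n E (n * n))" by (simp only: h_def)
    finally show "f' ''c'' (n * n * n + v) = of_bool (v \<in> scanned n E (n * n))" .
  qed
  with f' show ?thesis using that by blast
qed

lemma tval_cover:
  assumes "reads_input s" "reads_cover s" "tval s v \<rho> < n"
  shows "tval s (cover_tm v) \<rho> = of_bool (tval s v \<rho> \<in> C)"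
  using assms by (simp add: cover_tm_def tval_at tval_n reads_cover_def)

lemma rank_table:
  assumes f: "reads_input f" "reads_cover f" "f ''var'' = zeros" "tables_le M f"
  obtains f' where "filled ''r'' rank_size_tm rank_tm M f f'" "reads_rank f'"
    "\<And>a. a \<noteq> ''r'' \<Longrightarrow> f' a = f a" "tables_le M f'" "f' ''var'' = zeros"
proof -
  have entry: "tval s rank_tm (zeros(0 := y)) = rank C y"
    if y: "y < n + 1" and s: "\<And>a. a \<noteq> ''r'' \<Longrightarrow> s a = f a" for y s
  proof -
    have in_s: "reads_input s" "reads_cover s"
      using f(1,2) s by (simp_all add: reads_input_def reads_cover_def)
    have "tval s rank_tm (zeros(0 := y)) = (\<Sum>j<y. of_bool (j \<in> C))"
      unfolding rank_tm_def using y by (simp add: tval_cover[OF in_s])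
    also have "\<dots> = rank C y" by (induction y) (simp_all add: rank_Suc, simp add: rank_def)
    finally show ?thesis .
  qed
  have size: "tval f rank_size_tm zeros = n + 1"
    by (simp add: rank_size_tm_def tval_n[OF f(1)])
  have le: "rank C i \<le> M" if "i < n + 1" for i
    using rank_mono[of i n C] that rank_full[OF C_subset] card_C M_ge by simp
  obtain f' where f': "filled ''r'' rank_size_tm rank_tm M f f'"
    "\<And>i. i < n + 1 \<Longrightarrow> f' ''r'' i = rank C i" "\<And>a. a \<noteq> ''r'' \<Longrightarrow> f' a = f a"
    "tables_le M f'" "f' ''var'' = zeros"
  proof (rule filledI[OF f(3,4) size])
    show "computes ''r'' rank_tm (rank C) (n + 1) f" by (rule computesI) (simp, blast intro: entry)
    show "\<forall>i<n + 1. rank C i \<le> M" using le by blast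
  qed blast
  then have "reads_rank f'" by (simp add: reads_rank_def)
  with f' show ?thesis using that by blast
qed

lemma tval_cover_size: "reads_input s \<Longrightarrow> reads_rank s \<Longrightarrow> tval s cover_size_tm \<rho> = card C"
  by (simp add: cover_size_tm_def tval_n reads_rank_def rank_full[OF C_subset])

lemma power_table:
  assumes f: "reads_input f" "reads_rank f" "f ''var'' = zeros" "tables_le M f" "f ''p'' = zeros"
  obtains f' where "filled ''p'' power_size_tm power_tm M f f'" "reads_power f'"
    "\<And>a. a \<noteq> ''p'' \<Longrightarrow> f' a = f a" "tables_le M f'" "f' ''var'' = zeros"
proof -
  let ?l = "of_bool \<gamma> * (2 * card C + 1)"
  have entry: "tval s power_tm (zeros(0 := y)) = 2 ^ y"
    if "\<And>j. j < y \<Longrightarrow> s ''p'' j = 2 ^ j" "\<And>j. y \<le> j \<Longrightarrow> s ''p'' j = f ''p'' j" for y s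
    using that(1)[of "y - 1"] that(2)[of 0] f(5)
    by (cases y) (simp_all add: power_tm_def Let_def zeros_def)
  have size: "tval f power_size_tm zeros = ?l"
    using f(1) by (simp add: power_size_tm_def tval_cover_size[OF f(1,2)] double_tm_def g_tm_def reads_input_def)
  have le: "2 ^ i \<le> M" if "i < ?l" for i
  proof -
    have "\<gamma>" "i \<le> 2 * card C" using that by (auto split: if_splits simp: of_bool_def)
    then have "2 ^ i \<le> (2 ^ (2 * card C) :: nat)" by (intro power_increasing) simp_all
    then show ?thesis using M_codes[OF \<open>\<gamma>\<close>] unfolding C_def by linarith
  qed
  obtain f' where f': "filled ''p'' power_size_tm power_tm M f f'"
    "\<And>i. i < ?l \<Longrightarrow> f' ''p'' i = 2 ^ i" "\<And>a. a \<noteq> ''p'' \<Longrightarrow> f' a = f a"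
    "tables_le M f'" "f' ''var'' = zeros"
  proof (rule filledI[OF f(3,4) size])
    show "computes ''p'' power_tm (\<lambda>i. 2 ^ i) (?l) f" by (rule computesI) (simp, blast intro: entry)
    show "\<forall>i<?l. 2 ^ i \<le> M" using le by blast
  qed blast
  then have "reads_power f'" by (simp add: reads_power_def)
  with f' show ?thesis using that by blast
qed

lemma codes_table:
  assumes f: "reads_input f" "reads_rank f" "reads_power f" "f ''var'' = zeros" "tables_le M f"
  obtains f' where "filled ''N'' (TConst 1) codes_tm M f f'" "reads_codes f'"
    "\<And>a. a \<noteq> ''N'' \<Longrightarrow> f' a = f a" "tables_le M f'" "f' ''var'' = zeros"
proof -
  have entry: "tval s codes_tm (zeros(0 := y)) = N"
    if s: "\<And>a. a \<noteq> ''N'' \<Longrightarrow> s a = f a" for y s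
  proof -
    have in_s: "reads_input s" "reads_rank s" "reads_power s"
      using f(1,2,3) s by (simp_all add: reads_input_def reads_rank_def reads_power_def)
    then show ?thesis
      by (simp add: codes_tm_def tval_cover_size double_tm_def g_tm_def N_def mult_2)
        (simp add: reads_input_def reads_power_def)
  qed
  have size: "tval f (TConst 1) zeros = 1" by simp
  have le: "N \<le> M" if "i < 1" for i :: nat
    using M_codes by (simp add: N_def C_def)
  obtain f' where f': "filled ''N'' (TConst 1) codes_tm M f f'"
    "\<And>i. i < 1 \<Longrightarrow> f' ''N'' i = N" "\<And>a. a \<noteq> ''N'' \<Longrightarrow> f' a = f a"
    "tables_le M f'" "f' ''var'' = zeros"
  proof (rule filledI[OF f(4,5) size])
    show "computes ''N'' codes_tm (\<lambda>_. N) (1) f" by (rule computesI) (simp, rule entry, assumption)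
    show "\<forall>i<1. N \<le> M" using le by simp
  qed blast
  then have "reads_codes f'" by (simp add: reads_codes_def)
  with f' show ?thesis using that by blast
qed

lemma rank_less_card: "v \<in> C \<Longrightarrow> rank C v < card C"
  using rank_less[of v C n] rank_full[OF C_subset] C_subset by auto

lemma tval_bit:
  assumes "reads_power s" \<gamma> "tval s i \<rho> \<le> 2 * card C"
  shows "tval s (bit_tm x i) \<rho> = of_bool (odd (tval s x \<rho> div 2 ^ tval s i \<rho>))"
proof -
  have "s ''p'' (tval s i \<rho>) = 2 ^ tval s i \<rho>" using assms unfolding reads_power_def by simp
  then show ?thesis by (simp add: bit_tm_def mod2_eq_if)
qed

lemma decode_table:
  assumes f: "reads_input f" "reads_cover f" "reads_rank f" "reads_power f" "reads_codes f"
    "f ''var'' = zeros" "tables_le M f"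
  obtains f' where "filled ''z'' decode_size_tm decode_tm M f f'" "reads_decode f'"
    "\<And>a. a \<noteq> ''z'' \<Longrightarrow> f' a = f a" "tables_le M f'" "f' ''var'' = zeros"
proof -
  define h where "h = (\<lambda>y. of_bool (y mod n \<in> D (y div n)) :: nat)"
  have entry: "tval s decode_tm (zeros(0 := y)) = h y"
    if y: "y < N * n" and s: "\<And>a. a \<noteq> ''z'' \<Longrightarrow> s a = f a" for y s
  proof -
    have in_s: "reads_input s" "reads_cover s" "reads_rank s" "reads_power s"
      using f(1-4) s by (simp_all add: reads_input_def reads_cover_def reads_rank_def reads_power_def)
    have \<gamma> using y unfolding N_def by (cases \<gamma>) simp_all
    let ?x = "y div n" and ?v = "y mod n"
    have v: "?v < n" using n_pos by simp
    have rank_s: "s ''r'' u = rank C u" if "u < n" for u using in_s(3) that by (simp add: reads_rank_def)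
    have low: "tval s (TAnd (cover_tm (TMod y_tm n_tm)) (bit_tm (TDiv y_tm n_tm) (TRead ''r'' (TMod y_tm n_tm))))
        (zeros(0 := y)) = of_bool (?v \<in> C \<and> odd (?x div 2 ^ rank C ?v))"
    proof (cases "?v \<in> C")
      case True
      then have "rank C ?v \<le> 2 * card C" using rank_less_card[of ?v] by simp
      then show ?thesis
        using n_pos v rank_s[OF v] by (simp add: tval_bit[OF in_s(4) \<open>\<gamma>\<close>] tval_cover[OF in_s(1,2)] tval_n[OF in_s(1)])
    next
      case False
      then show ?thesis using n_pos v by (simp add: tval_cover[OF in_s(1,2)] tval_n[OF in_s(1)])
    qed
    have high: "tval s (TAnd (TAnd (cover_tm (TVar 1)) (at_tm ''adj'' (TVar 1) n_tm (TMod y_tm n_tm)))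
          (bit_tm (TDiv y_tm n_tm) (TAdd cover_size_tm (TRead ''r'' (TVar 1))))) (zeros(0 := y, 1 := u)) =
        of_bool (u \<in> C \<and> E u ?v \<and> odd (?x div 2 ^ (card C + rank C u)))" if u: "u < n" for u
    proof (cases "u \<in> C")
      case True
      then have "card C + rank C u \<le> 2 * card C" using rank_less_card[of u] by simp
      then show ?thesis
        using n_pos u v rank_s[OF u] by (simp add: tval_bit[OF in_s(4) \<open>\<gamma>\<close>] tval_cover[OF in_s(1,2)]
          tval_n[OF in_s(1)] tval_adj[OF in_s(1)] tval_cover_size[OF in_s(1,3)])
    next
      case False
      then show ?thesis using u by (simp add: tval_cover[OF in_s(1,2)])
    qed
    have ex: "tval s (TEx 1 n_tm (TAnd (TAnd (cover_tm (TVar 1)) (at_tm ''adj'' (TVar 1) n_tm (TMod y_tm n_tm)))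
          (bit_tm (TDiv y_tm n_tm) (TAdd cover_size_tm (TRead ''r'' (TVar 1)))))) (zeros(0 := y)) =
        of_bool (\<exists>u<n. u \<in> C \<and> E u ?v \<and> odd (?x div 2 ^ (card C + rank C u)))"
      by (simp only: tval_TEx tval_n[OF in_s(1)] high of_bool_eq_0_iff not_not cong: conj_cong)
    have not_cover: "tval s (TNot (cover_tm (TMod y_tm n_tm))) (zeros(0 := y)) = of_bool (?v \<notin> C)"
      using n_pos v by (simp add: tval_cover[OF in_s(1,2)] tval_n[OF in_s(1)])
    have "tval s decode_tm (zeros(0 := y)) = of_bool ((?v \<in> C \<and> odd (?x div 2 ^ rank C ?v)) \<or>
        (?v \<notin> C \<and> (\<exists>u<n. u \<in> C \<and> E u ?v \<and> odd (?x div 2 ^ (card C + rank C u)))))"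
      unfolding decode_tm_def Let_def tval_TOr low
      unfolding tval_TAnd[of s "TNot (cover_tm (TMod y_tm n_tm))"] ex not_cover
      by (simp only: of_bool_eq_0_iff not_not)
    also have "\<dots> = h y" unfolding h_def D_def decode_def using v by auto
    finally show ?thesis .
  qed
  have size: "tval f decode_size_tm zeros = N * n"
    by (simp add: decode_size_tm_def tval_n[OF f(1)] tval_N[OF f(5)])
  have le: "h i \<le> M" for i using M_ge by (simp add: h_def)
  obtain f' where f': "filled ''z'' decode_size_tm decode_tm M f f'"
    "\<And>i. i < N * n \<Longrightarrow> f' ''z'' i = h i" "\<And>a. a \<noteq> ''z'' \<Longrightarrow> f' a = f a"
    "tables_le M f'" "f' ''var'' = zeros"
  proof (rule filledI[OF f(6,7) size])
    show "computes ''z'' decode_tm h (N * n) f" by (rule computesI) (simp, blast intro: entry)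
    show "\<forall>i<N * n. h i \<le> M" using le by blast
  qed blast
  have "reads_decode f'"
    unfolding reads_decode_def using f'(2) index_less by (simp add: h_def)
  with f' show ?thesis using that by blast
qed

end

section \<open>The game on codes\<close>

lemma fresh_macros [simp]:
  "fresh (TMul t u) = max (fresh t) (fresh u)"
  "fresh (TDiv t u) = Suc (max (fresh t) (fresh u))"
  "fresh (TMod t u) = Suc (max (fresh t) (fresh u))"
  by (simp_all add: TMul_def TDiv_def TMod_def TLe_def TNot_def Let_def)

text \<open>Extracting a component nests at most two divisions, each with its own summation
  variable. The bound 7 leaves room for them below 10, and vertices are quantified by the variables
  10, 11 and 12.\<close>

lemma fresh_thirds:
  assumes "fresh x \<le> 7"
  shows "fresh (first_tm x) \<le> 10" "fresh (second_tm x) \<le> 10" "fresh (third_tm x) \<le> 10"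
  using assms by (simp_all add: first_tm_def second_tm_def third_tm_def N_tm_def)

context solver_input
begin

definition reads_game :: "state \<Rightarrow> bool" where
  "reads_game s \<longleftrightarrow> reads_input s \<and> reads_codes s \<and> reads_decode s"

lemma D_subset: "D x \<subseteq> {..<n}"
  unfolding D_def decode_def by auto

lemma tval_in:
  assumes "reads_game s" "tval s x \<rho> < N" "tval s v \<rho> < n"
  shows "tval s (in_tm x v) \<rho> = of_bool (tval s v \<rho> \<in> D (tval s x \<rho>))"
  using assms unfolding in_tm_def tval_at reads_game_def by (simp add: tval_n reads_decode_def)

lemma N_pos: "X < B \<Longrightarrow> N > 0"
  unfolding B_def by (cases "N = 0") simp_all

lemma thirds_less:
  assumes "X < B"
  shows "X div (N * N) < N" "X div N mod N < N" "X mod N < N"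
proof -
  show "X div (N * N) < N"
    using assms unfolding B_def by (intro less_mult_imp_div_less) (simp add: mult.assoc)
qed (use N_pos[OF assms] in simp_all)

lemma tval_thirds:
  assumes "reads_game s" "tval s x \<rho> < B"
  shows "tval s (first_tm x) \<rho> = tval s x \<rho> div (N * N)"
    "tval s (second_tm x) \<rho> = tval s x \<rho> div N mod N"
    "tval s (third_tm x) \<rho> = tval s x \<rho> mod N"
  using N_pos[OF assms(2)] assms(1)
  by (simp_all add: first_tm_def second_tm_def third_tm_def tval_N reads_game_def)

lemma tval_all:
  assumes s: "reads_game s" and x: "tval s x \<rho> < N" "fresh x \<le> i"
  shows "tval s (all_tm i x) \<rho> = of_bool (D (tval s x \<rho>) = {..<n})"
proof -
  have n: "tval s n_tm \<rho> = n" using s by (simp add: tval_n reads_game_def)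
  have "tval s (in_tm x (TVar i)) (\<rho>(i := v)) = of_bool (v \<in> D (tval s x \<rho>))" if "v < n" for v
    using tval_in[OF s, of x "\<rho>(i := v)" "TVar i"] that x by (simp add: tval_fresh)
  then have "tval s (all_tm i x) \<rho> = of_bool (\<forall>v<n. v \<in> D (tval s x \<rho>))"
    unfolding all_tm_def tval_TAll n by (simp cong: imp_cong)
  also have "(\<forall>v<n. v \<in> D (tval s x \<rho>)) \<longleftrightarrow> D (tval s x \<rho>) = {..<n}" using D_subset by blast
  finally show ?thesis .
qed

lemma tval_start:
  assumes s: "reads_game s" and x: "tval s x \<rho> < B" "fresh x \<le> 7"
  shows "tval s (start_tm x) \<rho> = of_bool (triple_start {..<n} N D (tval s x \<rho>))"
proof -
  note eqs = tval_thirds[OF s x(1)]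
  note less = thirds_less[OF x(1)]
  show ?thesis
    unfolding start_tm_def triple_start_def tval_TAnd
    using tval_all[OF s, of "first_tm x" \<rho> 10] tval_all[OF s, of "second_tm x" \<rho> 10]
      tval_all[OF s, of "third_tm x" \<rho> 10] fresh_thirds[OF x(2)] less by (simp add: eqs)
qed

abbreviation spared_code :: "nat \<Rightarrow> nat \<Rightarrow> nat set" where
  "spared_code X Y \<equiv> spared E b (D (X div (N * N))) (D (X div N mod N)) (D (X mod N)) (D (Y mod N))"

lemma tval_spared:
  assumes s: "reads_game s" and x: "tval s x \<rho> < B" "fresh x \<le> 7" and y: "tval s y \<rho> < B" "fresh y \<le> 7"
    and i: "i < 12" "\<rho> i < n"
  shows "tval s (spared_tm b x y i) \<rho> = of_bool (\<rho> i \<in> spared_code (tval s x \<rho>) (tval s y \<rho>))"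
proof -
  have in_s: "reads_input s" using s by (simp add: reads_game_def)
  let ?X = "tval s x \<rho>" and ?Y = "tval s y \<rho>" and ?\<sigma> = "\<lambda>u. \<rho>(12 := u)"
  have keep: "tval s x (?\<sigma> u) = ?X" "tval s y (?\<sigma> u) = ?Y" for u
    using x(2) y(2) by (simp_all add: tval_fresh)
  have in1: "tval s (in_tm (first_tm x) v) \<rho> = of_bool (tval s v \<rho> \<in> D (?X div (N * N)))"
    and in2: "tval s (in_tm (second_tm x) v) \<rho> = of_bool (tval s v \<rho> \<in> D (?X div N mod N))"
    and in3: "tval s (in_tm (third_tm x) v) \<rho> = of_bool (tval s v \<rho> \<in> D (?X mod N))"
    if "tval s v \<rho> < n" for v
    using tval_in[OF s _ that] tval_thirds[OF s x(1)] thirds_less[OF x(1)] by simp_all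
  have x': "tval s x (?\<sigma> u) < B" and y': "tval s y (?\<sigma> u) < B" for u using x(1) y(1) keep by simp_all
  have in1': "tval s (in_tm (first_tm x) (TVar 12)) (?\<sigma> u) = of_bool (u \<in> D (?X div (N * N)))"
    and in2': "tval s (in_tm (second_tm x) (TVar 12)) (?\<sigma> u) = of_bool (u \<in> D (?X div N mod N))"
    and in3': "tval s (in_tm (third_tm y) (TVar 12)) (?\<sigma> u) = of_bool (u \<in> D (?Y mod N))"
    and adj: "tval s (at_tm ''adj'' (TVar i) n_tm (TVar 12)) (?\<sigma> u) = of_bool (E (\<rho> i) u)"
    if "u < n" for u
  proof -
    show "tval s (in_tm (first_tm x) (TVar 12)) (?\<sigma> u) = of_bool (u \<in> D (?X div (N * N)))"
      using tval_in[OF s, of "first_tm x" "?\<sigma> u" "TVar 12"] tval_thirds(1)[OF s x'[of u]]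
        thirds_less[OF x(1)] that unfolding keep by simp
    show "tval s (in_tm (second_tm x) (TVar 12)) (?\<sigma> u) = of_bool (u \<in> D (?X div N mod N))"
      using tval_in[OF s, of "second_tm x" "?\<sigma> u" "TVar 12"] tval_thirds(2)[OF s x'[of u]]
        thirds_less[OF x(1)] that unfolding keep by simp
    show "tval s (in_tm (third_tm y) (TVar 12)) (?\<sigma> u) = of_bool (u \<in> D (?Y mod N))"
      using tval_in[OF s, of "third_tm y" "?\<sigma> u" "TVar 12"] tval_thirds(3)[OF s y'[of u]]
        thirds_less[OF y(1)] that unfolding keep by simp
    show "tval s (at_tm ''adj'' (TVar i) n_tm (TVar 12)) (?\<sigma> u) = of_bool (E (\<rho> i) u)"
      using tval_adj[OF in_s, of "TVar i" "?\<sigma> u" "TVar 12"] i that by simp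
  qed
  let ?inner = "TOr (TNot (at_tm ''adj'' (TVar i) n_tm (TVar 12)))
        (TAnd (in_tm (third_tm y) (TVar 12)) (if b then
           TAnd (in_tm (first_tm x) (TVar 12)) (in_tm (second_tm x) (TVar 12)) else TConst 1))"
  have inner: "tval s ?inner (?\<sigma> u) = of_bool (\<not> E (\<rho> i) u \<or> (u \<in> D (?Y mod N) \<and>
      (b \<longrightarrow> u \<in> D (?X div (N * N)) \<and> u \<in> D (?X div N mod N))))" if "u < n" for u
    by (cases b) (simp_all add: in1'[OF that] in2'[OF that] in3'[OF that] adj[OF that])
  have all: "tval s (TAll 12 n_tm ?inner) \<rho> = of_bool (\<forall>u<n. \<not> E (\<rho> i) u \<or> (u \<in> D (?Y mod N) \<and>
      (b \<longrightarrow> u \<in> D (?X div (N * N)) \<and> u \<in> D (?X div N mod N))))"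
    by (simp only: tval_TAll tval_n[OF in_s] inner of_bool_eq_0_iff not_not cong: imp_cong)
  have own: "tval s (if b then TAnd (in_tm (first_tm x) (TVar i)) (in_tm (second_tm x) (TVar i)) else TConst 1) \<rho>
      = of_bool (b \<longrightarrow> \<rho> i \<in> D (?X div (N * N)) \<and> \<rho> i \<in> D (?X div N mod N))"
    using i in1[of "TVar i"] in2[of "TVar i"] by simp
  have third: "tval s (in_tm (third_tm x) (TVar i)) \<rho> = of_bool (\<rho> i \<in> D (?X mod N))"
    using i in3[of "TVar i"] by simp
  have "tval s (spared_tm b x y i) \<rho> = of_bool (\<rho> i \<in> D (?X mod N) \<and>
      (\<forall>u<n. \<not> E (\<rho> i) u \<or> (u \<in> D (?Y mod N) \<and> (b \<longrightarrow> u \<in> D (?X div (N * N)) \<and> u \<in> D (?X div N mod N)))) \<and>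
      (b \<longrightarrow> \<rho> i \<in> D (?X div (N * N)) \<and> \<rho> i \<in> D (?X div N mod N)))"
    unfolding spared_tm_def tval_TAnd[of s "in_tm (third_tm x) (TVar i)"] tval_TAnd[of s "TAll 12 _ _"]
      all own third by simp
  also have "\<dots> = of_bool (\<rho> i \<in> spared_code ?X ?Y)"
    using E_less unfolding spared_def nbrs_def by (intro arg_cong[where f = of_bool]) blast
  finally show ?thesis .
qed

lemma tval_sweep_step:
  assumes s: "reads_game s" and x: "tval s x \<rho> < B" "fresh x \<le> 7" and y: "tval s y \<rho> < B" "fresh y \<le> 7"
  shows "tval s (sweep_step_tm b x y) \<rho> = of_bool (sweep_step E b kk
    (D (tval s x \<rho> div (N * N))) (D (tval s x \<rho> div N mod N)) (D (tval s x \<rho> mod N)) (D (tval s y \<rho> mod N)))"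
proof -
  have in_s: "reads_input s" using s by (simp add: reads_game_def)
  let ?X = "tval s x \<rho>" and ?Y = "tval s y \<rho>"
  let ?W = "spared_code ?X ?Y"
  have keep: "tval s x (\<rho>(10 := v)) = ?X" "tval s y (\<rho>(10 := v)) = ?Y"
    "tval s x (\<rho>(10 := v, 11 := u)) = ?X" "tval s y (\<rho>(10 := v, 11 := u)) = ?Y" for u v
    using x(2) y(2) by (simp_all add: tval_fresh)
  have inner: "tval s (TAnd (spared_tm b x y 11) (at_tm ''adj'' (TVar 10) n_tm (TVar 11))) (\<rho>(10 := v, 11 := u))
      = of_bool (u \<in> ?W \<and> E v u)" if "u < n" "v < n" for u v
    using tval_spared[OF s, of x "\<rho>(10 := v, 11 := u)" y 11] x y that
      tval_adj[OF in_s, of "TVar 10" "\<rho>(10 := v, 11 := u)" "TVar 11"] by (simp add: keep)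
  have ex: "tval s (TEx 11 n_tm (TAnd (spared_tm b x y 11) (at_tm ''adj'' (TVar 10) n_tm (TVar 11)))) (\<rho>(10 := v))
      = of_bool (v \<in> nb E ?W)" if "v < n" for v
  proof -
    have "tval s (TEx 11 n_tm (TAnd (spared_tm b x y 11) (at_tm ''adj'' (TVar 10) n_tm (TVar 11)))) (\<rho>(10 := v))
        = of_bool (\<exists>u<n. u \<in> ?W \<and> E v u)"
      using inner[OF _ that]
      by (simp only: tval_TEx tval_n[OF in_s] of_bool_eq_0_iff not_not cong: conj_cong)
    also have "(\<exists>u<n. u \<in> ?W \<and> E v u) \<longleftrightarrow> v \<in> nb E ?W" unfolding nb_def using E_less by blast
    finally show ?thesis .
  qed
  have third: "tval s (in_tm (third_tm y) (TVar 10)) (\<rho>(10 := v)) = of_bool (v \<in> D (?Y mod N))"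
    "tval s (in_tm (third_tm x) (TVar 10)) (\<rho>(10 := v)) = of_bool (v \<in> D (?X mod N))" if "v < n" for v
    using tval_in[OF s, of "third_tm y" "\<rho>(10 := v)" "TVar 10"] tval_thirds(3)[OF s, of y "\<rho>(10 := v)"]
      tval_in[OF s, of "third_tm x" "\<rho>(10 := v)" "TVar 10"] tval_thirds(3)[OF s, of x "\<rho>(10 := v)"]
      thirds_less(3)[OF x(1)] thirds_less(3)[OF y(1)] x y that by (simp_all add: keep)
  have sp: "tval s (spared_tm b x y 10) (\<rho>(10 := v)) = of_bool (v \<in> ?W)" if "v < n" for v
    using tval_spared[OF s, of x "\<rho>(10 := v)" y 10] x y that by (simp add: keep)
  have fix1: "tval s (TAll 10 n_tm (TEq (in_tm (third_tm y) (TVar 10))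
        (TEx 11 n_tm (TAnd (spared_tm b x y 11) (at_tm ''adj'' (TVar 10) n_tm (TVar 11)))))) \<rho> =
      of_bool (\<forall>v<n. v \<in> D (?Y mod N) \<longleftrightarrow> v \<in> nb E ?W)"
    by (simp only: tval_TAll tval_n[OF in_s] tval_TEq third ex of_bool_eq_0_iff of_bool_eq_iff not_not
        cong: imp_cong)
  have nb_less: "nb E ?W \<subseteq> {..<n}" unfolding nb_def using E_less by blast
  have iff: "(\<forall>v<n. v \<in> D (?Y mod N) \<longleftrightarrow> v \<in> nb E ?W) \<longleftrightarrow> D (?Y mod N) = nb E ?W"
    using nb_less D_subset[of "?Y mod N"] by blast
  have "(\<Sum>v<n. tval s (TAnd (in_tm (third_tm x) (TVar 10)) (TNot (spared_tm b x y 10))) (\<rho>(10 := v)))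
      = (\<Sum>v<n. of_bool (v \<in> D (?X mod N) - ?W))"
    by (rule sum.cong) (simp_all add: third sp)
  also have "\<dots> = card ({..<n} \<inter> {v. v \<in> D (?X mod N) - ?W})" by (subst sum_of_bool_eq) simp_all
  also have "{..<n} \<inter> {v. v \<in> D (?X mod N) - ?W} = D (?X mod N) - ?W" using D_subset[of "?X mod N"] by blast
  finally have sum: "tval s (TSum 10 n_tm (TAnd (in_tm (third_tm x) (TVar 10)) (TNot (spared_tm b x y 10)))) \<rho>
      = card (D (?X mod N) - ?W)"
    by (simp only: tval.simps tval_n[OF in_s])
  have kk: "tval s (TRead ''kk'' (TConst 0)) \<rho> = kk" using in_s by (simp add: reads_input_def)
  show ?thesis
    unfolding sweep_step_tm_def tval_TAnd[of s "TAll _ _ _"] fix1 tval_TLe sum kk sweep_step_def iff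
    by (simp only: of_bool_eq_0_iff not_not)
qed

definition reads_reach :: "state \<Rightarrow> bool" where
  "reads_reach s \<longleftrightarrow> (\<forall>y<(B * B + 1) * B.
     s ''R'' y = of_bool (triple_reach {..<n} E b kk N D (y div B) (y mod B)))"

lemma reach_table:
  assumes f: "reads_game f" "f ''var'' = zeros" "tables_le M f"
  obtains f' where "filled ''R'' R_size_tm (reach_tm b) M f f'" "reads_reach f'"
    "\<And>a. a \<noteq> ''R'' \<Longrightarrow> f' a = f a" "tables_le M f'" "f' ''var'' = zeros"
proof -
  let ?reach = "triple_reach {..<n} E b kk N D"
  define h where "h = (\<lambda>y. of_bool (?reach (y div B) (y mod B)) :: nat)"
  have entry: "tval s (reach_tm b) (zeros(0 := y)) = h y"
    if y: "y < (B * B + 1) * B" and s: "\<And>a. a \<noteq> ''R'' \<Longrightarrow> s a = f a" "\<And>j. j < y \<Longrightarrow> s ''R'' j = h j" for y s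
  proof -
    have B: "B > 0" using y by (cases "B = 0") simp_all
    have game: "reads_game s"
      using f(1) s(1) by (simp add: reads_game_def reads_input_def reads_codes_def reads_decode_def)
    then have codes: "reads_codes s" by (simp add: reads_game_def)
    let ?i = "y div B" and ?Y = "y mod B" and ?\<rho> = "zeros(0 := y)"
    let ?yt = "TMod y_tm B_tm" and ?it = "TDiv y_tm B_tm"
    have it: "tval s ?it ?\<rho> = ?i" and yt: "tval s ?yt ?\<rho> = ?Y" "\<And>x. tval s ?yt (?\<rho>(2 := x)) = ?Y"
      using B by (simp_all add: tval_B[OF codes])
    have fresh_y: "fresh ?yt \<le> 7" by (simp add: B_tm_def N_tm_def)
    have Y: "?Y < B" using B by simp
    have N: "N > 0" using N_pos[OF Y] .
    have Y_N: "?Y < N * N * N" using Y by (simp add: B_def)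
    have start: "tval s (start_tm ?yt) ?\<rho> = of_bool (triple_start {..<n} N D ?Y)"
      using tval_start[OF game, of ?yt ?\<rho>] fresh_y Y yt by simp
    let ?inner = "TAnd (at_tm ''R'' (TSub ?it (TConst 1)) B_tm (TVar 2))
            (TAnd (TEq (TDiv ?yt N_tm) (TMod (TVar 2) (TMul N_tm N_tm))) (sweep_step_tm b (TVar 2) ?yt))"
    have inner: "tval s ?inner (?\<rho>(2 := x)) = of_bool (?reach (?i - 1) x \<and> triple_step E b kk N D x ?Y)"
      if i: "?i \<noteq> 0" and x: "x < B" for x
    proof -
      \<comment> \<open>The previous row lies entirely before the current entry, so it is already
        filled.\<close>
      have "(?i - 1) * B + x < ?i * B" using index_less[of "?i - 1" ?i x B] i x by simp
      also have "\<dots> \<le> y" by simp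
      finally have "s ''R'' ((?i - 1) * B + x) = h ((?i - 1) * B + x)" by (rule s(2))
      also have "\<dots> = of_bool (?reach (?i - 1) x)" using x B by (simp add: h_def)
      finally have R: "tval s (at_tm ''R'' (TSub ?it (TConst 1)) B_tm (TVar 2)) (?\<rho>(2 := x)) = of_bool (?reach (?i - 1) x)"
        using B by (simp add: tval_at tval_B[OF codes])
      have eq: "tval s (TEq (TDiv ?yt N_tm) (TMod (TVar 2) (TMul N_tm N_tm))) (?\<rho>(2 := x)) =
          of_bool (?Y div N = x mod (N * N))"
        using N by (simp add: tval_N[OF codes] yt)
      have step: "tval s (sweep_step_tm b (TVar 2) ?yt) (?\<rho>(2 := x)) = of_bool (sweep_step E b kk
          (D (x div (N * N))) (D (x div N mod N)) (D (x mod N)) (D (?Y mod N)))"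
        using tval_sweep_step[OF game, of "TVar 2" "?\<rho>(2 := x)" ?yt] x Y fresh_y by (simp add: yt)
      show ?thesis
        unfolding tval_TAnd[of s "at_tm _ _ _ _"] tval_TAnd[of s "TEq _ _"] R eq step triple_step_def
        by (simp only: of_bool_eq_0_iff not_not)
    qed
    have ex: "tval s (TEx 2 B_tm ?inner) ?\<rho> = of_bool (\<exists>x<B. ?reach (?i - 1) x \<and> triple_step E b kk N D x ?Y)"
      if "?i \<noteq> 0"
      using inner[OF that] by (simp only: tval_TEx tval_B[OF codes] of_bool_eq_0_iff not_not cong: conj_cong)
    have "tval s (reach_tm b) ?\<rho> = of_bool ((?i = 0 \<and> tval s (start_tm ?yt) ?\<rho> \<noteq> 0) \<or>
        (?i \<noteq> 0 \<and> tval s (TEx 2 B_tm ?inner) ?\<rho> \<noteq> 0))"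
      unfolding reach_tm_def Let_def tval_TOr[of s "TAnd (TNot _) _"] tval_TAnd[of s "TNot _"]
        tval_TAnd[of s ?it] tval_TNot it by (simp only: of_bool_eq_0_iff not_not)
    also have "\<dots> = of_bool (?reach ?i ?Y)"
    proof (cases ?i)
      case 0
      then show ?thesis using triple_reach_0[OF Y_N, of "{..<n}" E b kk D] by (simp add: start)
    next
      case (Suc l)
      then show ?thesis using triple_reach_Suc[OF Y_N, of "{..<n}" E b kk D l] ex
        unfolding B_def[symmetric] by simp
    qed
    finally show ?thesis by (simp add: h_def)
  qed
  have "reads_codes f" using f(1) by (simp add: reads_game_def)
  then have size: "tval f R_size_tm zeros = (B * B + 1) * B"
    by (simp add: R_size_tm_def tval_B)
  have le: "h i \<le> M" for i using M_ge by (simp add: h_def)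
  obtain f' where f': "filled ''R'' R_size_tm (reach_tm b) M f f'"
    "\<And>i. i < (B * B + 1) * B \<Longrightarrow> f' ''R'' i = h i" "\<And>a. a \<noteq> ''R'' \<Longrightarrow> f' a = f a"
    "tables_le M f'" "f' ''var'' = zeros"
  proof (rule filledI[OF f(2,3) size])
    show "computes ''R'' (reach_tm b) h ((B * B + 1) * B) f" by (rule computesI) (simp, blast intro: entry)
    show "\<forall>i<(B * B + 1) * B. h i \<le> M" using le by blast
  qed blast
  then have "reads_reach f'" by (simp add: reads_reach_def h_def)
  with f' show ?thesis using that by blast
qed

definition accepts :: bool where
  "accepts \<longleftrightarrow> n \<le> 1 \<or> (\<exists>i y. i \<le> B * B \<and> y < B \<and> triple_reach {..<n} E b kk N D i y \<and> D (y mod N) = {})"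

lemma answer_table:
  assumes f: "reads_game f" "reads_reach f" "f ''var'' = zeros" "tables_le M f"
  obtains f' where "filled ''out'' (TConst 1) answer_tm M f f'" "f' ''out'' 0 = of_bool accepts"
    "\<And>a. a \<noteq> ''out'' \<Longrightarrow> f' a = f a" "tables_le M f'" "f' ''var'' = zeros"
proof -
  let ?reach = "triple_reach {..<n} E b kk N D"
  have entry: "tval s answer_tm (zeros(0 := y)) = of_bool accepts"
    if s: "\<And>a. a \<noteq> ''out'' \<Longrightarrow> s a = f a" for y s
  proof -
    have game: "reads_game s"
      using f(1) s(1) by (simp add: reads_game_def reads_input_def reads_codes_def reads_decode_def)
    have reach: "reads_reach s" using f(2) s(1) by (simp add: reads_reach_def)
    have in_s: "reads_input s" "reads_codes s" using game by (simp_all add: reads_game_def)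
    let ?\<rho> = "zeros(0 := y)" and ?yt = "TMod (TVar 1) B_tm"
    have n: "tval s n_tm \<rho> = n" for \<rho> using in_s by (simp add: tval_n)
    have size: "tval s R_size_tm ?\<rho> = (B * B + 1) * B" by (simp add: R_size_tm_def tval_B[OF in_s(2)])
    have inner: "tval s (TAnd (TRead ''R'' (TVar 1)) (TAll 10 n_tm (TNot (in_tm (third_tm ?yt) (TVar 10)))))
        (?\<rho>(1 := z)) = of_bool (?reach (z div B) (z mod B) \<and> D (z mod B mod N) = {})"
      if z: "z < (B * B + 1) * B" for z
    proof -
      have B: "B > 0" using z by (cases "B = 0") simp_all
      have yt: "tval s ?yt (?\<rho>(1 := z)) = z mod B" "\<And>v. tval s ?yt (?\<rho>(1 := z, 10 := v)) = z mod B"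
        using B by (simp_all add: tval_B[OF in_s(2)])
      have zB: "z mod B < B" using B by simp
      have "tval s (in_tm (third_tm ?yt) (TVar 10)) (?\<rho>(1 := z, 10 := v)) = of_bool (v \<in> D (z mod B mod N))"
        if "v < n" for v
        using tval_in[OF game, of "third_tm ?yt" "?\<rho>(1 := z, 10 := v)" "TVar 10"] that
          tval_thirds(3)[OF game, of ?yt "?\<rho>(1 := z, 10 := v)"] thirds_less(3)[OF zB] zB
        unfolding yt by simp
      then have "tval s (TAll 10 n_tm (TNot (in_tm (third_tm ?yt) (TVar 10)))) (?\<rho>(1 := z)) =
          of_bool (\<forall>v<n. v \<notin> D (z mod B mod N))"
        by (simp only: tval_TAll tval_TNot n of_bool_eq_0_iff not_not cong: imp_cong)
      also have "(\<forall>v<n. v \<notin> D (z mod B mod N)) \<longleftrightarrow> D (z mod B mod N) = {}" using D_subset by blast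
      finally have all: "tval s (TAll 10 n_tm (TNot (in_tm (third_tm ?yt) (TVar 10)))) (?\<rho>(1 := z)) =
          of_bool (D (z mod B mod N) = {})" .
      have "s ''R'' z = of_bool (?reach (z div B) (z mod B))" using reach z unfolding reads_reach_def by blast
      then have R: "tval s (TRead ''R'' (TVar 1)) (?\<rho>(1 := z)) = of_bool (?reach (z div B) (z mod B))" by simp
      show ?thesis unfolding tval_TAnd R all by (simp only: of_bool_eq_0_iff not_not)
    qed
    have "tval s answer_tm ?\<rho> = of_bool (n \<le> 1 \<or> (\<exists>z<(B * B + 1) * B. ?reach (z div B) (z mod B) \<and> D (z mod B mod N) = {}))"
      unfolding answer_tm_def tval_TOr tval_TLe tval_TEx n size using inner
      by (simp only: of_bool_eq_0_iff not_not tval.simps cong: conj_cong)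
    also have "(\<exists>z<(B * B + 1) * B. ?reach (z div B) (z mod B) \<and> D (z mod B mod N) = {}) \<longleftrightarrow>
        (\<exists>i y. i \<le> B * B \<and> y < B \<and> ?reach i y \<and> D (y mod N) = {})" (is "?L \<longleftrightarrow> ?R")
    proof
      assume ?L
      then obtain z where z: "z < (B * B + 1) * B" "?reach (z div B) (z mod B)" "D (z mod B mod N) = {}" by blast
      have "B > 0" using z by (cases "B = 0") simp_all
      moreover have "z div B < B * B + 1" using z(1) by (rule less_mult_imp_div_less)
      ultimately have "z div B \<le> B * B" "z mod B < B" by simp_all
      then show ?R using z by blast
    next
      assume ?R
      then obtain i y where iy: "i \<le> B * B" "y < B" "?reach i y" "D (y mod N) = {}" by blast
      have "i * B + y < (B * B + 1) * B" using iy by (intro index_less) simp_all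
      moreover have "(i * B + y) div B = i" "(i * B + y) mod B = y" using iy(2) by simp_all
      ultimately show ?L using iy by metis
    qed
    finally show ?thesis unfolding accepts_def .
  qed
  have size: "tval f (TConst 1) zeros = 1" by simp
  have le: "of_bool accepts \<le> M" using M_ge by simp
  obtain f' where f': "filled ''out'' (TConst 1) answer_tm M f f'"
    "\<And>i. i < 1 \<Longrightarrow> f' ''out'' i = of_bool accepts" "\<And>a. a \<noteq> ''out'' \<Longrightarrow> f' a = f a"
    "tables_le M f'" "f' ''var'' = zeros"
  proof (rule filledI[OF f(3,4) size])
    show "computes ''out'' answer_tm (\<lambda>_. of_bool accepts) 1 f"
      by (rule computesI) (simp, rule entry, assumption)
    show "\<forall>i<1. of_bool accepts \<le> M" using le by simp
  qed blast
  then have "f' ''out'' 0 = of_bool accepts" by simp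
  with f' show ?thesis using that by blast
qed

text \<open>The last conclusion guarantees that \<open>n\<close>, \<open>k\<close>, \<open>t\<close>
  and \<open>adj\<close> survive, which allows the kernel to return the input graph after running
  the solver.\<close>

lemma solver_tables:
  assumes f: "reads_input f" "f ''var'' = zeros" "tables_le M f" "f ''p'' = zeros"
  obtains f1 f2 f3 f4 f5 f6 f' where
    "filled ''c'' scan_size_tm scan_tm M f f1" "filled ''r'' rank_size_tm rank_tm M f1 f2"
    "filled ''p'' power_size_tm power_tm M f2 f3" "filled ''N'' (TConst 1) codes_tm M f3 f4"
    "filled ''z'' decode_size_tm decode_tm M f4 f5" "filled ''R'' R_size_tm (reach_tm b) M f5 f6"
    "filled ''out'' (TConst 1) answer_tm M f6 f'" "f' ''out'' 0 = of_bool accepts"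
    "\<And>a. a \<notin> {''c'', ''r'', ''p'', ''N'', ''z'', ''R'', ''out''} \<Longrightarrow> f' a = f a"
proof -
  obtain f1 where f1: "filled ''c'' scan_size_tm scan_tm M f f1" "reads_cover f1"
    "\<And>a. a \<noteq> ''c'' \<Longrightarrow> f1 a = f a" "tables_le M f1" "f1 ''var'' = zeros"
    using f(1-3) by (rule scan_table) blast
  have i1: "reads_input f1" using f(1) f1(3) by (simp add: reads_input_def)
  obtain f2 where f2: "filled ''r'' rank_size_tm rank_tm M f1 f2" "reads_rank f2"
    "\<And>a. a \<noteq> ''r'' \<Longrightarrow> f2 a = f1 a" "tables_le M f2" "f2 ''var'' = zeros"
    using i1 f1(2,5,4) by (rule rank_table) blast
  have i2: "reads_input f2" "reads_cover f2" "f2 ''p'' = zeros"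
    using i1 f1(2,3) f2(3) f(4) by (simp_all add: reads_input_def reads_cover_def)
  obtain f3 where f3: "filled ''p'' power_size_tm power_tm M f2 f3" "reads_power f3"
    "\<And>a. a \<noteq> ''p'' \<Longrightarrow> f3 a = f2 a" "tables_le M f3" "f3 ''var'' = zeros"
    using i2(1) f2(2,5,4) i2(3) by (rule power_table) blast
  have i3: "reads_input f3" "reads_cover f3" "reads_rank f3"
    using i2 f2(2) f3(3) by (simp_all add: reads_input_def reads_cover_def reads_rank_def)
  obtain f4 where f4: "filled ''N'' (TConst 1) codes_tm M f3 f4" "reads_codes f4"
    "\<And>a. a \<noteq> ''N'' \<Longrightarrow> f4 a = f3 a" "tables_le M f4" "f4 ''var'' = zeros"
    using i3(1,3) f3(2,5,4) by (rule codes_table) blast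
  have i4: "reads_input f4" "reads_cover f4" "reads_rank f4" "reads_power f4"
    using i3 f3(2) f4(3) by (simp_all add: reads_input_def reads_cover_def reads_rank_def reads_power_def)
  obtain f5 where f5: "filled ''z'' decode_size_tm decode_tm M f4 f5" "reads_decode f5"
    "\<And>a. a \<noteq> ''z'' \<Longrightarrow> f5 a = f4 a" "tables_le M f5" "f5 ''var'' = zeros"
    using i4 f4(2,5,4) by (rule decode_table) blast
  have i5: "reads_game f5"
    using i4(1) f4(2) f5(2,3) by (simp add: reads_game_def reads_input_def reads_codes_def)
  obtain f6 where f6: "filled ''R'' R_size_tm (reach_tm b) M f5 f6" "reads_reach f6"
    "\<And>a. a \<noteq> ''R'' \<Longrightarrow> f6 a = f5 a" "tables_le M f6" "f6 ''var'' = zeros"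
    using i5 f5(5,4) by (rule reach_table) blast
  have i6: "reads_game f6"
    using i5 f6(3) by (simp add: reads_game_def reads_input_def reads_codes_def reads_decode_def)
  obtain f' where f': "filled ''out'' (TConst 1) answer_tm M f6 f'" "f' ''out'' 0 = of_bool accepts"
    "\<And>a. a \<noteq> ''out'' \<Longrightarrow> f' a = f6 a" "tables_le M f'" "f' ''var'' = zeros"
    using i6 f6(2,5,4) by (rule answer_table) blast
  have "f' a = f a" if "a \<notin> {''c'', ''r'', ''p'', ''N'', ''z'', ''R'', ''out''}" for a
    using that f'(3) f6(3) f5(3) f4(3) f3(3) f2(3) f1(3) by simp
  with f1(1) f2(1) f3(1) f4(1) f5(1) f6(1) f'(1,2) show ?thesis by (rule that)
qed

end

section \<open>The kernel and the running times\<close>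

lemma is_instance_pos: "is_instance n E k t \<Longrightarrow> n > 0"
  by (auto simp: is_instance_def simple_graph_def)

lemma is_instance_edge:
  assumes "is_instance n E k t" and "E u v"
  shows "u < n \<and> v < n"
  using assms unfolding is_instance_def simple_graph_def by blast

lemma hunted_graph_instance:
  assumes "is_instance n E k t" and "n \<noteq> 1"
  shows "hunted_graph {..<n} E"
  using assms unfolding is_instance_def by unfold_locales simp_all

lemma vertex_cover_vc_number:
  assumes "\<And>u v. E u v \<Longrightarrow> u \<in> V \<and> v \<in> V"
  obtains X where "vertex_cover V E X" "card X = vc_number V E"
proof -
  have "vertex_cover V E V" using assms unfolding vertex_cover_def by blast
  then have "\<exists>m X. vertex_cover V E X \<and> card X = m" by blast
  from LeastI_ex[OF this] obtain X where "vertex_cover V E X" "card X = vc_number V E"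
    unfolding vc_number_def by blast
  then show ?thesis by (rule that)
qed

lemma vc_number_le: "vertex_cover V E X \<Longrightarrow> vc_number V E \<le> card X"
  unfolding vc_number_def by (rule Least_le) blast

lemma vertex_cover_greedy:
  assumes "is_instance n E k t"
  shows "vertex_cover {..<n} E (greedy_cover n E)"
  unfolding vertex_cover_def
proof (intro conjI allI impI)
  show "greedy_cover n E \<subseteq> {..<n}" using is_instance_edge[OF assms] by (rule greedy_cover_subset)
  show "u \<in> greedy_cover n E \<or> v \<in> greedy_cover n E" if "E u v" for u v
    using that is_instance_edge[OF assms that] greedy_cover_covers by blast
qed

text \<open>The greedy cover has at most 2t elements, so a code has at most 4t bits. The bound is
  written as the square of 4^t because the kernel compares 4^t with n.\<close>

lemma codes_le:
  assumes "is_instance n E k t"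
  shows "2 ^ (2 * card (greedy_cover n E)) \<le> (4 ^ t * 4 ^ t :: nat)"
proof -
  obtain X where X: "vertex_cover {..<n} E X" "card X = vc_number {..<n} E"
    using is_instance_edge[OF assms] vertex_cover_vc_number[of E "{..<n}"] by (metis lessThan_iff)
  have "card X \<le> t" using X assms by (simp add: is_instance_def)
  then have "2 * card (greedy_cover n E) \<le> 2 * (2 * t)" using card_greedy_cover[OF X(1)] by linarith
  then have "2 ^ (2 * card (greedy_cover n E)) \<le> (2 ^ (2 * (2 * t)) :: nat)"
    by (intro power_increasing) simp_all
  also have "\<dots> = 4 ^ t * 4 ^ t" by (simp add: power_mult power_mult_distrib[symmetric])
  finally show ?thesis .
qed

lemma game_number_singleton: "game_number b {..<1::nat} E = 0"
  by (simp add: game_number_def hunter_number_def monotone_hunter_number_def)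

text \<open>Justifies capping k at n + 1 inside the solver and at t + 1 in the kernel: neither
  changes the answer.\<close>

lemma game_number_le_parameter:
  assumes "is_instance n E k t"
  shows "game_number b {..<n} E \<le> t" "game_number b {..<n} E \<le> n"
proof -
  have "game_number b {..<n} E \<le> vc_number {..<n} E"
  proof (cases "n = 1")
    case True
    then show ?thesis by (simp only: game_number_singleton le0)
  next
    case False
    then show ?thesis using hunted_graph.game_number_le_vc[OF hunted_graph_instance[OF assms]] by blast
  qed
  moreover have "vertex_cover {..<n} E {..<n}"
    using is_instance_edge[OF assms] unfolding vertex_cover_def by blast
  from vc_number_le[OF this] have "vc_number {..<n} E \<le> n" by simp
  moreover have "vc_number {..<n} E \<le> t" using assms by (simp add: is_instance_def)
  ultimately show "game_number b {..<n} E \<le> t" "game_number b {..<n} E \<le> n" by linarith+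
qed

lemma (in solver_input) accepts_iff:
  assumes inst: "is_instance n E k t" and kk: "kk = min k (n + 1)" and \<gamma>
  shows "accepts \<longleftrightarrow> game_number b {..<n} E \<le> k"
proof (cases "n = 1")
  case True
  then have "game_number b {..<n} E \<le> k" by (simp only: game_number_singleton le0)
  moreover have accepts unfolding accepts_def by (rule disjI1) (simp add: True)
  ultimately show ?thesis by blast
next
  case False
  have N: "N = 2 ^ (2 * card C)" using \<open>\<gamma>\<close> unfolding N_def by simp
  have "kk \<ge> 1" using inst kk n_pos by (simp add: is_instance_def)
  have "vertex_cover {..<n} E C" unfolding C_def using inst by (rule vertex_cover_greedy)
  from decode_triple_reach_iff[OF hunted_graph_instance[OF inst False] this \<open>kk \<ge> 1\<close> N, of b]
  have "accepts \<longleftrightarrow> game_number b {..<n} E \<le> kk"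
    using False n_pos unfolding accepts_def B_def D_def by simp
  also have "\<dots> \<longleftrightarrow> game_number b {..<n} E \<le> k"
    using game_number_le_parameter(2)[OF inst, of b] kk by auto
  finally show ?thesis .
qed

definition solver_tables_rel :: "bool \<Rightarrow> nat \<Rightarrow> state \<Rightarrow> state \<Rightarrow> bool" where
  "solver_tables_rel b M f f' \<longleftrightarrow> (\<exists>f1 f2 f3 f4 f5 f6.
     filled ''c'' scan_size_tm scan_tm M f f1 \<and> filled ''r'' rank_size_tm rank_tm M f1 f2 \<and>
     filled ''p'' power_size_tm power_tm M f2 f3 \<and> filled ''N'' (TConst 1) codes_tm M f3 f4 \<and>
     filled ''z'' decode_size_tm decode_tm M f4 f5 \<and> filled ''R'' R_size_tm (reach_tm b) M f5 f6 \<and>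
     filled ''out'' (TConst 1) answer_tm M f6 f')"

lemma implements_solver_tables_rel: "implements (solver b) (solver_tables_rel b)"
  using implements_solver[of b] unfolding solver_tables_rel_def .

lemma solver_correct:
  assumes inst: "is_instance n E k t"
    and M: "n + 2 \<le> M" "\<gamma> \<Longrightarrow> 4 ^ t * 4 ^ t \<le> M"
    and f: "f ''n'' 0 = n" "\<And>z. z < n * n \<Longrightarrow> f ''adj'' z = of_bool (E (z div n) (z mod n))"
      "f ''kk'' 0 = min k (n + 1)" "f ''g'' 0 = of_bool \<gamma>" "f ''var'' = zeros" "f ''p'' = zeros"
      "tables_le M f"
  obtains f' where "solver_tables_rel b M f f'" "\<gamma> \<Longrightarrow> f' ''out'' 0 \<noteq> 0 \<longleftrightarrow> game_number b {..<n} E \<le> k"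
    "\<And>a. a \<notin> {''c'', ''r'', ''p'', ''N'', ''z'', ''R'', ''out''} \<Longrightarrow> f' a = f a"
proof -
  interpret solver_input n E b \<gamma> "min k (n + 1)" M
    using is_instance_pos[OF inst] is_instance_edge[OF inst] M codes_le[OF inst]
    by unfold_locales (auto intro: le_trans)
  have "reads_input f" using f unfolding reads_input_def by simp
  then obtain f1 f2 f3 f4 f5 f6 f' where
    "filled ''c'' scan_size_tm scan_tm M f f1" "filled ''r'' rank_size_tm rank_tm M f1 f2"
    "filled ''p'' power_size_tm power_tm M f2 f3" "filled ''N'' (TConst 1) codes_tm M f3 f4"
    "filled ''z'' decode_size_tm decode_tm M f4 f5" "filled ''R'' R_size_tm (reach_tm b) M f5 f6"
    "filled ''out'' (TConst 1) answer_tm M f6 f'" and out: "f' ''out'' 0 = of_bool accepts"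
    and other: "\<And>a. a \<notin> {''c'', ''r'', ''p'', ''N'', ''z'', ''R'', ''out''} \<Longrightarrow> f' a = f a"
    using f(5,7,6) by (rule solver_tables) blast
  then have "solver_tables_rel b M f f'" unfolding solver_tables_rel_def by blast
  moreover have "f' ''out'' 0 \<noteq> 0 \<longleftrightarrow> game_number b {..<n} E \<le> k" if \<gamma>
    using out accepts_iff[OF inst _ that] by simp
  ultimately show ?thesis using other by (rule that)
qed

section \<open>The decision procedure and its running time\<close>

abbreviation scalar :: "string \<Rightarrow> exp" where
  "scalar a \<equiv> Read a (Const 0)"

abbreviation set_scalar :: "string \<Rightarrow> exp \<Rightarrow> com" where
  "set_scalar a e \<equiv> Write a (Const 0) e"

text \<open>With truncated subtraction, k - (k - m) is the minimum of k and m. Terms read this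
  capped copy because \<open>k\<close> itself may exceed every bound M on table entries.\<close>

definition cap_com :: com where
  "cap_com = set_scalar ''kk'' (Minus (scalar ''k'') (Minus (scalar ''k'') (Plus (scalar ''n'') (Const 1))))"

definition decide_com :: "bool \<Rightarrow> com" where
  "decide_com b = Seq cap_com (Seq (set_scalar ''g'' (Const 1)) (solver b))"

lemma runs_cap_com:
  "runs cap_com 12 s (\<lambda>s'. s' = s(''kk'' := (s ''kk'')(0 := min (s ''k'' 0) (s ''n'' 0 + 1))))"
  unfolding cap_com_def by (intro runs_Write) (auto simp: min_def)

lemma input_state_simps:
  "input_state n E k t ''n'' 0 = n" "input_state n E k t ''k'' 0 = k" "input_state n E k t ''t'' 0 = t"
  "z < n * n \<Longrightarrow> input_state n E k t ''adj'' z = of_bool (E (z div n) (z mod n))"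
  "input_state n E k t ''var'' = zeros" "input_state n E k t ''p'' = zeros"
  "input_state n E k t ''kk'' = zeros" "input_state n E k t ''g'' = zeros"
  "input_state n E k t ''F'' = zeros"
  by (simp_all add: input_state_def zeros_def)

lemma tables_le_input_state: "1 \<le> M \<Longrightarrow> n \<le> M \<Longrightarrow> t \<le> M \<Longrightarrow> tables_le M (input_state n E k t)"
  by (auto simp: tables_le_def input_state_def)

lemma tables_le_upd: "tables_le M f \<Longrightarrow> x \<le> M \<Longrightarrow> tables_le M (f(a := (f a)(i := x)))"
  by (simp add: tables_le_def)

text \<open>The factor 4^(2te) is split by 2te \<le> t^2 + e^2, that is, by (t - e)^2 \<ge> 0, into
  (4^t)^t and a constant. The constant also serves as the exponent of n, for which it only has to be
  at least e.\<close>

lemma fpt_time_bound: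
  fixes n t e :: nat
  assumes "n > 0"
  shows "(n + 2 + 4 ^ t * 4 ^ t) ^ e \<le>
    (4 ^ t * (t + 1) + 2 * t) ^ (t + 1) * (4 ^ e * 4 ^ (e * e) * n ^ (4 ^ e * 4 ^ (e * e)))"
proof -
  let ?c = "4 ^ e * 4 ^ (e * e) :: nat"
  have "1 \<le> (4 ^ t * 4 ^ t :: nat)" by simp
  then have "n * 1 \<le> n * (4 ^ t * 4 ^ t)" "1 * (4 ^ t * 4 ^ t) \<le> n * (4 ^ t * 4 ^ t)"
    using assms by (intro mult_le_mono; simp)+
  then have "n + 2 + 4 ^ t * 4 ^ t \<le> 4 * (n * (4 ^ t * 4 ^ t))" using assms by linarith
  then have "(n + 2 + 4 ^ t * 4 ^ t) ^ e \<le> (4 * (n * (4 ^ t * 4 ^ t))) ^ e" by (intro power_mono) simp_all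
  also have "\<dots> = 4 ^ e * n ^ e * 4 ^ (2 * t * e)"
    by (simp add: power_mult_distrib power_mult[symmetric] power_add[symmetric] mult.assoc algebra_simps)
  also have "4 ^ (2 * t * e) \<le> (4 ^ (t * t + e * e) :: nat)"
  proof (rule power_increasing)
    have "0 \<le> (int t - int e)\<^sup>2" by simp
    then have "int (2 * t * e) \<le> int (t * t + e * e)" by (simp add: power2_eq_square algebra_simps)
    then show "2 * t * e \<le> t * t + e * e" by (simp only: of_nat_le_iff)
  qed simp
  also have "(4 ^ (t * t + e * e) :: nat) = (4 ^ t) ^ t * 4 ^ (e * e)" by (simp add: power_add power_mult)
  also have "4 ^ e * n ^ e * ((4 ^ t) ^ t * 4 ^ (e * e)) = (4 ^ t) ^ t * (?c * n ^ e)" by simp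
  also have "\<dots> \<le> (4 ^ t * (t + 1) + 2 * t) ^ (t + 1) * (?c * n ^ ?c)"
  proof (intro mult_le_mono order_refl)
    have "(4 ^ t) ^ t \<le> ((4 ^ t) ^ (t + 1) :: nat)" by (intro power_increasing) simp_all
    also have "\<dots> \<le> (4 ^ t * (t + 1) + 2 * t) ^ (t + 1)" by (intro power_mono) simp_all
    finally show "(4 ^ t) ^ t \<le> (4 ^ t * (t + 1) + 2 * t) ^ (t + 1)" .
    have "e \<le> 4 ^ e * 1" using const_le_power[of 4 e] by simp
    also have "\<dots> \<le> ?c" by (intro mult_le_mono) simp_all
    finally show "n ^ e \<le> n ^ ?c" using assms by (intro power_increasing) simp_all
  qed
  finally show ?thesis by simp
qed

lemma solvable: "solvable_in_fpt_time (game_number b) (\<lambda>t. (4 ^ t * (t + 1) + 2 * t) ^ (t + 1))"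
proof -
  obtain e where e: "\<And>M f f' s. 2 \<le> M \<Longrightarrow> solver_tables_rel b M f f' \<Longrightarrow> agree f s \<Longrightarrow>
      runs (solver b) (M ^ e) s (agree f')"
    using implements_solver_tables_rel by (rule implementsE) blast
  \<comment> \<open>The code around the solver takes 17 further steps, which is below 2^5.\<close>
  let ?e = "e + 5 + 1"
  let ?c = "4 ^ ?e * 4 ^ (?e * ?e)"
  have "runs (decide_com b) ((4 ^ t * (t + 1) + 2 * t) ^ (t + 1) * (?c * n ^ ?c)) (input_state n E k t)
      (\<lambda>s. s ''out'' 0 \<noteq> 0 \<longleftrightarrow> game_number b {..<n} E \<le> k)" if inst: "is_instance n E k t" for n E k t
  proof -
    \<comment> \<open>The largest entries are the code count, at most 16^t, and numbers up to n + 1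
      such as the capped k.\<close>
    define M :: nat where "M = n + 2 + 4 ^ t * 4 ^ t"
    have M: "2 \<le> M" "n + 2 \<le> M" "4 ^ t * 4 ^ t \<le> M" by (simp_all add: M_def)
    have "t \<le> 4 ^ t * 1" using const_le_power[of 4 t] by simp
    also have "\<dots> \<le> 4 ^ t * 4 ^ t" by (intro mult_le_mono) simp_all
    finally have t: "t \<le> M" using M by linarith
    let ?s0 = "input_state n E k t"
    define s1 where "s1 = ?s0(''kk'' := (?s0 ''kk'')(0 := min k (n + 1)))"
    define s2 where "s2 = s1(''g'' := (s1 ''g'')(0 := 1))"
    have tables: "tables_le M s2"
      unfolding s2_def s1_def using M t by (intro tables_le_upd tables_le_input_state) simp_all
    obtain f' where f': "solver_tables_rel b M s2 f'" "True \<Longrightarrow> f' ''out'' 0 \<noteq> 0 \<longleftrightarrow> game_number b {..<n} E \<le> k"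
      by (rule solver_correct[OF inst M(2), of True s2 b])
        (use M tables in \<open>simp_all add: s2_def s1_def input_state_simps\<close>)
    have "agree s2 s2" by (simp add: agree_def)
    have run: "runs (decide_com b) (12 + (3 + M ^ e + 1) + 1) ?s0
        (\<lambda>s. s ''out'' 0 \<noteq> 0 \<longleftrightarrow> game_number b {..<n} E \<le> k)"
      unfolding decide_com_def
    proof (rule runs_Seq)
      show "runs cap_com 12 ?s0 (\<lambda>s. s = s1)"
        using runs_cap_com[of ?s0] by (simp add: s1_def input_state_simps)
      fix s1' assume "s1' = s1"
      then show "runs (Seq (set_scalar ''g'' (Const 1)) (solver b)) (3 + M ^ e + 1) s1'
          (\<lambda>s. s ''out'' 0 \<noteq> 0 \<longleftrightarrow> game_number b {..<n} E \<le> k)"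
      proof (intro runs_Seq)
        show "runs (set_scalar ''g'' (Const 1)) 3 s1' (\<lambda>s. s = s2)"
          using \<open>s1' = s1\<close> by (intro runs_Write) (simp_all add: s2_def)
        fix s2' assume "s2' = s2"
        then show "runs (solver b) (M ^ e) s2' (\<lambda>s. s ''out'' 0 \<noteq> 0 \<longleftrightarrow> game_number b {..<n} E \<le> k)"
          using runs_mono[OF e[OF M(1) f'(1) \<open>agree s2 s2\<close>] order_refl] f'(2) by (simp add: agree_def)
      qed
    qed
    have "12 + (3 + M ^ e + 1) + 1 \<le> M ^ ?e"
      using power_add_le[OF M(1), of e 5] power_mono[OF M(1), of 5] by simp
    also have "\<dots> \<le> (4 ^ t * (t + 1) + 2 * t) ^ (t + 1) * (?c * n ^ ?c)"
      unfolding M_def using is_instance_pos[OF inst] by (rule fpt_time_bound)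
    finally show ?thesis by (rule runs_le[OF run])
  qed
  note run = this
  show ?thesis
    unfolding solvable_in_fpt_time_def
  proof (rule exI[of _ "decide_com b"], rule exI[of _ ?c], intro allI impI)
    fix n E k t assume "is_instance n E k t"
    from run[OF this] show "\<exists>T s'. exec (decide_com b) (input_state n E k t) T s' \<and>
        T \<le> (4 ^ t * (t + 1) + 2 * t) ^ (t + 1) * (?c * n ^ ?c) \<and>
        (s' ''out'' 0 \<noteq> 0 \<longleftrightarrow> game_number b {..<n} E \<le> k)"
      unfolding runs_def .
  qed
qed

text \<open>The power \<open>4^t\<close> is computed only up to \<open>n + 1\<close>, as the table entries must stay polynomial in
  \<open>n + t\<close>.\<close>

definition cap_power_tm :: tm where
  "cap_power_tm = (let p = TRead ''F'' (TSub y_tm (TConst 1));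
       x = TAdd (TSub (TConst 1) y_tm) (TMul (TConst 4) p)
     in TSub x (TSub x (TAdd n_tm (TConst 1))))"

definition t_tm :: tm where
  "t_tm = TRead ''t'' (TConst 0)"

text \<open>The cap at n + 1, not at n, keeps the comparison of 4^t with n exact.\<close>

definition large_tm :: tm where
  "large_tm = TLe (TRead ''F'' t_tm) n_tm"

definition yes_com :: com where
  "yes_com = Seq (set_scalar ''n'' (Const 1)) (Seq (set_scalar ''k'' (Const 1))
     (Seq (set_scalar ''t'' (Const 0)) (set_scalar ''adj'' (Const 0))))"

primrec write_adjs_com :: "nat \<Rightarrow> com" where
  "write_adjs_com 0 = Skip"
| "write_adjs_com (Suc z) = Seq (write_adjs_com z)
     (Write ''adj'' (Const z) (Const (of_bool (z div 3 \<noteq> z mod 3))))"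

definition no_com :: com where
  "no_com = Seq (set_scalar ''n'' (Const 3)) (Seq (set_scalar ''k'' (Const 1))
     (Seq (set_scalar ''t'' (Const 2)) (write_adjs_com 9)))"

definition keep_com :: com where
  "keep_com = set_scalar ''k'' (Minus (scalar ''k'') (Minus (scalar ''k'') (Plus (scalar ''t'') (Const 1))))"

definition output_com :: com where
  "output_com = Cond (scalar ''g'') (Cond (scalar ''out'') yes_com no_com) keep_com"

definition kernel_com :: "bool \<Rightarrow> com" where
  "kernel_com b = Seq cap_com (Seq (Seq (fill ''F'' (TAdd t_tm (TConst 1)) cap_power_tm)
     (Seq (fill ''g'' (TConst 1) large_tm) (solver b))) output_com)"

section \<open>Constant-size instances and the kernel\<close>

definition triangle :: "nat \<Rightarrow> nat \<Rightarrow> bool" where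
  "triangle u v \<longleftrightarrow> u < 3 \<and> v < 3 \<and> u \<noteq> v"

lemma singleton_instance: "is_instance 1 (\<lambda>_ _. False) 1 0"
proof -
  have "vertex_cover {..<1::nat} (\<lambda>_ _. False) {}" by (simp add: vertex_cover_def)
  from vc_number_le[OF this] have "vc_number {..<1::nat} (\<lambda>_ _. False) = 0" by simp
  moreover have "simple_graph {..<1::nat} (\<lambda>_ _. False)"
    by (auto simp: simple_graph_def symp_def irreflp_def)
  moreover have "connected_graph {..<1::nat} (\<lambda>_ _. False)"
    by (auto simp: connected_graph_def)
  ultimately show ?thesis by (simp add: is_instance_def)
qed

lemma triangle_instance: "is_instance 3 triangle 1 2"
proof -
  have "vertex_cover {..<3} triangle {0, 1}" by (auto simp: vertex_cover_def triangle_def)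
  from vc_number_le[OF this] have "vc_number {..<3} triangle \<le> 2" by simp
  moreover have "simple_graph {..<3} triangle"
    by (auto simp: simple_graph_def symp_def irreflp_def triangle_def lessThan_empty_iff)
  moreover have "triangle\<^sup>*\<^sup>* u v" if "u < 3" "v < 3" for u v
    using that by (cases "u = v") (auto simp: triangle_def)
  then have "connected_graph {..<3} triangle" by (simp add: connected_graph_def)
  ultimately show ?thesis by (simp add: is_instance_def)
qed

text \<open>Every vertex has two neighbours and a single shot misses one of them, so all three
  vertices stay contaminated forever.\<close>

lemma triangle_game_number: "\<not> game_number b {..<3} triangle \<le> 1"
proof
  assume le: "game_number b {..<3} triangle \<le> 1"
  interpret hunted_graph "{..<3}" triangle
    using hunted_graph_instance[OF triangle_instance] by simp
  obtain S where S: "good_strategy b 1 S" using le game_number_le_iff by blast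
  have "contaminated {..<3} triangle S j = {..<3}" if "j \<le> length S" for j
    using that
  proof (induction j)
    case (Suc j)
    have "S ! j \<in> set S" using Suc.prems by simp
    then have Sj: "card (S ! j) \<le> 1" "S ! j \<subseteq> {..<3}"
      using S unfolding good_strategy_def hunter_strategy_def by auto
    have "\<exists>y\<in>{..<3} - S ! j. triangle x y" if x: "x < 3" for x
    proof (rule ccontr)
      assume "\<not> (\<exists>y\<in>{..<3} - S ! j. triangle x y)"
      then have "{..<3} - {x} \<subseteq> S ! j" using x by (auto simp: triangle_def)
      then have "card ({..<3} - {x}) \<le> card (S ! j)"
        using Sj(2) finite_V by (meson card_mono finite_subset)
      then show False using x Sj(1) by simp
    qed
    then have "{..<3} \<subseteq> contaminated {..<3} triangle S (Suc j)" using Suc by auto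
    then show ?case using contaminated_subset_V[of S "Suc j"] by blast
  qed simp
  then have "contaminated {..<3} triangle S (length S) = {..<3}" by simp
  moreover have "contaminated {..<3} triangle S (length S) = {}"
    using S unfolding good_strategy_def winning_iff by blast
  ultimately show False by (metis lessThan_empty_iff zero_neq_numeral)
qed

lemma runs_yes_com:
  "runs yes_com 15 s (\<lambda>s'. stores_instance s' 1 (\<lambda>_ _. False) 1 0)"
proof -
  have "runs yes_com (3 + (3 + (3 + 3 + 1) + 1) + 1) s (\<lambda>s'. stores_instance s' 1 (\<lambda>_ _. False) 1 0)"
    unfolding yes_com_def
    apply (rule runs_Seq[where P = "\<lambda>s'. s' ''n'' 0 = 1"])
    subgoal by (intro runs_Write) simp_all
    apply (rule runs_Seq[where P = "\<lambda>s'. s' ''n'' 0 = 1 \<and> s' ''k'' 0 = 1"])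
    subgoal by (intro runs_Write) simp_all
    apply (rule runs_Seq[where P = "\<lambda>s'. s' ''n'' 0 = 1 \<and> s' ''k'' 0 = 1 \<and> s' ''t'' 0 = 0"])
    subgoal by (intro runs_Write) simp_all
    by (intro runs_Write) (simp_all add: stores_instance_def)
  then show ?thesis by simp
qed

lemma runs_write_adjs_com:
  "runs (write_adjs_com z) (4 * z + 1) s (\<lambda>s'. (\<forall>a. a \<noteq> ''adj'' \<longrightarrow> s' a = s a) \<and>
     (\<forall>i<z. s' ''adj'' i = of_bool (i div 3 \<noteq> i mod 3)))"
proof (induction z)
  case 0
  show ?case using runs_Skip by simp
next
  case (Suc z)
  have "runs (write_adjs_com (Suc z)) (4 * z + 1 + 3 + 1) s (\<lambda>s'. (\<forall>a. a \<noteq> ''adj'' \<longrightarrow> s' a = s a) \<and>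
     (\<forall>i<Suc z. s' ''adj'' i = of_bool (i div 3 \<noteq> i mod 3)))"
    unfolding write_adjs_com.simps
    by (rule runs_Seq[OF Suc], rule runs_Write) (auto simp: less_Suc_eq)
  then show ?case by (rule runs_le) simp
qed

lemma runs_no_com:
  "runs no_com 49 s (\<lambda>s'. stores_instance s' 3 triangle 1 2)"
proof -
  have stores: "stores_instance s' 3 triangle 1 2"
    if adj: "\<forall>i<9. s' ''adj'' i = of_bool (i div 3 \<noteq> i mod 3)"
      and "s' ''n'' 0 = 3" "s' ''k'' 0 = 1" "s' ''t'' 0 = 2" for s'
  proof -
    have "s' ''adj'' (u * 3 + v) = (if triangle u v then 1 else 0)" if "u < 3" "v < 3" for u v
    proof -
      have "u * 3 + v < 9" using that by simp
      then have "s' ''adj'' (u * 3 + v) = of_bool ((u * 3 + v) div 3 \<noteq> (u * 3 + v) mod 3)"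
        using adj by blast
      then show ?thesis using that by (simp add: triangle_def)
    qed
    with that show ?thesis unfolding stores_instance_def by blast
  qed
  have "runs no_com (3 + (3 + (3 + (4 * 9 + 1) + 1) + 1) + 1) s (\<lambda>s'. stores_instance s' 3 triangle 1 2)"
    unfolding no_com_def
    apply (rule runs_Seq[where P = "\<lambda>s'. s' ''n'' 0 = 3"])
    subgoal by (intro runs_Write) simp_all
    apply (rule runs_Seq[where P = "\<lambda>s'. s' ''n'' 0 = 3 \<and> s' ''k'' 0 = 1"])
    subgoal by (intro runs_Write) simp_all
    apply (rule runs_Seq[where P = "\<lambda>s'. s' ''n'' 0 = 3 \<and> s' ''k'' 0 = 1 \<and> s' ''t'' 0 = 2"])
    subgoal by (intro runs_Write) simp_all
    by (rule runs_mono[OF runs_write_adjs_com order_refl], rule stores) simp_all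
  then show ?thesis by simp
qed

lemma runs_keep_com:
  "runs keep_com 12 s (\<lambda>s'. s' = s(''k'' := (s ''k'')(0 := min (s ''k'' 0) (s ''t'' 0 + 1))))"
  unfolding keep_com_def by (intro runs_Write) (auto simp: min_def)

lemma cap_power_table:
  assumes f: "f ''n'' 0 = n" "f ''t'' 0 = t" "f ''F'' = zeros" "f ''var'' = zeros" "tables_le M f"
    and M: "n + 2 \<le> M"
  obtains f' where "filled ''F'' (TAdd t_tm (TConst 1)) cap_power_tm M f f'"
    "f' ''F'' t = min (4 ^ t) (n + 1)" "\<And>a. a \<noteq> ''F'' \<Longrightarrow> f' a = f a" "tables_le M f'"
    "f' ''var'' = zeros"
proof -
  define h :: "nat \<Rightarrow> nat" where "h = (\<lambda>i. min (4 ^ i) (n + 1))"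
  have entry: "tval s cap_power_tm (zeros(0 := i)) = h i"
    if s: "\<And>a. a \<noteq> ''F'' \<Longrightarrow> s a = f a" "\<And>j. j < i \<Longrightarrow> s ''F'' j = h j"
      "\<And>j. i \<le> j \<Longrightarrow> s ''F'' j = f ''F'' j" for i s
  proof (cases i)
    case 0
    then have "s ''F'' 0 = 0" using s(3)[of 0] f(3) by (simp add: zeros_def)
    then show ?thesis using 0 s(1) f(1) by (simp add: cap_power_tm_def Let_def n_tm_def h_def)
  next
    case (Suc j)
    then have "s ''F'' j = h j" using s(2) by simp
    \<comment> \<open>Capping before the multiplication loses nothing, because 4m is capped to m
      again.\<close>
    moreover have "4 * min x m - (4 * min x m - m) = min (4 * x) m" for x m :: nat
      by (simp add: min_def)
    ultimately show ?thesis using Suc s(1) f(1) by (simp add: cap_power_tm_def Let_def n_tm_def h_def)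
  qed
  have size: "tval f (TAdd t_tm (TConst 1)) zeros = t + 1" using f(2) by (simp add: t_tm_def)
  have le: "h i \<le> M" for i using M by (simp add: h_def)
  obtain f' where f': "filled ''F'' (TAdd t_tm (TConst 1)) cap_power_tm M f f'"
    "\<And>i. i < t + 1 \<Longrightarrow> f' ''F'' i = h i" "\<And>a. a \<noteq> ''F'' \<Longrightarrow> f' a = f a"
    "tables_le M f'" "f' ''var'' = zeros"
  proof (rule filledI[OF f(4,5) size])
    show "computes ''F'' cap_power_tm h (t + 1) f" by (rule computesI) (simp, blast intro: entry)
    show "\<forall>i<t + 1. h i \<le> M" using le by blast
  qed blast
  moreover have "f' ''F'' t = min (4 ^ t) (n + 1)" using f'(2)[of t] by (simp add: h_def)
  ultimately show ?thesis using that by blast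
qed

lemma large_table:
  assumes f: "f ''n'' 0 = n" "f ''t'' 0 = t" "f ''F'' t = min (4 ^ t) (n + 1)" "f ''var'' = zeros"
    "tables_le M f" and M: "n + 2 \<le> M"
  obtains f' where "filled ''g'' (TConst 1) large_tm M f f'"
    "f' ''g'' 0 = of_bool (4 ^ t \<le> n)" "\<And>a. a \<noteq> ''g'' \<Longrightarrow> f' a = f a" "tables_le M f'"
    "f' ''var'' = zeros"
proof -
  have entry: "tval s large_tm (zeros(0 := i)) = of_bool (4 ^ t \<le> n)"
    if s: "\<And>a. a \<noteq> ''g'' \<Longrightarrow> s a = f a" for i s
    using s f(1-3) by (auto simp: large_tm_def t_tm_def n_tm_def)
  have size: "tval f (TConst 1) zeros = 1" by simp
  obtain f' where f': "filled ''g'' (TConst 1) large_tm M f f'"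
    "\<And>i. i < 1 \<Longrightarrow> f' ''g'' i = of_bool (4 ^ t \<le> n)" "\<And>a. a \<noteq> ''g'' \<Longrightarrow> f' a = f a"
    "tables_le M f'" "f' ''var'' = zeros"
  proof (rule filledI[OF f(4,5) size])
    show "computes ''g'' large_tm (\<lambda>_. of_bool (4 ^ t \<le> n)) 1 f"
      by (rule computesI) (simp, rule entry, assumption)
    show "\<forall>i<1. of_bool (4 ^ t \<le> n) \<le> M" using M by simp
  qed blast
  moreover have "f' ''g'' 0 = of_bool (4 ^ t \<le> n)" using f'(2)[of 0] by simp
  ultimately show ?thesis using that by blast
qed

text \<open>From n + t + 2 \<le> 3 (n + t) comes the factor 9 per power; 9^q then serves as constant
  and as exponent, since 2q \<le> 9^q.\<close>

lemma kernel_time_bound: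
  fixes n t q :: nat
  assumes "n > 0"
  shows "((n + t + 2) * (n + t + 2)) ^ q \<le> 9 ^ q * (n + t) ^ 9 ^ q"
proof -
  have "n + t + 2 \<le> 3 * (n + t)" using assms by simp
  then have "(n + t + 2) * (n + t + 2) \<le> 3 * (n + t) * (3 * (n + t))" by (intro mult_le_mono)
  then have "((n + t + 2) * (n + t + 2)) ^ q \<le> (3 * (n + t) * (3 * (n + t))) ^ q"
    by (rule power_mono) simp
  also have "3 * (n + t) * (3 * (n + t)) = 9 * (n + t) ^ 2"
    by (simp add: power2_eq_square algebra_simps)
  also have "(9 * (n + t) ^ 2) ^ q = 9 ^ q * (n + t) ^ (2 * q)"
    by (simp only: power_mult_distrib power_mult)
  also have "\<dots> \<le> 9 ^ q * (n + t) ^ 9 ^ q"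
  proof (intro mult_le_mono power_increasing order_refl)
    show "2 * q \<le> 9 ^ q"
    proof (induction q)
      case (Suc q)
      have "1 \<le> (9 :: nat) ^ q" by simp
      then show ?case using Suc unfolding power_Suc mult_Suc_right by linarith
    qed simp
  qed (use assms in simp_all)
  finally show ?thesis .
qed

lemma stores_instance_cong:
  "stores_instance s n E k t \<Longrightarrow> s' ''n'' = s ''n'' \<Longrightarrow> s' ''t'' = s ''t'' \<Longrightarrow> s' ''adj'' = s ''adj'' \<Longrightarrow>
     stores_instance s' n E (s' ''k'' 0) t"
  by (simp add: stores_instance_def)

lemma kernel: "admits_kernel (game_number b) (\<lambda>t. 4 ^ t * (t + 1) + 2 * t)"
proof -
  \<comment> \<open>The solver runs in either case. If the guard \<open>g\<close> is 0, its
    exponential tables are empty and it stays cheap.\<close>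
  define main where "main = Seq (fill ''F'' (TAdd t_tm (TConst 1)) cap_power_tm)
     (Seq (fill ''g'' (TConst 1) large_tm) (solver b))"
  define rel where "rel = (\<lambda>M f1 f4. \<exists>f2. filled ''F'' (TAdd t_tm (TConst 1)) cap_power_tm M f1 f2 \<and>
     (\<exists>f3. filled ''g'' (TConst 1) large_tm M f2 f3 \<and> solver_tables_rel b M f3 f4))"
  have "implements main rel"
    unfolding main_def rel_def
    by (intro implements_Seq implements_filled implements_solver_tables_rel)
      (simp_all add: t_tm_def cap_power_tm_def large_tm_def n_tm_def Let_def)
  then obtain e where e: "\<And>M f f' s. 2 \<le> M \<Longrightarrow> rel M f f' \<Longrightarrow> agree f s \<Longrightarrow> runs main (M ^ e) s (agree f')"
    by (rule implementsE) blast
  let ?q = "e + 7 + 1" and ?f = "\<lambda>t. 4 ^ t * (t + 1) + 2 * t"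
  let ?c = "9 ^ ?q"
  have "runs (kernel_com b) (?c * (n + t) ^ ?c) (input_state n E k t)
      (\<lambda>s'. \<exists>n' E' k' t'. stores_instance s' n' E' k' t' \<and> is_instance n' E' k' t' \<and>
           (game_number b {..<n'} E' \<le> k' \<longleftrightarrow> game_number b {..<n} E \<le> k) \<and>
           n' \<le> ?f t \<and> k' \<le> ?f t \<and> t' \<le> t)" if inst: "is_instance n E k t" for n E k t
  proof -
    let ?Q = "\<lambda>s'. \<exists>n' E' k' t'. stores_instance s' n' E' k' t' \<and> is_instance n' E' k' t' \<and>
           (game_number b {..<n'} E' \<le> k' \<longleftrightarrow> game_number b {..<n} E \<le> k) \<and>
           n' \<le> ?f t \<and> k' \<le> ?f t \<and> t' \<le> t"
    \<comment> \<open>If 4^t \<le> n, the number of codes is at most 16^t \<le> n^2 \<le> M;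
      otherwise only n + 2 \<le> M is required.\<close>
    define M where "M = (n + t + 2) * (n + t + 2)"
    have "n + t + 2 \<le> M" unfolding M_def by simp
    then have M: "2 \<le> M" "n + 2 \<le> M" "1 \<le> M" "n \<le> M" "n + 1 \<le> M" "t \<le> M" by simp_all
    have M_codes: "4 ^ t * 4 ^ t \<le> M" if "4 ^ t \<le> n"
      unfolding M_def using that by (intro mult_le_mono) simp_all
    let ?s0 = "input_state n E k t"
    define s1 where "s1 = ?s0(''kk'' := (?s0 ''kk'')(0 := min k (n + 1)))"
    have tables: "tables_le M s1"
      unfolding s1_def using M by (intro tables_le_upd tables_le_input_state) simp_all
    have s1: "s1 ''n'' 0 = n" "s1 ''t'' 0 = t" "s1 ''k'' 0 = k" "s1 ''F'' = zeros" "s1 ''var'' = zeros"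
      "s1 ''p'' = zeros" "s1 ''kk'' 0 = min k (n + 1)"
      "\<And>z. z < n * n \<Longrightarrow> s1 ''adj'' z = of_bool (E (z div n) (z mod n))"
      unfolding s1_def by (simp_all add: input_state_simps)
    obtain f2 where f2: "filled ''F'' (TAdd t_tm (TConst 1)) cap_power_tm M s1 f2"
      "f2 ''F'' t = min (4 ^ t) (n + 1)" "\<And>a. a \<noteq> ''F'' \<Longrightarrow> f2 a = s1 a" "tables_le M f2"
      "f2 ''var'' = zeros"
      using s1(1,2,4,5) tables M(2) by (rule cap_power_table) blast
    have f2_nt: "f2 ''n'' 0 = n" "f2 ''t'' 0 = t" using f2(3) s1 by simp_all
    obtain f3 where f3: "filled ''g'' (TConst 1) large_tm M f2 f3"
      "f3 ''g'' 0 = of_bool (4 ^ t \<le> n)" "\<And>a. a \<noteq> ''g'' \<Longrightarrow> f3 a = f2 a" "tables_le M f3"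
      "f3 ''var'' = zeros"
      using f2_nt f2(2,5,4) M(2) by (rule large_table) blast
    have f3': "f3 ''n'' 0 = n" "\<And>z. z < n * n \<Longrightarrow> f3 ''adj'' z = of_bool (E (z div n) (z mod n))"
      "f3 ''kk'' 0 = min k (n + 1)" "f3 ''p'' = zeros"
      using f2(3) f3(3) s1 by simp_all
    obtain f4 where f4: "solver_tables_rel b M f3 f4"
      "4 ^ t \<le> n \<Longrightarrow> f4 ''out'' 0 \<noteq> 0 \<longleftrightarrow> game_number b {..<n} E \<le> k"
      "\<And>a. a \<notin> {''c'', ''r'', ''p'', ''N'', ''z'', ''R'', ''out''} \<Longrightarrow> f4 a = f3 a"
      using inst M(2) M_codes f3'(1,2,3) f3(2,5) f3'(4) f3(4) by (rule solver_correct[where b = b]) (assumption, assumption, rule that, assumption, simp, simp)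
    have rel: "rel M s1 f4" unfolding rel_def using f2(1) f3(1) f4(1) by blast
    have f4': "f4 ''n'' = s1 ''n''" "f4 ''t'' = s1 ''t''" "f4 ''k'' = s1 ''k''" "f4 ''adj'' = s1 ''adj''"
      "f4 ''g'' 0 = of_bool (4 ^ t \<le> n)"
      using f2(3) f3(2,3) f4(3) by simp_all
    have stores: "stores_instance s1 n E k t"
      using stores_input_state[of n E k t] by (simp add: stores_instance_def s1_def)
    have f_ge: "t + 1 \<le> ?f t" "4 ^ t \<le> ?f t"
      using mult_le_mono[of 1 "4 ^ t" "t + 1" "t + 1"] by simp_all
    have k1: "k \<ge> 1" using inst by (simp add: is_instance_def)
    have yes: "?Q s'" if "stores_instance s' 1 (\<lambda>_ _. False) 1 0" and le: "game_number b {..<n} E \<le> k" for s'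
    proof -
      have "game_number b {..<1::nat} (\<lambda>_ _. False) \<le> 1"
        by (simp only: game_number_singleton le0)
      moreover have "1 \<le> ?f t" using f_ge(1) by linarith
      ultimately show ?thesis using that singleton_instance by blast
    qed
    \<comment> \<open>A negative answer means that the game number exceeds k \<ge> 1. Being at most
      t, it forces t \<ge> 2, so the triangle respects the bound on the parameter, and its size 3 is
      at most t + 1.\<close>
    have no: "?Q s'" if "stores_instance s' 3 triangle 1 2" and gt: "\<not> game_number b {..<n} E \<le> k" for s'
    proof -
      have "t \<ge> 2" using game_number_le_parameter(1)[OF inst, of b] k1 gt by linarith
      moreover from this have "3 \<le> ?f t" "1 \<le> ?f t" using f_ge(1) by linarith+
      ultimately show ?thesis using that triangle_instance triangle_game_number[of b] by blast
    qed
    \<comment> \<open>The graph and t are returned unchanged. Since the game number is at most t,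
      the cap t + 1 on k preserves the answer and makes k' bounded in terms of t.\<close>
    have keep: "?Q s'" if small: "n \<le> 4 ^ t" and "stores_instance s' n E (min k (t + 1)) t" for s'
    proof -
      have "is_instance n E (min k (t + 1)) t" using inst by (simp add: is_instance_def)
      moreover have "game_number b {..<n} E \<le> min k (t + 1) \<longleftrightarrow> game_number b {..<n} E \<le> k"
        using game_number_le_parameter(1)[OF inst, of b] by auto
      moreover have "n \<le> ?f t" "min k (t + 1) \<le> ?f t" using small f_ge by linarith+
      ultimately show ?thesis using that by blast
    qed
    have out: "runs output_com 55 s4 ?Q" if s4: "agree f4 s4" for s4
    proof -
      have s4': "s4 ''g'' 0 = of_bool (4 ^ t \<le> n)" "s4 ''out'' 0 = f4 ''out'' 0" "s4 ''n'' = s1 ''n''"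
        "s4 ''t'' = s1 ''t''" "s4 ''k'' = s1 ''k''" "s4 ''adj'' = s1 ''adj''"
        using s4 f4' by (simp_all add: agree_def)
      have "runs output_com (exp_time (scalar ''g'') + (exp_time (scalar ''out'') + 49 + 1) + 1) s4 ?Q"
        unfolding output_com_def
      proof (rule runs_Cond)
        assume "aval (scalar ''g'') s4 \<noteq> 0"
        then have large: "4 ^ t \<le> n" using s4'(1) by simp
        show "runs (Cond (scalar ''out'') yes_com no_com) (exp_time (scalar ''out'') + 49 + 1) s4 ?Q"
        proof (rule runs_Cond)
          assume "aval (scalar ''out'') s4 \<noteq> 0"
          then have "game_number b {..<n} E \<le> k" using f4(2)[OF large] s4'(2) by simp
          from yes[OF _ this] show "runs yes_com 49 s4 ?Q" by (rule runs_mono[OF runs_yes_com, rotated]) simp_all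
        next
          assume "aval (scalar ''out'') s4 = 0"
          then have "\<not> game_number b {..<n} E \<le> k" using f4(2)[OF large] s4'(2) by simp
          from no[OF _ this] show "runs no_com 49 s4 ?Q" by (rule runs_mono[OF runs_no_com, rotated]) simp_all
        qed
      next
        assume "aval (scalar ''g'') s4 = 0"
        then have small: "n \<le> 4 ^ t" using s4'(1) by (simp split: if_splits)
        have "?Q s'" if s': "s' = s4(''k'' := (s4 ''k'')(0 := min (s4 ''k'' 0) (s4 ''t'' 0 + 1)))" for s'
        proof (rule keep[OF small])
          have "s' ''k'' 0 = min k (t + 1)" using s' s4' s1 by simp
          moreover have "s' ''n'' = s1 ''n''" "s' ''t'' = s1 ''t''" "s' ''adj'' = s1 ''adj''"
            using s' s4' by simp_all
          ultimately show "stores_instance s' n E (min k (t + 1)) t"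
            using stores_instance_cong[OF stores, of s'] by simp
        qed
        then show "runs keep_com (exp_time (scalar ''out'') + 49 + 1) s4 ?Q"
          by (rule runs_mono[OF runs_keep_com, rotated]) simp_all
      qed
      then show ?thesis by simp
    qed
    have run: "runs (kernel_com b) (12 + (M ^ e + 55 + 1) + 1) ?s0 ?Q"
      unfolding kernel_com_def main_def[symmetric]
    proof (rule runs_Seq)
      show "runs cap_com 12 ?s0 (\<lambda>s. s = s1)"
        using runs_cap_com[of ?s0] by (simp add: s1_def input_state_simps)
      fix s1' assume "s1' = s1"
      then have "agree s1 s1'" by (simp add: agree_def)
      from e[OF M(1) rel this] out
      show "runs (Seq main output_com) (M ^ e + 55 + 1) s1' ?Q" by (rule runs_Seq)
    qed
    have "12 + (M ^ e + 55 + 1) + 1 \<le> M ^ ?q"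
      using power_add_le[OF M(1), of e 7] power_mono[OF M(1), of 7] by simp
    also have "\<dots> \<le> ?c * (n + t) ^ ?c"
      unfolding M_def using is_instance_pos[OF inst] by (rule kernel_time_bound)
    finally show ?thesis by (rule runs_le[OF run])
  qed
  note run = this
  show ?thesis
    unfolding admits_kernel_def
  proof (rule exI[of _ "kernel_com b"], rule exI[of _ ?c], intro allI impI)
    fix n E k t assume inst: "is_instance n E k t"
    from run[OF inst] show "\<exists>T s' n' E' k' t'. exec (kernel_com b) (input_state n E k t) T s' \<and>
        T \<le> ?c * (n + t) ^ ?c \<and> stores_instance s' n' E' k' t' \<and> is_instance n' E' k' t' \<and>
        (game_number b {..<n'} E' \<le> k' \<longleftrightarrow> game_number b {..<n} E \<le> k) \<and>
        n' \<le> ?f t \<and> k' \<le> ?f t \<and> t' \<le> t"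
      unfolding runs_def by (simp only: ex_simps)
  qed
qed

theorem theorem6p4:
  shows "admits_kernel hunter_number (\<lambda>t. 4 ^ t * (t + 1) + 2 * t) \<and>
         admits_kernel monotone_hunter_number (\<lambda>t. 4 ^ t * (t + 1) + 2 * t) \<and>
         solvable_in_fpt_time hunter_number (\<lambda>t. (4 ^ t * (t + 1) + 2 * t) ^ (t + 1)) \<and>
         solvable_in_fpt_time monotone_hunter_number (\<lambda>t. (4 ^ t * (t + 1) + 2 * t) ^ (t + 1))"
proof -
  have eqs: "game_number False = (hunter_number :: nat set \<Rightarrow> _)"
    "game_number True = (monotone_hunter_number :: nat set \<Rightarrow> _)"
    by (simp_all add: game_number_def fun_eq_iff)
  show ?thesis
    using kernel[of False] kernel[of True] solvable[of False] solvable[of True] unfolding eqs by blast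
qed

end
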